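(* Let $\mathcal X$ be a geometric $G$-crystal on $(X,\gamma)$, given by rational actions $e_i:\mathbb G_m\times X\to X$, $i\in I$. For $w\in W$ let $e_w:T\times X\to X$, $(t,x)\mapsto e_w^t(x)$, be the rational morphism $e_w:=e_{\mathbf i}$ for any $\mathbf i\in R(w)$ (this is independent of $\mathbf i$ by the definition of a geometric crystal). Then the correspondence $W\times X\to X$ given by $$(w,x)\mapsto w(x)=e_w^{\gamma(x)^{-1}}(x)$$ is a rational unital action of $W$ on $X$.
   Context: $G$ is a split reductive algebraic group over $\mathbb Q$, $T\subset G$ a (split) maximal torus, $B\supset T$ a Borel subgroup, $I$ the set of vertices of the Dynkin diagram, $\alpha_i:T\to\mathbb G_m$ and $\alpha_i^\vee:\mathbb G_m\to T$ ($i\in I$) the simple roots and coroots, $W=\mathrm{Norm}_G(T)/T$ the Weyl group with simple reflections $s_i$. For $w\in W$, $R(w)$ is the set of reduced sequences $\mathbf i=(i_1,\dots,i_l)$ with $s_{i_1}\cdots s_{i_l}=w$, $l=l(w)$. For a rational morphism $\mathbf f$, $\mathrm{dom}(\mathbf f)$ is its maximal open domain of definition. A rational action $\alpha:H\times X\to X$ of an algebraic group $H$ is called unital if $\mathrm{dom}(\alpha)\supset\{e\}\times X$. Let $X$ be an irreducible algebraic variety over $\mathbb Q$ and $\gamma:X\to T$ a rational morphism. A geometric $G$-pre-crystal on $(X,\gamma)$ is a family of unital rational actions $e_i:\mathbb G_m\times X\to X$, $(c,x)\mapsto e_i^c(x)$, $i\in I$, such that $\gamma(e_i^c(x))=\alpha_i^\vee(c)\gamma(x)$.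 For a reduced sequence $\mathbf i=(i_1,\dots,i_l)$ define the rational morphism $e_{\mathbf i}:T\times X\to X$ by $$e_{\mathbf i}^t(x)=e_{i_1}^{\alpha^{(1)}(t)}\circ\cdots\circ e_{i_l}^{\alpha^{(l)}(t)}(x),\qquad \alpha^{(k)}=s_{i_l}s_{i_{l-1}}\cdots s_{i_{k+1}}(\alpha_{i_k}).$$ A geometric pre-crystal is a geometric crystal if $e_{\mathbf i}=e_{\mathbf i'}$ for every $w\in W$ and all $\mathbf i,\mathbf i'\in R(w)$. *)

theory Defs
  imports "HOL-Analysis.Analysis" "HOL-Algebra.Coset" "HOL-Algebra.Generated_Groups" "HOL-Algebra.Group_Action" "HOL-Algebra.Solvable_Groups"
begin

text \<open>
  Varieties over \<open>\<rat>\<close> are treated in the language of points with values in the universal domain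
  \<open>\<complex>\<close>: a reduced separated scheme \<open>X\<close> of finite type over \<open>\<rat>\<close> is determined by the set
  \<open>X(\<complex>)\<close>, its Zariski topology \<^emph>\<open>over\<close> \<open>\<rat>\<close> and its sheaf of \<open>\<complex>\<close>-valued regular functions
  \<^emph>\<open>with rational coefficients\<close>, and morphisms of \<open>\<rat>\<close>-schemes are the maps of
  \<open>\<complex>\<close>-points that pull regular functions back to regular functions.  Closed
  subsets, density and irreducibility of varieties below therefore refer to the \<open>\<rat>\<close>-topology,
  in which \<open>X(\<complex>)\<close> is irreducible iff the scheme \<open>X\<close> is.
\<close>


section \<open>Varieties over the rationals\<close>

text \<open>\<open>polyfun k F\<close> is the \<open>k\<close>-algebra of functions generated by \<open>F\<close>; it is used for
  \<open>k = \<rat>\<close> and \<open>k = UNIV\<close>.\<close>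

inductive_set polyfun :: "complex set \<Rightarrow> ('a \<Rightarrow> complex) set \<Rightarrow> ('a \<Rightarrow> complex) set"
  for k F where
  const: "c \<in> k \<Longrightarrow> (\<lambda>_. c) \<in> polyfun k F"
| gen: "f \<in> F \<Longrightarrow> f \<in> polyfun k F"
| add: "f \<in> polyfun k F \<Longrightarrow> g \<in> polyfun k F \<Longrightarrow> (\<lambda>x. f x + g x) \<in> polyfun k F"
| mult: "f \<in> polyfun k F \<Longrightarrow> g \<in> polyfun k F \<Longrightarrow> (\<lambda>x. f x * g x) \<in> polyfun k F"

text \<open>An affine chart is a set \<open>U\<close> with finitely many functions \<open>F\<close> generating the coordinate
  ring \<open>\<rat>[U] = polyfun \<rat> F\<close> (functions being compared on \<open>U\<close> only).
  It is affine if \<open>U \<rightarrow> Hom(\<rat>[U], \<complex>)\<close> is bijective, i.e. if \<open>F\<close> identifies \<open>U\<close> with the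
  complex zero set of a set of polynomials with rational coefficients.\<close>

definition algebra_hom :: "'a set \<Rightarrow> ('a \<Rightarrow> complex) set \<Rightarrow> (('a \<Rightarrow> complex) \<Rightarrow> complex) \<Rightarrow> bool" where
  "algebra_hom U F h \<longleftrightarrow>
     (\<forall>f\<in>polyfun \<rat> F. \<forall>g\<in>polyfun \<rat> F.
        h (\<lambda>x. f x + g x) = h f + h g \<and> h (\<lambda>x. f x * g x) = h f * h g \<and>
        ((\<forall>x\<in>U. f x = g x) \<longrightarrow> h f = h g)) \<and>
     (\<forall>c\<in>\<rat>. h (\<lambda>_. c) = c)"

definition affine_chart :: "'a set \<Rightarrow> ('a \<Rightarrow> complex) set \<Rightarrow> bool" where
  "affine_chart U F \<longleftrightarrow> finite F \<and>
     (\<forall>h. algebra_hom U F h \<longrightarrow> (\<exists>!x. x \<in> U \<and> (\<forall>f\<in>polyfun \<rat> F. h f = f x)))"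

record 'a var =
  pts :: "'a set"
  atlas :: "('a set \<times> ('a \<Rightarrow> complex) set) set"

definition zariski_open :: "('a, 'm) var_scheme \<Rightarrow> 'a set \<Rightarrow> bool" where
  "zariski_open X V \<longleftrightarrow> V \<subseteq> pts X \<and>
     (\<forall>(U, F)\<in>atlas X. \<forall>x\<in>U \<inter> V. \<exists>q\<in>polyfun \<rat> F. q x \<noteq> 0 \<and> {y\<in>U. q y \<noteq> 0} \<subseteq> V)"

definition zariski_dense :: "('a, 'm) var_scheme \<Rightarrow> 'a set \<Rightarrow> bool" where
  "zariski_dense X S \<longleftrightarrow> (\<forall>V. zariski_open X V \<and> V \<noteq> {} \<longrightarrow> S \<inter> V \<noteq> {})"

definition irreducible_var :: "('a, 'm) var_scheme \<Rightarrow> bool" where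
  "irreducible_var X \<longleftrightarrow> pts X \<noteq> {} \<and>
     (\<forall>U V. zariski_open X U \<and> zariski_open X V \<and> U \<noteq> {} \<and> V \<noteq> {} \<longrightarrow> U \<inter> V \<noteq> {})"

definition prod_var :: "('a, 'm) var_scheme \<Rightarrow> ('b, 'n) var_scheme \<Rightarrow> ('a \<times> 'b) var"
  (infixr "\<times>\<^sub>v" 80) where
  "X \<times>\<^sub>v Y = \<lparr>pts = pts X \<times> pts Y,
     atlas = {(U \<times> V, (\<lambda>f. f \<circ> fst) ` F \<union> (\<lambda>g. g \<circ> snd) ` H) | U F V H.
                (U, F) \<in> atlas X \<and> (V, H) \<in> atlas Y}\<rparr>"

text \<open>Clauses: finite cover by affine charts; the charts overlap in open sets and
  coordinate changes are regular; the diagonal is closed (separatedness).\<close>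

definition variety :: "('a, 'm) var_scheme \<Rightarrow> bool" where
  "variety X \<longleftrightarrow>
     finite (atlas X) \<and> \<Union>(fst ` atlas X) = pts X \<and>
     (\<forall>(U, F)\<in>atlas X. affine_chart U F) \<and>
     (\<forall>(U, F)\<in>atlas X. \<forall>(V, H)\<in>atlas X. \<forall>x\<in>U \<inter> V.
        \<exists>q\<in>polyfun \<rat> F. q x \<noteq> 0 \<and> {y\<in>U. q y \<noteq> 0} \<subseteq> V \<and>
          (\<forall>g\<in>H. \<exists>p\<in>polyfun \<rat> F. \<forall>y\<in>U. q y \<noteq> 0 \<longrightarrow> g y = p y / q y)) \<and>
     zariski_open (X \<times>\<^sub>v X) {(x, y). x \<in> pts X \<and> y \<in> pts X \<and> x \<noteq> y}"


section \<open>Rational morphisms\<close>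

text \<open>\<open>f\<close> is a morphism over \<open>\<rat>\<close> from \<open>dom f\<close> (which is then open) to \<open>Y\<close>: locally on the
  source it maps a principal open subset of a chart into a chart, the
  coordinates of the image being quotients \<open>p / q\<close>.\<close>

definition regular_map :: "('a, 'm) var_scheme \<Rightarrow> ('b, 'n) var_scheme \<Rightarrow> ('a \<rightharpoonup> 'b) \<Rightarrow> bool" where
  "regular_map X Y f \<longleftrightarrow> dom f \<subseteq> pts X \<and>
     (\<forall>x\<in>dom f. \<exists>(U, F)\<in>atlas X. \<exists>(V, H)\<in>atlas Y. \<exists>q\<in>polyfun \<rat> F.
        x \<in> U \<and> q x \<noteq> 0 \<and>
        (\<forall>y\<in>U. q y \<noteq> 0 \<longrightarrow> (\<exists>z\<in>V. f y = Some z)) \<and>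
        (\<forall>g\<in>H. \<exists>p\<in>polyfun \<rat> F. \<forall>y\<in>U. q y \<noteq> 0 \<longrightarrow> g (the (f y)) = p y / q y))"

text \<open>Two partially defined maps define the same rational morphism. Note that this forces both
  of them to be defined on a common dense open set; in particular, for a composite
  it includes the claim that the composite is well defined as a rational morphism.\<close>

definition rat_equiv :: "('a, 'm) var_scheme \<Rightarrow> ('a \<rightharpoonup> 'b) \<Rightarrow> ('a \<rightharpoonup> 'b) \<Rightarrow> bool" where
  "rat_equiv X f g \<longleftrightarrow>
     (\<exists>D. zariski_open X D \<and> zariski_dense X D \<and> D \<subseteq> dom f \<inter> dom g \<and> (\<forall>x\<in>D. f x = g x))"

text \<open>A rational morphism is represented by its unique representative with maximal
  domain of definition, so that \<open>dom f\<close> is the maximal open domain of definition and equality of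
  rational morphisms is equality of partial functions.\<close>

definition rational_map :: "('a, 'm) var_scheme \<Rightarrow> ('b, 'n) var_scheme \<Rightarrow> ('a \<rightharpoonup> 'b) \<Rightarrow> bool" where
  "rational_map X Y f \<longleftrightarrow> regular_map X Y f \<and> zariski_dense X (dom f) \<and>
     (\<forall>g. regular_map X Y g \<and> rat_equiv X f g \<longrightarrow> g \<subseteq>\<^sub>m f)"

text \<open>The maximal representative of the rational morphism given by \<open>f\<close>; it is
  nowhere defined if \<open>f\<close> does not define a rational morphism.\<close>

definition rat_ext :: "('a, 'm) var_scheme \<Rightarrow> ('b, 'n) var_scheme \<Rightarrow> ('a \<rightharpoonup> 'b) \<Rightarrow> ('a \<rightharpoonup> 'b)" where
  "rat_ext X Y f = (\<lambda>x.
     let P = (\<lambda>y. \<exists>g. regular_map X Y g \<and> rat_equiv X f g \<and> g x = Some y)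
     in if \<exists>y. P y then Some (THE y. P y) else None)"


section \<open>Rational actions\<close>

text \<open>Algebraic groups over \<open>\<rat>\<close>, as far as they act on varieties.\<close>

record 'a var_group = "'a var" +
  gmult :: "'a \<Rightarrow> 'a \<Rightarrow> 'a"
  gone :: "'a"

definition Gm :: "complex var_group" where
  "Gm = \<lparr>pts = - {0}, atlas = {(- {0}, {\<lambda>z. z, inverse})}, gmult = (*), gone = 1\<rparr>"

text \<open>An abstract (in practice finite) group as a constant algebraic group.\<close>

definition constant_group :: "('a, 'm) monoid_scheme \<Rightarrow> 'a var_group" where
  "constant_group W = \<lparr>pts = carrier W, atlas = {({w}, {}) | w. w \<in> carrier W},
     gmult = mult W, gone = one W\<rparr>"

definition rational_action ::
  "('h, 'm) var_group_scheme \<Rightarrow> ('x, 'k) var_scheme \<Rightarrow> ('h \<times> 'x \<rightharpoonup> 'x) \<Rightarrow> bool" where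
  "rational_action H X a \<longleftrightarrow>
     rational_map (H \<times>\<^sub>v X) X a \<and>
     (\<forall>x. (gone H, x) \<in> dom a \<longrightarrow> a (gone H, x) = Some x) \<and>
     rat_equiv (H \<times>\<^sub>v H \<times>\<^sub>v X)
       (\<lambda>(g, h, x). a (gmult H g h, x))
       (\<lambda>(g, h, x). Option.bind (a (h, x)) (\<lambda>y. a (g, y)))"

definition unital_rational_action ::
  "('h, 'm) var_group_scheme \<Rightarrow> ('x, 'k) var_scheme \<Rightarrow> ('h \<times> 'x \<rightharpoonup> 'x) \<Rightarrow> bool" where
  "unital_rational_action H X a \<longleftrightarrow> rational_action H X a \<and> {gone H} \<times> pts X \<subseteq> dom a"


section \<open>Split reductive groups\<close>

text \<open>Linear algebraic groups are given as closed subgroups of \<open>GL\<^sub>n\<close> by their sets of complex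
  points; \<open>k = \<rat>\<close> means ``defined over \<open>\<rat>\<close>'', \<open>k = UNIV\<close> means ``over \<open>\<complex>\<close>''.\<close>

definition mat_group :: "(complex^'n^'n) set \<Rightarrow> (complex^'n^'n) monoid" where
  "mat_group H = \<lparr>carrier = H, mult = (**), one = mat 1\<rparr>"

definition GL :: "(complex^'n^'n) set" where
  "GL = {A. invertible A}"

definition entries :: "(complex^'n^'n \<Rightarrow> complex) set" where
  "entries = {\<lambda>A. A $ i $ j | i j. True}"

definition coords :: "(complex^'n^'n \<Rightarrow> complex) set" where
  "coords = insert (\<lambda>A. inverse (det A)) entries"

definition closed_in_GL :: "complex set \<Rightarrow> (complex^'n^'n) set \<Rightarrow> bool" where
  "closed_in_GL k Z \<longleftrightarrow> (\<exists>S \<subseteq> polyfun k entries. Z = {A\<in>GL. \<forall>p\<in>S. p A = 0})"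

definition algebraic_group :: "complex set \<Rightarrow> (complex^'n^'n) set \<Rightarrow> bool" where
  "algebraic_group k H \<longleftrightarrow> subgroup H (mat_group GL) \<and> closed_in_GL k H"

definition mat_variety :: "(complex^'n^'n) set \<Rightarrow> (complex^'n^'n) var" where
  "mat_variety H = \<lparr>pts = H, atlas = {(H, coords)}\<rparr>"

definition connected_group :: "(complex^'n^'n) set \<Rightarrow> bool" where
  "connected_group H \<longleftrightarrow>
     \<not> (\<exists>Z1 Z2. closed_in_GL UNIV Z1 \<and> closed_in_GL UNIV Z2 \<and> H \<subseteq> Z1 \<union> Z2 \<and>
              H \<inter> Z1 \<inter> Z2 = {} \<and> H \<inter> Z1 \<noteq> {} \<and> H \<inter> Z2 \<noteq> {})"

definition unipotent :: "complex^'n^'n \<Rightarrow> bool" where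
  "unipotent A \<longleftrightarrow> (\<exists>m. (((**) (A - mat 1)) ^^ m) (mat 1) = 0)"

text \<open>Connected, with trivial unipotent radical.\<close>

definition reductive :: "(complex^'n^'n) set \<Rightarrow> bool" where
  "reductive G \<longleftrightarrow> connected_group G \<and>
     (\<forall>U. algebraic_group UNIV U \<and> connected_group U \<and> U \<lhd> mat_group G \<and>
          (\<forall>u\<in>U. unipotent u) \<longrightarrow> U = {mat 1})"

text \<open>Characters are kept extensional, so that they are equal iff they agree on \<open>T\<close>.\<close>

definition characters :: "complex set \<Rightarrow> (complex^'n^'n) set \<Rightarrow> (complex^'n^'n \<Rightarrow> complex) set" where
  "characters k T = {\<eta> \<in> extensional T.
     (\<exists>p\<in>polyfun k coords. \<forall>t\<in>T. \<eta> t = p t) \<and>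
     \<eta> (mat 1) = 1 \<and> (\<forall>s\<in>T. \<forall>t\<in>T. \<eta> (s ** t) = \<eta> s * \<eta> t)}"

definition cocharacters :: "complex set \<Rightarrow> (complex^'n^'n) set \<Rightarrow> (complex \<Rightarrow> complex^'n^'n) set" where
  "cocharacters k T = {l.
     (\<forall>c. c \<noteq> 0 \<longrightarrow> l c \<in> T) \<and>
     (\<forall>f\<in>entries. \<exists>p\<in>polyfun k {\<lambda>z. z, inverse}. \<forall>c. c \<noteq> 0 \<longrightarrow> f (l c) = p c) \<and>
     (\<forall>c d. c \<noteq> 0 \<and> d \<noteq> 0 \<longrightarrow> l (c * d) = l c ** l d)}"

text \<open>\<open>T\<close> is isomorphic over \<open>k\<close> to a power \<open>\<bbbG>\<^sub>m\<^sup>r\<close>: the \<open>\<eta> i\<close> are the components of an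
  isomorphism, and the last clause says that its inverse is a morphism.\<close>

definition split_torus :: "complex set \<Rightarrow> (complex^'n^'n) set \<Rightarrow> bool" where
  "split_torus k T \<longleftrightarrow> algebraic_group k T \<and>
     (\<exists>(r::nat) \<eta>. (\<forall>i<r. \<eta> i \<in> characters k T) \<and>
        bij_betw (\<lambda>t. \<lambda>i\<in>{..<r}. \<eta> i t) T ({..<r} \<rightarrow>\<^sub>E - {0}) \<and>
        (\<forall>f\<in>entries. \<exists>p\<in>polyfun k (\<Union>i<r. {\<eta> i, \<lambda>t. inverse (\<eta> i t)}). \<forall>t\<in>T. f t = p t))"

definition split_maximal_torus :: "(complex^'n^'n) set \<Rightarrow> (complex^'n^'n) set \<Rightarrow> bool" where
  "split_maximal_torus G T \<longleftrightarrow> split_torus \<rat> T \<and> T \<subseteq> G \<and>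
     (\<forall>S. split_torus UNIV S \<and> T \<subseteq> S \<and> S \<subseteq> G \<longrightarrow> S = T)"

definition borel_subgroup :: "(complex^'n^'n) set \<Rightarrow> (complex^'n^'n) set \<Rightarrow> bool" where
  "borel_subgroup G B \<longleftrightarrow> algebraic_group \<rat> B \<and> connected_group B \<and> solvable (mat_group B) \<and> B \<subseteq> G \<and>
     (\<forall>H. algebraic_group UNIV H \<and> connected_group H \<and> solvable (mat_group H) \<and> B \<subseteq> H \<and> H \<subseteq> G
          \<longrightarrow> H = B)"

text \<open>Lie algebra as the Zariski tangent space at the identity.\<close>

definition lie :: "(complex^'n^'n) set \<Rightarrow> (complex^'n^'n) set" where
  "lie H = {Y. \<forall>p\<in>polyfun UNIV entries. (\<forall>A\<in>H. p A = 0) \<longrightarrow>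
     ((\<lambda>z::complex. p (\<chi> i j. mat 1 $ i $ j + z * Y $ i $ j)) has_field_derivative 0) (at 0)}"

definition roots :: "(complex^'n^'n) set \<Rightarrow> (complex^'n^'n) set \<Rightarrow> (complex^'n^'n \<Rightarrow> complex) set" where
  "roots H T = {a \<in> characters \<rat> T. (\<exists>t\<in>T. a t \<noteq> 1) \<and>
     (\<exists>Y\<in>lie H. Y \<noteq> 0 \<and> (\<forall>t\<in>T. t ** Y ** matrix_inv t = (\<chi> i j. a t * Y $ i $ j)))}"

text \<open>\<open>(a i)\<close>, \<open>i \<in> I\<close>, is the base of the root system of \<open>(G, T)\<close> whose positive roots are the
  roots of \<open>B\<close> (characters being written multiplicatively).\<close>

definition simple_roots ::
  "(complex^'n^'n) set \<Rightarrow> (complex^'n^'n) set \<Rightarrow> (complex^'n^'n) set \<Rightarrow> 'i set \<Rightarrow>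
   ('i \<Rightarrow> complex^'n^'n \<Rightarrow> complex) \<Rightarrow> bool" where
  "simple_roots G B T I a \<longleftrightarrow> finite I \<and>
     (\<forall>i\<in>I. a i \<in> roots B T) \<and>
     (\<forall>m::'i \<Rightarrow> int. (\<forall>t\<in>T. (\<Prod>i\<in>I. a i t powi m i) = 1) \<longrightarrow> (\<forall>i\<in>I. m i = 0)) \<and>
     (\<forall>b\<in>roots B T. \<exists>m::'i \<Rightarrow> nat. \<forall>t\<in>T. b t = (\<Prod>i\<in>I. a i t ^ m i)) \<and>
     (\<forall>b\<in>roots G T - roots B T. \<exists>m::'i \<Rightarrow> nat. \<forall>t\<in>T. b t = inverse (\<Prod>i\<in>I. a i t ^ m i))"

definition mat2 :: "complex \<Rightarrow> complex \<Rightarrow> complex \<Rightarrow> complex \<Rightarrow> complex^2^2" where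
  "mat2 p q r s = vector [vector [p, q], vector [r, s]]"

text \<open>The coroot of \<open>a\<close>, via a homomorphism \<open>SL\<^sub>2 \<rightarrow> G\<close> over \<open>\<rat>\<close> carrying the two standard
  unipotent subgroups to the root subgroups of \<open>a\<close> and \<open>-a\<close>.\<close>

definition is_coroot ::
  "(complex^'n^'n) set \<Rightarrow> (complex^'n^'n) set \<Rightarrow> (complex^'n^'n \<Rightarrow> complex) \<Rightarrow>
   (complex \<Rightarrow> complex^'n^'n) \<Rightarrow> bool" where
  "is_coroot G T a l \<longleftrightarrow> l \<in> cocharacters \<rat> T \<and>
     (\<exists>\<phi>::complex^2^2 \<Rightarrow> complex^'n^'n.
        (\<forall>A. det A = 1 \<longrightarrow> \<phi> A \<in> G) \<and>
        (\<forall>A A'. det A = 1 \<and> det A' = 1 \<longrightarrow> \<phi> (A ** A') = \<phi> A ** \<phi> A') \<and>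
        (\<forall>f\<in>entries. \<exists>p\<in>polyfun \<rat> entries. \<forall>A. det A = 1 \<longrightarrow> f (\<phi> A) = p A) \<and>
        \<phi> (mat2 1 1 0 1) \<noteq> mat 1 \<and>
        (\<forall>t\<in>T. \<forall>z. t ** \<phi> (mat2 1 z 0 1) ** matrix_inv t = \<phi> (mat2 1 (a t * z) 0 1)) \<and>
        (\<forall>t\<in>T. \<forall>z. t ** \<phi> (mat2 1 0 z 1) ** matrix_inv t = \<phi> (mat2 1 0 (inverse (a t) * z) 1)) \<and>
        (\<forall>c. c \<noteq> 0 \<longrightarrow> l c = \<phi> (mat2 c 0 0 (inverse c))))"

definition weyl_group :: "(complex^'n^'n) set \<Rightarrow> (complex^'n^'n) set \<Rightarrow> (complex^'n^'n) set monoid" where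
  "weyl_group G T =
     (mat_group G)\<lparr>carrier := normalizer (mat_group G) T\<rparr> Mod T"

text \<open>The action of \<open>w \<in> W\<close> on characters; the choice of representative is
  immaterial, because \<open>T\<close> is commutative.\<close>

definition weyl_char ::
  "(complex^'n^'n) set \<Rightarrow> (complex^'n^'n \<Rightarrow> complex) \<Rightarrow> (complex^'n^'n \<Rightarrow> complex)" where
  "weyl_char w \<eta> = (let n = (SOME n. n \<in> w) in (\<lambda>t. \<eta> (matrix_inv n ** t ** n)))"

record ('n::finite, 'i) reductive_datum =
  grp :: "(complex^'n^'n) set"
  tor :: "(complex^'n^'n) set"
  bor :: "(complex^'n^'n) set"
  idx :: "'i set"
  sroot :: "'i \<Rightarrow> complex^'n^'n \<Rightarrow> complex"
  scoroot :: "'i \<Rightarrow> complex \<Rightarrow> complex^'n^'n"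
  srefl :: "'i \<Rightarrow> (complex^'n^'n) set"

abbreviation weyl :: "('n::finite, 'i) reductive_datum \<Rightarrow> (complex^'n^'n) set monoid" where
  "weyl D \<equiv> weyl_group (grp D) (tor D)"

text \<open>The last two clauses describe the simple reflections: \<open>s\<^sub>i\<close> is the element of \<open>W\<close>
  acting on \<open>T\<close> by \<open>t \<mapsto> t \<alpha>\<^sub>i\<^sup>\<or>(\<alpha>\<^sub>i(t))\<^sup>-\<^sup>1\<close>, and \<open>W\<close> is generated by the \<open>s\<^sub>i\<close>, so that every
  \<open>w \<in> W\<close> has a reduced sequence.  That such an element exists, that it is the only one
  (\<open>W\<close> acts faithfully on \<open>T\<close>) and that these elements generate \<open>W\<close> holds for every split
  reductive group, so these clauses exclude no group; they record the standard facts which the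
  notations \<open>s\<^sub>i\<close> and \<open>R(w)\<close> presuppose.\<close>

definition split_reductive :: "('n::finite, 'i) reductive_datum \<Rightarrow> bool" where
  "split_reductive D \<longleftrightarrow>
     algebraic_group \<rat> (grp D) \<and> reductive (grp D) \<and>
     split_maximal_torus (grp D) (tor D) \<and>
     borel_subgroup (grp D) (bor D) \<and> tor D \<subseteq> bor D \<and>
     simple_roots (grp D) (bor D) (tor D) (idx D) (sroot D) \<and>
     (\<forall>i\<in>idx D. is_coroot (grp D) (tor D) (sroot D i) (scoroot D i)) \<and>
     (\<forall>i\<in>idx D. \<forall>w.
        w = srefl D i \<longleftrightarrow>
        w \<in> carrier (weyl D) \<and>
        (\<forall>n\<in>w. \<forall>t\<in>tor D. n ** t ** matrix_inv n = t ** scoroot D i (inverse (sroot D i t)))) \<and>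
     carrier (weyl D) = generate (weyl D) (srefl D ` idx D)"

definition word_prod :: "('n::finite, 'i) reductive_datum \<Rightarrow> 'i list \<Rightarrow> (complex^'n^'n) set" where
  "word_prod D is = foldr (\<lambda>i w. srefl D i \<otimes>\<^bsub>weyl D\<^esub> w) is \<one>\<^bsub>weyl D\<^esub>"

definition weyl_length :: "('n::finite, 'i) reductive_datum \<Rightarrow> (complex^'n^'n) set \<Rightarrow> nat" where
  "weyl_length D w = (LEAST l. \<exists>is\<in>lists (idx D). word_prod D is = w \<and> length is = l)"

definition reduced_words :: "('n::finite, 'i) reductive_datum \<Rightarrow> (complex^'n^'n) set \<Rightarrow> 'i list set" where
  "reduced_words D w = {is\<in>lists (idx D). word_prod D is = w \<and> length is = weyl_length D w}"


section \<open>Geometric crystals\<close>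

definition geometric_precrystal ::
  "('n::finite, 'i) reductive_datum \<Rightarrow> ('x, 'm) var_scheme \<Rightarrow> ('x \<rightharpoonup> complex^'n^'n) \<Rightarrow>
   ('i \<Rightarrow> complex \<times> 'x \<rightharpoonup> 'x) \<Rightarrow> bool" where
  "geometric_precrystal D X \<gamma> e \<longleftrightarrow>
     variety X \<and> irreducible_var X \<and> rational_map X (mat_variety (tor D)) \<gamma> \<and>
     (\<forall>i\<in>idx D. unital_rational_action Gm X (e i) \<and>
        rat_equiv (Gm \<times>\<^sub>v X)
          (\<lambda>(c, x). Option.bind (e i (c, x)) \<gamma>)
          (\<lambda>(c, x). map_option (\<lambda>t. scoroot D i c ** t) (\<gamma> x)))"

text \<open>\<open>e\<^sub>\<i>\<close> for \<open>\<i> = (i\<^sub>1, \<dots>, i\<^sub>l)\<close>, by recursion on \<open>l\<close>.  The character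
  \<open>\<alpha>\<^sup>(\<^sup>k\<^sup>) = s\<^bsub>i\<^sub>l\<^esub> \<dots> s\<^bsub>i\<^sub>k\<^sub>+\<^sub>1\<^esub> (\<alpha>\<^bsub>i\<^sub>k\<^esub>)\<close> depends only on \<open>i\<^sub>k, \<dots>, i\<^sub>l\<close>, and \<open>fold\<close> applies
  \<open>s\<^bsub>i\<^sub>2\<^esub>\<close> first and \<open>s\<^bsub>i\<^sub>l\<^esub>\<close> last.\<close>

primrec e_word ::
  "('n::finite, 'i) reductive_datum \<Rightarrow> ('x, 'm) var_scheme \<Rightarrow> ('i \<Rightarrow> complex \<times> 'x \<rightharpoonup> 'x) \<Rightarrow>
   'i list \<Rightarrow> ((complex^'n^'n) \<times> 'x \<rightharpoonup> 'x)" where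
  "e_word D X e [] = (\<lambda>(t, x). if t \<in> tor D \<and> x \<in> pts X then Some x else None)"
| "e_word D X e (i # is) = rat_ext (mat_variety (tor D) \<times>\<^sub>v X) X
     (\<lambda>(t, x). Option.bind (e_word D X e is (t, x))
        (\<lambda>y. e i (fold (\<lambda>j. weyl_char (srefl D j)) is (sroot D i) t, y)))"

definition geometric_crystal ::
  "('n::finite, 'i) reductive_datum \<Rightarrow> ('x, 'm) var_scheme \<Rightarrow> ('x \<rightharpoonup> complex^'n^'n) \<Rightarrow>
   ('i \<Rightarrow> complex \<times> 'x \<rightharpoonup> 'x) \<Rightarrow> bool" where
  "geometric_crystal D X \<gamma> e \<longleftrightarrow> geometric_precrystal D X \<gamma> e \<and>
     (\<forall>w\<in>carrier (weyl D). \<forall>is\<in>reduced_words D w. \<forall>is'\<in>reduced_words D w.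
        e_word D X e is = e_word D X e is')"

definition e_weyl ::
  "('n::finite, 'i) reductive_datum \<Rightarrow> ('x, 'm) var_scheme \<Rightarrow> ('i \<Rightarrow> complex \<times> 'x \<rightharpoonup> 'x) \<Rightarrow>
   (complex^'n^'n) set \<Rightarrow> ((complex^'n^'n) \<times> 'x \<rightharpoonup> 'x)" where
  "e_weyl D X e w = e_word D X e (SOME is. is \<in> reduced_words D w)"

text \<open>The correspondence \<open>(w, x) \<mapsto> e\<^sub>w(\<gamma>(x)\<^sup>-\<^sup>1, x)\<close>, first where the composite is
  literally defined, then as a rational morphism \<open>W \<times> X \<rightarrow> X\<close>.\<close>

definition weyl_corr ::
  "('n::finite, 'i) reductive_datum \<Rightarrow> ('x, 'm) var_scheme \<Rightarrow> ('x \<rightharpoonup> complex^'n^'n) \<Rightarrow>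
   ('i \<Rightarrow> complex \<times> 'x \<rightharpoonup> 'x) \<Rightarrow> ((complex^'n^'n) set \<times> 'x \<rightharpoonup> 'x)" where
  "weyl_corr D X \<gamma> e = (\<lambda>(w, x). Option.bind (\<gamma> x) (\<lambda>t. e_weyl D X e w (matrix_inv t, x)))"

definition weyl_map ::
  "('n::finite, 'i) reductive_datum \<Rightarrow> ('x, 'm) var_scheme \<Rightarrow> ('x \<rightharpoonup> complex^'n^'n) \<Rightarrow>
   ('i \<Rightarrow> complex \<times> 'x \<rightharpoonup> 'x) \<Rightarrow> ((complex^'n^'n) set \<times> 'x \<rightharpoonup> 'x)" where
  "weyl_map D X \<gamma> e = rat_ext (constant_group (weyl D) \<times>\<^sub>v X) X (weyl_corr D X \<gamma> e)"

end

theory Submission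
  imports Defs "HOL-Algebra.Zassenhaus"
begin

text \<open>
  Put \<open>\<sigma>\<^sub>i(x) = e\<^sub>i(1 / \<alpha>\<^sub>i(\<gamma>(x)), x)\<close>.  Once \<open>\<sigma>\<^sub>i\<close> is known to be a dominant rational map, equivariance gives
  \<open>\<gamma>(\<sigma>\<^sub>i x) = s\<^sub>i(\<gamma>(x))\<close>, and the action law together with \<open>\<alpha>\<^sub>i(\<alpha>\<^sub>i\<^sup>\<or>(c)) = c\<^sup>2\<close> gives \<open>\<sigma>\<^sub>i\<^sup>2 = id\<close>.
  For a word \<open>\<i>\<close> the characters \<open>\<alpha>\<^sup>(\<^sup>k\<^sup>)\<close> are such that \<open>e\<^sub>\<i>(\<gamma>(x)\<inverse>, x) = \<sigma>\<^bsub>i\<^sub>1\<^esub> \<dots> \<sigma>\<^bsub>i\<^sub>l\<^esub>(x)\<close>, so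
  \<open>w(x)\<close> is this product for any reduced word of \<open>w\<close>.  Left multiplication by \<open>s\<^sub>i\<close> changes the length
  of \<open>w\<close> by exactly one, because a reflection acts on the 3-torsion of \<open>T\<close> by an odd permutation;
  hence either \<open>i # \<i>\<close> is reduced, or \<open>\<sigma>\<^sub>i\<close> cancels against the first letter of another reduced word
  of \<open>w\<close>, and \<open>\<sigma>\<^sub>i(w(x)) = (s\<^sub>i w)(x)\<close> in both cases.  The action law follows by induction on words.
\<close>


section \<open>Regular functions in a chart\<close>

text \<open>The obstacle is that evaluation takes place at points that are not generic where the
  hypotheses speak: the graph t = \<gamma>(x)^-1 is thin in T x X, so a generic identity on T x X
  says nothing about it. Two devices answer this. By separatedness, an identity extends from a dense
  open set to every point where both sides are regular; and maximal domains turn equality of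
  rational maps into equality of partial functions. On an irreducible variety a composite is densely
  defined as soon as one good point is found, often over the unit of T or Gm, where the action is
  the identity. Since the topology is the one over \<rat>, products of irreducible varieties need
  not be irreducible and only slices over rational points are morphisms; hence the care about the
  rational points of Gm and T. The sign on the 3-torsion replaces the determinant on the character
  lattice. The prime 2 would fail: if the coroot is trivial at -1, the reflection fixes all
  2-torsion. The pairing of a root with its coroot is 2, which is invertible modulo 3.\<close>

lemma polyfun_diff:
  assumes "-1 \<in> k" "f \<in> polyfun k F" "g \<in> polyfun k F"
  shows "(\<lambda>x. f x - g x) \<in> polyfun k F"
  using polyfun.add[OF assms(2) polyfun.mult[OF polyfun.const[OF assms(1)] assms(3)]] by simp

lemma polyfun_prod:
  assumes "1 \<in> k" "\<And>i. i \<in> I \<Longrightarrow> f i \<in> polyfun k F"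
  shows "(\<lambda>x. \<Prod>i\<in>I. f i x) \<in> polyfun k F"
  using assms(2)
proof (induction I rule: infinite_finite_induct)
  case (insert i I)
  then show ?case by (simp add: polyfun.mult)
qed (simp_all add: polyfun.const assms(1))

lemma polyfun_comp:
  assumes "f \<in> polyfun k F" "\<And>g. g \<in> F \<Longrightarrow> (\<lambda>x. g (\<phi> x)) \<in> polyfun k H"
  shows "(\<lambda>x. f (\<phi> x)) \<in> polyfun k H"
  using assms(1) by induction (auto intro: polyfun.const polyfun.add polyfun.mult assms(2))

lemma polyfun_mono:
  assumes "f \<in> polyfun k F" "k \<subseteq> k'" "F \<subseteq> F'"
  shows "f \<in> polyfun k' F'"
  using assms(1) by induction (use assms(2,3) in \<open>auto intro: polyfun.intros\<close>)

text \<open>The germ of \<open>h\<close> at \<open>x\<close> lies in the local ring of the chart.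
  The denominator may depend on \<open>h\<close>, whereas \<open>regular_map\<close> asks for one
  denominator for all coordinates.\<close>

definition chart_reg :: "'a set \<Rightarrow> ('a \<Rightarrow> complex) set \<Rightarrow> 'a \<Rightarrow> ('a \<Rightarrow> complex) \<Rightarrow> bool" where
  "chart_reg U F x h \<longleftrightarrow>
     (\<exists>p\<in>polyfun \<rat> F. \<exists>q\<in>polyfun \<rat> F. q x \<noteq> 0 \<and> (\<forall>y\<in>U. q y \<noteq> 0 \<longrightarrow> h y = p y / q y))"

lemma chart_regI:
  assumes "p \<in> polyfun \<rat> F" "q \<in> polyfun \<rat> F" "q x \<noteq> 0"
    "\<And>y. y \<in> U \<Longrightarrow> q y \<noteq> 0 \<Longrightarrow> h y = p y / q y"
  shows "chart_reg U F x h"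
  using assms unfolding chart_reg_def by (intro bexI[of _ p] bexI[of _ q]) auto

lemma chart_regE:
  assumes "chart_reg U F x h"
  obtains p q where "p \<in> polyfun \<rat> F" "q \<in> polyfun \<rat> F" "q x \<noteq> 0"
    "\<forall>y\<in>U. q y \<noteq> 0 \<longrightarrow> h y = p y / q y"
  using assms unfolding chart_reg_def by (elim bexE conjE) (rule that)

lemma chart_reg_poly: "f \<in> polyfun \<rat> F \<Longrightarrow> chart_reg U F x f"
  by (rule chart_regI[of f F "\<lambda>_. 1"]) (auto intro: polyfun.const)

lemma chart_reg_add:
  assumes "chart_reg U F x f" "chart_reg U F x g"
  shows "chart_reg U F x (\<lambda>y. f y + g y)"
proof -
  from assms(1) obtain p q where 1: "p \<in> polyfun \<rat> F" "q \<in> polyfun \<rat> F" "q x \<noteq> 0"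
    "\<forall>y\<in>U. q y \<noteq> 0 \<longrightarrow> f y = p y / q y" by (rule chart_regE)
  from assms(2) obtain p' q' where 2: "p' \<in> polyfun \<rat> F" "q' \<in> polyfun \<rat> F" "q' x \<noteq> 0"
    "\<forall>y\<in>U. q' y \<noteq> 0 \<longrightarrow> g y = p' y / q' y" by (rule chart_regE)
  show ?thesis
  proof (rule chart_regI)
    show "(\<lambda>y. p y * q' y + p' y * q y) \<in> polyfun \<rat> F" "(\<lambda>y. q y * q' y) \<in> polyfun \<rat> F"
      using 1 2 by (auto intro: polyfun.add polyfun.mult)
  qed (use 1 2 in \<open>auto simp: field_simps\<close>)
qed

lemma chart_reg_mult:
  assumes "chart_reg U F x f" "chart_reg U F x g"
  shows "chart_reg U F x (\<lambda>y. f y * g y)"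
proof -
  from assms(1) obtain p q where 1: "p \<in> polyfun \<rat> F" "q \<in> polyfun \<rat> F" "q x \<noteq> 0"
    "\<forall>y\<in>U. q y \<noteq> 0 \<longrightarrow> f y = p y / q y" by (rule chart_regE)
  from assms(2) obtain p' q' where 2: "p' \<in> polyfun \<rat> F" "q' \<in> polyfun \<rat> F" "q' x \<noteq> 0"
    "\<forall>y\<in>U. q' y \<noteq> 0 \<longrightarrow> g y = p' y / q' y" by (rule chart_regE)
  show ?thesis
  proof (rule chart_regI)
    show "(\<lambda>y. p y * p' y) \<in> polyfun \<rat> F" "(\<lambda>y. q y * q' y) \<in> polyfun \<rat> F"
      using 1 2 by (auto intro: polyfun.mult)
  qed (use 1 2 in \<open>auto\<close>)
qed

lemma chart_reg_inverse:
  assumes "chart_reg U F x f" "x \<in> U" "f x \<noteq> 0"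
  shows "chart_reg U F x (\<lambda>y. inverse (f y))"
proof -
  from assms(1) obtain p q where 1: "p \<in> polyfun \<rat> F" "q \<in> polyfun \<rat> F" "q x \<noteq> 0"
    "\<forall>y\<in>U. q y \<noteq> 0 \<longrightarrow> f y = p y / q y" by (rule chart_regE)
  show ?thesis
  proof (rule chart_regI)
    \<comment> \<open>The inverse q / p is expanded by q, so that the new denominator also vanishes
      with q and the formula f = p / q is available wherever it does not vanish.\<close>
    show "(\<lambda>y. q y * q y) \<in> polyfun \<rat> F" "(\<lambda>y. p y * q y) \<in> polyfun \<rat> F"
      using 1 by (auto intro: polyfun.mult)
  qed (use 1 assms in \<open>auto\<close>)
qed

lemma chart_reg_cong:
  assumes "chart_reg U F x f" "r \<in> polyfun \<rat> F" "r x \<noteq> 0"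
    "\<And>y. y \<in> U \<Longrightarrow> r y \<noteq> 0 \<Longrightarrow> g y = f y"
  shows "chart_reg U F x g"
proof -
  from assms(1) obtain p q where 1: "p \<in> polyfun \<rat> F" "q \<in> polyfun \<rat> F" "q x \<noteq> 0"
    "\<forall>y\<in>U. q y \<noteq> 0 \<longrightarrow> f y = p y / q y" by (rule chart_regE)
  show ?thesis
  proof (rule chart_regI)
    show "(\<lambda>y. p y * r y) \<in> polyfun \<rat> F" "(\<lambda>y. q y * r y) \<in> polyfun \<rat> F"
      using 1 assms by (auto intro: polyfun.mult)
  qed (use 1 assms in \<open>auto simp: field_simps\<close>)
qed

lemma chart_reg_polyfun_comp:
  assumes "f \<in> polyfun \<rat> H" "\<And>g. g \<in> H \<Longrightarrow> chart_reg U F x (\<lambda>y. g (\<phi> y))"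
  shows "chart_reg U F x (\<lambda>y. f (\<phi> y))"
  using assms(1)
  by induction (auto intro: assms(2) chart_reg_poly polyfun.const chart_reg_add chart_reg_mult)

lemma chart_reg_nonzero:
  assumes "chart_reg U F x f" "x \<in> U" "f x \<noteq> 0"
  shows "\<exists>r\<in>polyfun \<rat> F. r x \<noteq> 0 \<and> (\<forall>y\<in>U. r y \<noteq> 0 \<longrightarrow> f y \<noteq> 0)"
proof -
  from assms(1) obtain p q where 1: "p \<in> polyfun \<rat> F" "q \<in> polyfun \<rat> F" "q x \<noteq> 0"
    "\<forall>y\<in>U. q y \<noteq> 0 \<longrightarrow> f y = p y / q y" by (rule chart_regE)
  show ?thesis
    by (rule bexI[of _ "\<lambda>y. p y * q y"]) (use 1 assms in \<open>auto intro: polyfun.mult\<close>)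
qed

text \<open>Finitely many denominators can be multiplied together. Starting from \<open>r\<close>
  stores an additional open condition in the same denominator, since \<open>regular_map\<close> uses
  one \<open>q\<close> both for definedness and for the coordinates.\<close>

lemma chart_reg_common_denominator:
  assumes "finite H" "\<forall>g\<in>H. chart_reg U F x (\<lambda>y. g (\<phi> y))" "r \<in> polyfun \<rat> F" "r x \<noteq> 0"
  shows "\<exists>q\<in>polyfun \<rat> F. q x \<noteq> 0 \<and> (\<forall>y. q y \<noteq> 0 \<longrightarrow> r y \<noteq> 0) \<and>
    (\<forall>g\<in>H. \<exists>p\<in>polyfun \<rat> F. \<forall>y\<in>U. q y \<noteq> 0 \<longrightarrow> g (\<phi> y) = p y / q y)"
  (is "\<exists>q\<in>_. ?P H q")
  using assms(1,2)
proof (induction H)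
  case empty
  show ?case by (rule bexI[of _ r]) (use assms(3,4) in auto)
next
  case (insert g H)
  have "\<exists>q\<in>polyfun \<rat> F. ?P H q" by (rule insert.IH) (simp add: insert.prems)
  then obtain q where q: "q \<in> polyfun \<rat> F" "q x \<noteq> 0" "\<forall>y. q y \<noteq> 0 \<longrightarrow> r y \<noteq> 0"
    "\<forall>h\<in>H. \<exists>p\<in>polyfun \<rat> F. \<forall>y\<in>U. q y \<noteq> 0 \<longrightarrow> h (\<phi> y) = p y / q y"
    by (elim conjE bexE)
  obtain p' q' where g: "p' \<in> polyfun \<rat> F" "q' \<in> polyfun \<rat> F" "q' x \<noteq> 0"
    "\<forall>y\<in>U. q' y \<noteq> 0 \<longrightarrow> g (\<phi> y) = p' y / q' y"
    using bspec[OF insert.prems insertI1] by (rule chart_regE)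
  show ?case
  proof (rule bexI[of _ "\<lambda>y. q y * q' y"], intro conjI ballI allI impI)
    fix h assume "h \<in> insert g H"
    then consider "h = g" | "h \<in> H" by auto
    then show "\<exists>p\<in>polyfun \<rat> F. \<forall>y\<in>U. q y * q' y \<noteq> 0 \<longrightarrow> h (\<phi> y) = p y / (q y * q' y)"
    proof cases
      case 1
      show ?thesis
        by (rule bexI[of _ "\<lambda>y. p' y * q y"]) (use 1 g q(1-3) in \<open>auto intro: polyfun.mult\<close>)
    next
      case 2
      obtain p where "p \<in> polyfun \<rat> F" "\<forall>y\<in>U. q y \<noteq> 0 \<longrightarrow> h (\<phi> y) = p y / q y"
        using bspec[OF q(4) 2] by (elim bexE)
      then show ?thesis
        by (intro bexI[of _ "\<lambda>y. p y * q' y"]) (use g in \<open>auto intro: polyfun.mult\<close>)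
    qed
  qed (use q(1-3) g(1-3) in \<open>auto intro: polyfun.mult\<close>)
qed


section \<open>Zariski neighbourhoods\<close>

text \<open>The conditions on an atlas that are needed without affineness and separatedness; unlike
  \<open>variety\<close> they make sense for the possibly infinite constant groups.\<close>

definition prevar :: "('a, 'm) var_scheme \<Rightarrow> bool" where
  "prevar X \<longleftrightarrow> \<Union>(fst ` atlas X) = pts X \<and> (\<forall>(U, F)\<in>atlas X. finite F) \<and>
     (\<forall>(U, F)\<in>atlas X. \<forall>(V, H)\<in>atlas X. \<forall>x\<in>U \<inter> V.
        (\<exists>q\<in>polyfun \<rat> F. q x \<noteq> 0 \<and> {y\<in>U. q y \<noteq> 0} \<subseteq> V) \<and> (\<forall>g\<in>H. chart_reg U F x g))"

lemma prevar_cover: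
  assumes "prevar X" "x \<in> pts X"
  obtains U F where "(U, F) \<in> atlas X" "x \<in> U"
proof -
  have "x \<in> \<Union>(fst ` atlas X)" using assms by (simp add: prevar_def)
  then show ?thesis using that by auto
qed

lemma prevar_chart_subset:
  assumes "prevar X" "(U, F) \<in> atlas X" shows "U \<subseteq> pts X"
proof -
  have "\<Union>(fst ` atlas X) = pts X" using assms by (simp add: prevar_def)
  then show ?thesis using assms(2) by force
qed

lemma prevar_finite:
  assumes "prevar X" "(U, F) \<in> atlas X" shows "finite F"
proof -
  have "\<forall>(U, F)\<in>atlas X. finite F" using assms by (simp add: prevar_def)
  then show ?thesis using assms(2) by auto
qed

lemma prevar_overlap:
  assumes "prevar X" "(U, F) \<in> atlas X" "(V, H) \<in> atlas X" "x \<in> U" "x \<in> V"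
  obtains q where "q \<in> polyfun \<rat> F" "q x \<noteq> 0" "\<forall>y\<in>U. q y \<noteq> 0 \<longrightarrow> y \<in> V"
    "\<forall>g\<in>H. chart_reg U F x g"
proof -
  have ov: "\<forall>(U, F)\<in>atlas X. \<forall>(V, H)\<in>atlas X. \<forall>x\<in>U \<inter> V.
        (\<exists>q\<in>polyfun \<rat> F. q x \<noteq> 0 \<and> {y\<in>U. q y \<noteq> 0} \<subseteq> V) \<and> (\<forall>g\<in>H. chart_reg U F x g)"
    using assms(1) by (simp add: prevar_def)
  have "(\<exists>q\<in>polyfun \<rat> F. q x \<noteq> 0 \<and> {y\<in>U. q y \<noteq> 0} \<subseteq> V) \<and> (\<forall>g\<in>H. chart_reg U F x g)"
    using bspec[OF bspec[OF ov assms(2), simplified] assms(3), simplified] assms(4,5) by simp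
  then obtain q where "q \<in> polyfun \<rat> F" "q x \<noteq> 0" "{y\<in>U. q y \<noteq> 0} \<subseteq> V"
    "\<forall>g\<in>H. chart_reg U F x g" by (elim conjE bexE)
  then show ?thesis by (intro that[of q]) auto
qed

lemma variety_prevar:
  assumes "variety X" shows "prevar X"
  unfolding prevar_def
proof (intro conjI)
  show "\<Union>(fst ` atlas X) = pts X" using assms by (simp add: variety_def)
  show "\<forall>(U, F)\<in>atlas X. finite F" using assms by (auto simp: variety_def affine_chart_def)
  have ov: "\<forall>(U, F)\<in>atlas X. \<forall>(V, H)\<in>atlas X. \<forall>x\<in>U \<inter> V.
        \<exists>q\<in>polyfun \<rat> F. q x \<noteq> 0 \<and> {y\<in>U. q y \<noteq> 0} \<subseteq> V \<and>
          (\<forall>g\<in>H. \<exists>p\<in>polyfun \<rat> F. \<forall>y\<in>U. q y \<noteq> 0 \<longrightarrow> g y = p y / q y)"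
    using assms by (simp add: variety_def)
  show "\<forall>(U, F)\<in>atlas X. \<forall>(V, H)\<in>atlas X. \<forall>x\<in>U \<inter> V.
        (\<exists>q\<in>polyfun \<rat> F. q x \<noteq> 0 \<and> {y\<in>U. q y \<noteq> 0} \<subseteq> V) \<and> (\<forall>g\<in>H. chart_reg U F x g)"
  proof clarify
    fix U F V H x assume a: "(U, F) \<in> atlas X" "(V, H) \<in> atlas X" "x \<in> U" "x \<in> V"
    have "\<exists>q\<in>polyfun \<rat> F. q x \<noteq> 0 \<and> {y\<in>U. q y \<noteq> 0} \<subseteq> V \<and>
          (\<forall>g\<in>H. \<exists>p\<in>polyfun \<rat> F. \<forall>y\<in>U. q y \<noteq> 0 \<longrightarrow> g y = p y / q y)"
      using bspec[OF bspec[OF ov a(1), simplified] a(2), simplified] a(3,4) by simp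
    then obtain q where q: "q \<in> polyfun \<rat> F" "q x \<noteq> 0" "{y\<in>U. q y \<noteq> 0} \<subseteq> V"
      "\<forall>g\<in>H. \<exists>p\<in>polyfun \<rat> F. \<forall>y\<in>U. q y \<noteq> 0 \<longrightarrow> g y = p y / q y"
      by (elim bexE conjE)
    have "chart_reg U F x g" if g: "g \<in> H" for g
    proof -
      obtain p where "p \<in> polyfun \<rat> F" "\<forall>y\<in>U. q y \<noteq> 0 \<longrightarrow> g y = p y / q y"
        using bspec[OF q(4) g] by (elim bexE)
      then show ?thesis using chart_regI[of p F q] q(1,2) by simp
    qed
    with q show "(\<exists>q\<in>polyfun \<rat> F. q x \<noteq> 0 \<and> {y\<in>U. q y \<noteq> 0} \<subseteq> V) \<and> (\<forall>g\<in>H. chart_reg U F x g)"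
      by (intro conjI bexI[of _ q]) auto
  qed
qed

text \<open>Neighbourhoods and dense open sets are treated as filters, so that finitely many open
  conditions combine by \<open>eventually_elim\<close> without naming the sets. For
  \<open>generic\<close> this rests on the density of the intersection of two dense open
  sets.\<close>

definition near :: "('a, 'm) var_scheme \<Rightarrow> 'a \<Rightarrow> 'a filter" where
  "near X x = (INF V\<in>{V. zariski_open X V \<and> x \<in> V}. principal V)"

definition generic :: "('a, 'm) var_scheme \<Rightarrow> 'a filter" where
  "generic X = (INF V\<in>{V. zariski_open X V \<and> zariski_dense X V}. principal V)"

lemma zariski_openD:
  assumes "zariski_open X V" "(U, F) \<in> atlas X" "x \<in> U" "x \<in> V"
  obtains q where "q \<in> polyfun \<rat> F" "q x \<noteq> 0" "\<forall>y\<in>U. q y \<noteq> 0 \<longrightarrow> y \<in> V"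
proof -
  have "\<exists>q\<in>polyfun \<rat> F. q x \<noteq> 0 \<and> {y\<in>U. q y \<noteq> 0} \<subseteq> V"
    using bspec[OF conjunct2[OF assms(1)[unfolded zariski_open_def]] assms(2), simplified] assms(3,4)
    by simp
  then obtain q where "q \<in> polyfun \<rat> F" "q x \<noteq> 0" "{y\<in>U. q y \<noteq> 0} \<subseteq> V" by (elim conjE bexE)
  then show ?thesis by (intro that[of q]) auto
qed

lemma zariski_openI:
  assumes "V \<subseteq> pts X"
    "\<And>U F x. (U, F) \<in> atlas X \<Longrightarrow> x \<in> U \<Longrightarrow> x \<in> V \<Longrightarrow>
       \<exists>q\<in>polyfun \<rat> F. q x \<noteq> 0 \<and> (\<forall>y\<in>U. q y \<noteq> 0 \<longrightarrow> y \<in> V)"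
  shows "zariski_open X V"
  unfolding zariski_open_def
proof (intro conjI ballI, rule assms(1), clarify)
  fix U F x assume "(U, F) \<in> atlas X" "x \<in> U" "x \<in> V"
  from assms(2)[OF this] obtain q where "q \<in> polyfun \<rat> F" "q x \<noteq> 0" "\<forall>y\<in>U. q y \<noteq> 0 \<longrightarrow> y \<in> V"
    by (elim conjE bexE)
  then show "\<exists>q\<in>polyfun \<rat> F. q x \<noteq> 0 \<and> {y\<in>U. q y \<noteq> 0} \<subseteq> V"
    by (intro bexI[of _ q]) auto
qed

lemma zariski_open_Int:
  assumes "zariski_open X V" "zariski_open X V'"
  shows "zariski_open X (V \<inter> V')"
proof (rule zariski_openI)
  show "V \<inter> V' \<subseteq> pts X" using assms by (auto simp: zariski_open_def)
  fix U F x assume a: "(U, F) \<in> atlas X" "x \<in> U" "x \<in> V \<inter> V'"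
  obtain q where q: "q \<in> polyfun \<rat> F" "q x \<noteq> 0" "\<forall>y\<in>U. q y \<noteq> 0 \<longrightarrow> y \<in> V"
    using zariski_openD[OF assms(1) a(1,2)] a(3) by auto
  obtain q' where q': "q' \<in> polyfun \<rat> F" "q' x \<noteq> 0" "\<forall>y\<in>U. q' y \<noteq> 0 \<longrightarrow> y \<in> V'"
    using zariski_openD[OF assms(2) a(1,2)] a(3) by auto
  show "\<exists>q\<in>polyfun \<rat> F. q x \<noteq> 0 \<and> (\<forall>y\<in>U. q y \<noteq> 0 \<longrightarrow> y \<in> V \<inter> V')"
    by (rule bexI[of _ "\<lambda>y. q y * q' y"]) (use q q' in \<open>auto intro: polyfun.mult\<close>)
qed

lemma zariski_open_pts:
  assumes "prevar X" shows "zariski_open X (pts X)"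
proof (rule zariski_openI)
  fix U F x assume "(U, F) \<in> atlas X"
  then show "\<exists>q\<in>polyfun \<rat> F. q x \<noteq> 0 \<and> (\<forall>y\<in>U. q y \<noteq> 0 \<longrightarrow> y \<in> pts X)"
    using prevar_chart_subset[OF assms]
    by (intro bexI[of _ "\<lambda>_. 1"]) (auto intro: polyfun.const)
qed simp

lemma zariski_dense_pts:
  assumes "prevar X" shows "zariski_dense X (pts X)"
  unfolding zariski_dense_def zariski_open_def by blast

lemma zariski_dense_Int:
  assumes "zariski_open X V" "zariski_dense X V" "zariski_dense X V'"
  shows "zariski_dense X (V \<inter> V')"
  unfolding zariski_dense_def
proof clarify
  fix A assume a: "zariski_open X A" "A \<noteq> {}" "V \<inter> V' \<inter> A = {}"
  have "V \<inter> A \<noteq> {}" "zariski_open X (V \<inter> A)"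
    using a assms zariski_open_Int[OF assms(1) a(1)] by (auto simp: zariski_dense_def)
  then have "V' \<inter> (V \<inter> A) \<noteq> {}" using assms(3) by (simp add: zariski_dense_def)
  then show False using a(3) by auto
qed

lemma eventually_near:
  assumes "prevar X" "x \<in> pts X"
  shows "eventually P (near X x) \<longleftrightarrow> (\<exists>V. zariski_open X V \<and> x \<in> V \<and> (\<forall>y\<in>V. P y))"
  unfolding near_def
  by (subst eventually_INF_base)
     (use assms zariski_open_pts[OF assms(1)] in \<open>auto simp: eventually_principal intro: zariski_open_Int\<close>)

lemma eventually_generic:
  assumes "prevar X"
  shows "eventually P (generic X) \<longleftrightarrow>
    (\<exists>V. zariski_open X V \<and> zariski_dense X V \<and> (\<forall>y\<in>V. P y))"
  unfolding generic_def
proof (subst eventually_INF_base)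
  fix A B assume "A \<in> {V. zariski_open X V \<and> zariski_dense X V}"
    "B \<in> {V. zariski_open X V \<and> zariski_dense X V}"
  then show "\<exists>x\<in>{V. zariski_open X V \<and> zariski_dense X V}. principal x \<le> inf (principal A) (principal B)"
    by (intro bexI[of _ "A \<inter> B"]) (auto intro: zariski_open_Int zariski_dense_Int)
qed (use assms zariski_open_pts zariski_dense_pts in \<open>auto simp: eventually_principal\<close>)

text \<open>Openness is tested in every chart: in another chart q becomes a regular fraction, and
  clearing its denominator leaves a polynomial condition.\<close>

lemma zariski_open_basic:
  assumes "prevar X" "(U, F) \<in> atlas X" "q \<in> polyfun \<rat> F"
  shows "zariski_open X {y\<in>U. q y \<noteq> 0}"
proof (rule zariski_openI)
  show "{y\<in>U. q y \<noteq> 0} \<subseteq> pts X" using prevar_chart_subset[OF assms(1,2)] by auto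
  fix U' F' x assume a: "(U', F') \<in> atlas X" "x \<in> U'" "x \<in> {y\<in>U. q y \<noteq> 0}"
  then have x: "x \<in> U" "q x \<noteq> 0" by auto
  obtain r where r: "r \<in> polyfun \<rat> F'" "r x \<noteq> 0" "\<forall>y\<in>U'. r y \<noteq> 0 \<longrightarrow> y \<in> U"
    "\<forall>g\<in>F. chart_reg U' F' x g"
    using prevar_overlap[OF assms(1) a(1) assms(2) a(2) x(1)] .
  have "chart_reg U' F' x (\<lambda>y. q y)"
    by (rule chart_reg_polyfun_comp[OF assms(3)]) (rule bspec[OF r(4)])
  from chart_reg_nonzero[OF this a(2) x(2)]
  obtain s where "s \<in> polyfun \<rat> F'" "s x \<noteq> 0" "\<forall>y\<in>U'. s y \<noteq> 0 \<longrightarrow> q y \<noteq> 0"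
    by (elim conjE bexE)
  then show "\<exists>q'\<in>polyfun \<rat> F'. q' x \<noteq> 0 \<and> (\<forall>y\<in>U'. q' y \<noteq> 0 \<longrightarrow> y \<in> {y \<in> U. q y \<noteq> 0})"
    using r(1-3) by (intro bexI[of _ "\<lambda>y. r y * s y"]) (simp_all add: polyfun.mult)
qed

text \<open>Principal open sets of one chart already form a neighbourhood basis, although
  \<open>zariski_open\<close> quantifies over all charts.\<close>

lemma eventually_near_chart:
  assumes "prevar X" "(U, F) \<in> atlas X" "x \<in> U"
  shows "eventually P (near X x) \<longleftrightarrow>
    (\<exists>q\<in>polyfun \<rat> F. q x \<noteq> 0 \<and> (\<forall>y\<in>U. q y \<noteq> 0 \<longrightarrow> P y))"
proof -
  have x: "x \<in> pts X" using prevar_chart_subset[OF assms(1,2)] assms(3) by auto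
  show ?thesis
  proof
    assume "eventually P (near X x)"
    then obtain V where V: "zariski_open X V" "x \<in> V" "\<forall>y\<in>V. P y"
      using eventually_near[OF assms(1) x] by blast
    obtain q where "q \<in> polyfun \<rat> F" "q x \<noteq> 0" "\<forall>y\<in>U. q y \<noteq> 0 \<longrightarrow> y \<in> V"
      using zariski_openD[OF V(1) assms(2,3) V(2)] by auto
    then show "\<exists>q\<in>polyfun \<rat> F. q x \<noteq> 0 \<and> (\<forall>y\<in>U. q y \<noteq> 0 \<longrightarrow> P y)"
      using V(3) by (intro bexI[of _ q]) auto
  next
    assume "\<exists>q\<in>polyfun \<rat> F. q x \<noteq> 0 \<and> (\<forall>y\<in>U. q y \<noteq> 0 \<longrightarrow> P y)"
    then obtain q where q: "q \<in> polyfun \<rat> F" "q x \<noteq> 0" "\<forall>y\<in>U. q y \<noteq> 0 \<longrightarrow> P y"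
      by (elim conjE bexE)
    then show "eventually P (near X x)"
      unfolding eventually_near[OF assms(1) x]
      by (intro exI[of _ "{y\<in>U. q y \<noteq> 0}"]) (use zariski_open_basic[OF assms(1,2) q(1)] q(2,3) assms(3) in auto)
  qed
qed

lemma eventually_near_imp: "prevar X \<Longrightarrow> x \<in> pts X \<Longrightarrow> eventually P (near X x) \<Longrightarrow> P x"
  by (auto simp: eventually_near)

lemma eventually_near_pts: "prevar X \<Longrightarrow> x \<in> pts X \<Longrightarrow> eventually (\<lambda>y. y \<in> pts X) (near X x)"
  by (subst eventually_near) (auto intro: zariski_open_pts)

lemma eventually_near_open:
  "prevar X \<Longrightarrow> zariski_open X V \<Longrightarrow> x \<in> V \<Longrightarrow> eventually (\<lambda>y. y \<in> V) (near X x)"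
  by (subst eventually_near) (auto simp: zariski_open_def)

lemma eventually_near_near:
  assumes "prevar X" "x \<in> pts X" "eventually P (near X x)"
  shows "eventually (\<lambda>y. y \<in> pts X \<and> eventually P (near X y)) (near X x)"
proof -
  obtain V where "zariski_open X V" "x \<in> V" "\<forall>y\<in>V. P y"
    using eventually_near[OF assms(1,2)] assms(3) by blast
  then show ?thesis
    using eventually_near[OF assms(1)] by (subst eventually_near[OF assms(1,2)])
      (auto simp: zariski_open_def intro!: exI[of _ V])
qed

text \<open>Morphisms pull back neighbourhoods, not dense sets. A generic property is therefore
  first strengthened to hold near a point, transported there, and made generic again by
  \<open>generic_of_near\<close>.\<close>

lemma eventually_generic_near:
  assumes "prevar X" "eventually P (generic X)"
  shows "eventually (\<lambda>y. y \<in> pts X \<and> eventually P (near X y)) (generic X)"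
proof -
  obtain V where V: "zariski_open X V" "zariski_dense X V" "\<forall>y\<in>V. P y"
    using eventually_generic[OF assms(1)] assms(2) by blast
  then show ?thesis
    using eventually_near[OF assms(1)] unfolding eventually_generic[OF assms(1)]
    by (intro exI[of _ V]) (auto simp: zariski_open_def)
qed

lemma eventually_generic_pts: "prevar X \<Longrightarrow> eventually (\<lambda>y. y \<in> pts X) (generic X)"
  using eventually_generic zariski_open_pts zariski_dense_pts by blast

lemma generic_meets_near:
  assumes "prevar X" "x \<in> pts X" "eventually P (generic X)" "eventually Q (near X x)"
  shows "\<exists>y\<in>pts X. P y \<and> Q y"
proof -
  obtain V where V: "zariski_open X V" "zariski_dense X V" "\<forall>y\<in>V. P y"
    using eventually_generic[OF assms(1)] assms(3) by blast
  obtain V' where V': "zariski_open X V'" "x \<in> V'" "\<forall>y\<in>V'. Q y"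
    using eventually_near[OF assms(1,2)] assms(4) by blast
  have "V \<inter> V' \<noteq> {}" using V V' unfolding zariski_dense_def by auto
  then show ?thesis using V V' by (auto simp: zariski_open_def)
qed

text \<open>A nonempty open subset of an irreducible variety is dense, so a single good point proves
  a generic statement.\<close>

lemma generic_of_near:
  assumes "prevar X" "irreducible_var X" "x \<in> pts X" "eventually P (near X x)"
  shows "eventually P (generic X)"
proof -
  obtain V where "zariski_open X V" "x \<in> V" "\<forall>y\<in>V. P y"
    using eventually_near[OF assms(1,3)] assms(4) by blast
  then show ?thesis
    using assms(2) unfolding eventually_generic[OF assms(1)]
    by (intro exI[of _ V]) (auto simp: irreducible_var_def zariski_dense_def)
qed

lemma generic_ex:
  assumes "prevar X" "pts X \<noteq> {}" "eventually P (generic X)"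
  shows "\<exists>x\<in>pts X. P x"
  using generic_meets_near[OF assms(1) _ assms(3), of _ "\<lambda>_. True"] assms(2) by auto

lemma rat_equiv_iff:
  assumes "prevar X"
  shows "rat_equiv X f g \<longleftrightarrow>
    eventually (\<lambda>x. x \<in> dom f \<and> x \<in> dom g \<and> f x = g x) (generic X)"
  unfolding rat_equiv_def eventually_generic[OF assms] by blast


section \<open>Regular functions and morphisms at a point\<close>

definition reg_at :: "('a, 'm) var_scheme \<Rightarrow> 'a \<Rightarrow> ('a \<Rightarrow> complex) \<Rightarrow> bool" where
  "reg_at X x h \<longleftrightarrow> (\<exists>(U, F)\<in>atlas X. x \<in> U \<and> chart_reg U F x h)"

text \<open>A fraction in the coordinates of another chart is a fraction of fractions in this one,
  so the choice of the chart is immaterial.\<close>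

lemma reg_at_chart:
  assumes X: "prevar X" and U: "(U, F) \<in> atlas X" "x \<in> U"
  shows "reg_at X x h \<longleftrightarrow> chart_reg U F x h"
proof
  assume "chart_reg U F x h"
  then show "reg_at X x h" using U unfolding reg_at_def by auto
next
  assume "reg_at X x h"
  then obtain U' F' where U': "(U', F') \<in> atlas X" "x \<in> U'" "chart_reg U' F' x h"
    unfolding reg_at_def by auto
  obtain p q where pq: "p \<in> polyfun \<rat> F'" "q \<in> polyfun \<rat> F'" "q x \<noteq> 0"
    "\<forall>y\<in>U'. q y \<noteq> 0 \<longrightarrow> h y = p y / q y"
    using U'(3) by (rule chart_regE)
  obtain r where r: "r \<in> polyfun \<rat> F" "r x \<noteq> 0" "\<forall>y\<in>U. r y \<noteq> 0 \<longrightarrow> y \<in> U'"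
    "\<forall>g\<in>F'. chart_reg U F x g"
    using prevar_overlap[OF X U(1) U'(1) U(2) U'(2)] .
  have p: "chart_reg U F x (\<lambda>y. p y)" and q: "chart_reg U F x (\<lambda>y. q y)"
    using bspec[OF r(4)] by (auto intro: chart_reg_polyfun_comp[OF pq(1)] chart_reg_polyfun_comp[OF pq(2)])
  obtain s where s: "s \<in> polyfun \<rat> F" "s x \<noteq> 0" "\<forall>y\<in>U. s y \<noteq> 0 \<longrightarrow> q y \<noteq> 0"
    using chart_reg_nonzero[OF q U(2) pq(3)] by (elim bexE conjE)
  show "chart_reg U F x h"
  proof (rule chart_reg_cong)
    show "chart_reg U F x (\<lambda>y. p y * inverse (q y))"
      by (rule chart_reg_mult[OF p chart_reg_inverse[OF q U(2) pq(3)]])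
    show "(\<lambda>y. r y * s y) \<in> polyfun \<rat> F" by (rule polyfun.mult[OF r(1) s(1)])
  qed (use pq(4) r(2,3) s(2,3) in \<open>auto simp: divide_inverse\<close>)
qed

lemma reg_at_pts: "prevar X \<Longrightarrow> reg_at X x h \<Longrightarrow> x \<in> pts X"
  unfolding reg_at_def using prevar_chart_subset by fastforce

lemma reg_at_poly: "(U, F) \<in> atlas X \<Longrightarrow> x \<in> U \<Longrightarrow> f \<in> polyfun \<rat> F \<Longrightarrow> reg_at X x f"
  unfolding reg_at_def using chart_reg_poly by fastforce

lemma reg_at_const:
  assumes "prevar X" "x \<in> pts X" "c \<in> \<rat>" shows "reg_at X x (\<lambda>_. c)"
proof -
  obtain U F where "(U, F) \<in> atlas X" "x \<in> U" by (rule prevar_cover[OF assms(1,2)])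
  then show ?thesis by (rule reg_at_poly) (rule polyfun.const[OF assms(3)])
qed

lemma reg_at_add:
  assumes "prevar X" "reg_at X x f" "reg_at X x g"
  shows "reg_at X x (\<lambda>y. f y + g y)"
proof -
  obtain U F where U: "(U, F) \<in> atlas X" "x \<in> U"
    by (rule prevar_cover[OF assms(1) reg_at_pts[OF assms(1,2)]])
  show ?thesis using assms(2,3) unfolding reg_at_chart[OF assms(1) U] by (rule chart_reg_add)
qed

lemma reg_at_mult:
  assumes "prevar X" "reg_at X x f" "reg_at X x g"
  shows "reg_at X x (\<lambda>y. f y * g y)"
proof -
  obtain U F where U: "(U, F) \<in> atlas X" "x \<in> U"
    by (rule prevar_cover[OF assms(1) reg_at_pts[OF assms(1,2)]])
  show ?thesis using assms(2,3) unfolding reg_at_chart[OF assms(1) U] by (rule chart_reg_mult)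
qed

lemma reg_at_inverse:
  assumes "prevar X" "reg_at X x f" "f x \<noteq> 0"
  shows "reg_at X x (\<lambda>y. inverse (f y))"
proof -
  obtain U F where U: "(U, F) \<in> atlas X" "x \<in> U"
    by (rule prevar_cover[OF assms(1) reg_at_pts[OF assms(1,2)]])
  show ?thesis
    using assms(2,3) U(2) unfolding reg_at_chart[OF assms(1) U] by (intro chart_reg_inverse)
qed

lemma reg_at_cong:
  assumes "prevar X" "reg_at X x f" "eventually (\<lambda>y. g y = f y) (near X x)"
  shows "reg_at X x g"
proof -
  obtain U F where U: "(U, F) \<in> atlas X" "x \<in> U"
    by (rule prevar_cover[OF assms(1) reg_at_pts[OF assms(1,2)]])
  obtain q where "q \<in> polyfun \<rat> F" "q x \<noteq> 0" "\<forall>y\<in>U. q y \<noteq> 0 \<longrightarrow> g y = f y"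
    using assms(3)[unfolded eventually_near_chart[OF assms(1) U]] by (elim bexE conjE)
  then show ?thesis
    using assms(2) chart_reg_cong[of U F x f q g] unfolding reg_at_chart[OF assms(1) U] by simp
qed

lemma reg_at_nonzero:
  assumes "prevar X" "reg_at X x f" "f x \<noteq> 0"
  shows "eventually (\<lambda>y. f y \<noteq> 0) (near X x)"
proof -
  obtain U F where U: "(U, F) \<in> atlas X" "x \<in> U"
    by (rule prevar_cover[OF assms(1) reg_at_pts[OF assms(1,2)]])
  show ?thesis
    using assms(2,3) U(2)
    unfolding eventually_near_chart[OF assms(1) U] reg_at_chart[OF assms(1) U]
    by (intro chart_reg_nonzero)
qed

lemma reg_at_polyfun_comp:
  assumes "prevar X" "x \<in> pts X" "f \<in> polyfun \<rat> H" "\<And>g. g \<in> H \<Longrightarrow> reg_at X x (\<lambda>y. g (\<phi> y))"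
  shows "reg_at X x (\<lambda>y. f (\<phi> y))"
  using assms(3)
  by induction (auto intro: assms reg_at_const reg_at_add reg_at_mult)

text \<open>Only the germ of \<phi> at \<open>x\<close> matters, as \<open>morph_at_cong\<close>
  shows. A partial map \<open>f\<close> can thus enter as the total function
  \<open>the (f y)\<close>, whose values off \<open>dom f\<close> are harmless once
  \<open>dom f\<close> is a neighbourhood of \<open>x\<close>.\<close>

definition morph_at ::
  "('a, 'm) var_scheme \<Rightarrow> ('b, 'n) var_scheme \<Rightarrow> 'a \<Rightarrow> ('a \<Rightarrow> 'b) \<Rightarrow> bool" where
  "morph_at X Y x \<phi> \<longleftrightarrow> x \<in> pts X \<and>
     (\<exists>(V, H)\<in>atlas Y. \<phi> x \<in> V \<and> eventually (\<lambda>y. \<phi> y \<in> V) (near X x) \<and>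
        (\<forall>g\<in>H. reg_at X x (\<lambda>y. g (\<phi> y))))"

lemma morph_atI:
  assumes "prevar X" "x \<in> pts X" "(V, H) \<in> atlas Y" "eventually (\<lambda>y. \<phi> y \<in> V) (near X x)"
    "\<And>g. g \<in> H \<Longrightarrow> reg_at X x (\<lambda>y. g (\<phi> y))"
  shows "morph_at X Y x \<phi>"
  unfolding morph_at_def
  using assms eventually_near_imp[OF assms(1,2,4)] by (intro conjI bexI[of _ "(V, H)"]) auto

lemma morph_atE:
  assumes "morph_at X Y x \<phi>"
  obtains V H where "x \<in> pts X" "(V, H) \<in> atlas Y" "\<phi> x \<in> V"
    "eventually (\<lambda>y. \<phi> y \<in> V) (near X x)" "\<forall>g\<in>H. reg_at X x (\<lambda>y. g (\<phi> y))"
  using assms unfolding morph_at_def by auto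

lemma morph_at_source: "morph_at X Y x \<phi> \<Longrightarrow> x \<in> pts X"
  by (simp add: morph_at_def)

lemma morph_at_target: "prevar Y \<Longrightarrow> morph_at X Y x \<phi> \<Longrightarrow> \<phi> x \<in> pts Y"
  using prevar_chart_subset[of Y] by (auto elim!: morph_atE)

text \<open>Continuity: a principal open set of a target chart is given by q \<noteq> 0, and q
  composed with \<phi> is again regular.\<close>

lemma morph_at_eventually:
  assumes "prevar X" "prevar Y" "morph_at X Y x \<phi>" "eventually P (near Y (\<phi> x))"
  shows "eventually (\<lambda>y. P (\<phi> y)) (near X x)"
proof -
  obtain V H where V: "x \<in> pts X" "(V, H) \<in> atlas Y" "\<phi> x \<in> V"
    "eventually (\<lambda>y. \<phi> y \<in> V) (near X x)" "\<forall>g\<in>H. reg_at X x (\<lambda>y. g (\<phi> y))"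
    using assms(3) by (rule morph_atE)
  obtain q where q: "q \<in> polyfun \<rat> H" "q (\<phi> x) \<noteq> 0" "\<forall>y\<in>V. q y \<noteq> 0 \<longrightarrow> P y"
    using assms(4)[unfolded eventually_near_chart[OF assms(2) V(2,3)]] by (elim bexE conjE)
  have "reg_at X x (\<lambda>y. q (\<phi> y))"
    by (rule reg_at_polyfun_comp[OF assms(1) V(1) q(1)]) (rule bspec[OF V(5)])
  then have "eventually (\<lambda>y. q (\<phi> y) \<noteq> 0) (near X x)"
    by (rule reg_at_nonzero[OF assms(1)]) (rule q(2))
  with V(4) show ?thesis by eventually_elim (use q(3) in auto)
qed

lemma reg_at_comp:
  assumes "prevar X" "prevar Y" "morph_at X Y x \<phi>" "reg_at Y (\<phi> x) h"
  shows "reg_at X x (\<lambda>y. h (\<phi> y))"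
proof -
  obtain V H where V: "x \<in> pts X" "(V, H) \<in> atlas Y" "\<phi> x \<in> V"
    "eventually (\<lambda>y. \<phi> y \<in> V) (near X x)" "\<forall>g\<in>H. reg_at X x (\<lambda>y. g (\<phi> y))"
    using assms(3) by (rule morph_atE)
  obtain p q where pq: "p \<in> polyfun \<rat> H" "q \<in> polyfun \<rat> H" "q (\<phi> x) \<noteq> 0"
    "\<forall>y\<in>V. q y \<noteq> 0 \<longrightarrow> h y = p y / q y"
    using assms(4)[unfolded reg_at_chart[OF assms(2) V(2,3)]] by (rule chart_regE)
  have p: "reg_at X x (\<lambda>y. p (\<phi> y))"
    by (rule reg_at_polyfun_comp[OF assms(1) V(1) pq(1)]) (rule bspec[OF V(5)])
  have q: "reg_at X x (\<lambda>y. q (\<phi> y))"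
    by (rule reg_at_polyfun_comp[OF assms(1) V(1) pq(2)]) (rule bspec[OF V(5)])
  have "eventually (\<lambda>y. q (\<phi> y) \<noteq> 0) (near X x)"
    by (rule reg_at_nonzero[OF assms(1) q]) (rule pq(3))
  with V(4) have "eventually (\<lambda>y. h (\<phi> y) = p (\<phi> y) * inverse (q (\<phi> y))) (near X x)"
    by eventually_elim (use pq(4) in \<open>auto simp: divide_inverse\<close>)
  then show ?thesis
    by (rule reg_at_cong[OF assms(1) reg_at_mult[OF assms(1) p reg_at_inverse[OF assms(1) q pq(3)]]])
qed

lemma eventually_near_in_chart:
  "prevar X \<Longrightarrow> (U, F) \<in> atlas X \<Longrightarrow> x \<in> U \<Longrightarrow> eventually (\<lambda>y. y \<in> U) (near X x)"
  by (subst eventually_near_chart) (auto intro!: bexI[of _ "\<lambda>_. 1"] polyfun.const)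

lemma morph_at_chart:
  assumes "prevar X" "prevar Y" "morph_at X Y x \<phi>" "(V, H) \<in> atlas Y" "\<phi> x \<in> V"
  shows "eventually (\<lambda>y. \<phi> y \<in> V) (near X x)" "\<And>g. g \<in> H \<Longrightarrow> reg_at X x (\<lambda>y. g (\<phi> y))"
proof -
  show "eventually (\<lambda>y. \<phi> y \<in> V) (near X x)"
    by (rule morph_at_eventually[OF assms(1-3) eventually_near_in_chart[OF assms(2,4,5)]])
  show "reg_at X x (\<lambda>y. g (\<phi> y))" if "g \<in> H" for g
    by (rule reg_at_comp[OF assms(1-3) reg_at_poly[OF assms(4,5) polyfun.gen[OF that]]])
qed

lemma morph_at_comp:
  assumes "prevar X" "prevar Y" "prevar Z" "morph_at X Y x \<phi>" "morph_at Y Z (\<phi> x) \<psi>"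
  shows "morph_at X Z x (\<lambda>y. \<psi> (\<phi> y))"
proof -
  obtain V H where V: "(V, H) \<in> atlas Z" "eventually (\<lambda>y. \<psi> y \<in> V) (near Y (\<phi> x))"
    "\<forall>g\<in>H. reg_at Y (\<phi> x) (\<lambda>y. g (\<psi> y))"
    using assms(5) by (rule morph_atE)
  show ?thesis
    by (rule morph_atI[OF assms(1) morph_at_source[OF assms(4)] V(1)
          morph_at_eventually[OF assms(1,2,4) V(2)] reg_at_comp[OF assms(1,2,4) bspec[OF V(3)]]])
qed

lemma morph_at_cong:
  assumes "prevar X" "prevar Y" "morph_at X Y x \<phi>" "eventually (\<lambda>y. \<psi> y = \<phi> y) (near X x)"
  shows "morph_at X Y x \<psi>"
proof -
  obtain V H where V: "x \<in> pts X" "(V, H) \<in> atlas Y"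
    "eventually (\<lambda>y. \<phi> y \<in> V) (near X x)" "\<forall>g\<in>H. reg_at X x (\<lambda>y. g (\<phi> y))"
    using assms(3) by (rule morph_atE)
  have "eventually (\<lambda>y. \<psi> y \<in> V) (near X x)"
    using V(3) assms(4) by eventually_elim simp
  then show ?thesis
  proof (rule morph_atI[OF assms(1) V(1,2)])
    fix g assume "g \<in> H"
    have "eventually (\<lambda>y. g (\<psi> y) = g (\<phi> y)) (near X x)"
      using assms(4) by eventually_elim simp
    then show "reg_at X x (\<lambda>y. g (\<psi> y))"
      by (rule reg_at_cong[OF assms(1) bspec[OF V(4) \<open>g \<in> H\<close>]])
  qed
qed

lemma morph_at_id:
  assumes "prevar X" "x \<in> pts X" shows "morph_at X X x (\<lambda>y. y)"
proof -
  obtain U F where U: "(U, F) \<in> atlas X" "x \<in> U" by (rule prevar_cover[OF assms])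
  show ?thesis
    by (rule morph_atI[OF assms U(1) eventually_near_in_chart[OF assms(1) U]])
       (rule reg_at_poly[OF U polyfun.gen])
qed

text \<open>Separates openness of the domain from a condition on germs, which composes well. The
  converse uses the finiteness of the target coordinates to find a single denominator.\<close>

lemma regular_map_iff:
  assumes "prevar X" "prevar Y"
  shows "regular_map X Y f \<longleftrightarrow> dom f \<subseteq> pts X \<and>
    (\<forall>x\<in>dom f. eventually (\<lambda>y. y \<in> dom f) (near X x) \<and> morph_at X Y x (\<lambda>y. the (f y)))"
proof (intro iffI conjI ballI)
  assume f: "regular_map X Y f"
  then show sub: "dom f \<subseteq> pts X" by (simp add: regular_map_def)
  fix x assume x: "x \<in> dom f"
  have "\<exists>(U, F)\<in>atlas X. \<exists>(V, H)\<in>atlas Y. \<exists>q\<in>polyfun \<rat> F.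
        x \<in> U \<and> q x \<noteq> 0 \<and> (\<forall>y\<in>U. q y \<noteq> 0 \<longrightarrow> (\<exists>z\<in>V. f y = Some z)) \<and>
        (\<forall>g\<in>H. \<exists>p\<in>polyfun \<rat> F. \<forall>y\<in>U. q y \<noteq> 0 \<longrightarrow> g (the (f y)) = p y / q y)"
    using bspec[OF conjunct2[OF f[unfolded regular_map_def]] x] .
  then obtain U F V H q where U: "(U, F) \<in> atlas X" "x \<in> U" and V: "(V, H) \<in> atlas Y"
    and q: "q \<in> polyfun \<rat> F" "q x \<noteq> 0" "\<forall>y\<in>U. q y \<noteq> 0 \<longrightarrow> (\<exists>z\<in>V. f y = Some z)"
      "\<forall>g\<in>H. \<exists>p\<in>polyfun \<rat> F. \<forall>y\<in>U. q y \<noteq> 0 \<longrightarrow> g (the (f y)) = p y / q y"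
    by (elim bexE case_prodE conjE) simp
  have ev: "eventually (\<lambda>y. \<exists>z\<in>V. f y = Some z) (near X x)"
    unfolding eventually_near_chart[OF assms(1) U] by (rule bexI[OF _ q(1)]) (use q in auto)
  then show "eventually (\<lambda>y. y \<in> dom f) (near X x)" by eventually_elim auto
  show "morph_at X Y x (\<lambda>y. the (f y))"
  proof (rule morph_atI[OF assms(1) _ V])
    show "x \<in> pts X" using x sub by auto
    show "eventually (\<lambda>y. the (f y) \<in> V) (near X x)" using ev by eventually_elim auto
    fix g assume g: "g \<in> H"
    obtain p where "p \<in> polyfun \<rat> F" "\<forall>y\<in>U. q y \<noteq> 0 \<longrightarrow> g (the (f y)) = p y / q y"
      using bspec[OF q(4) g] by (elim bexE)
    then show "reg_at X x (\<lambda>y. g (the (f y)))"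
      unfolding reg_at_chart[OF assms(1) U] using q(1,2) by (intro chart_regI[of p F q]) auto
  qed
next
  assume f: "dom f \<subseteq> pts X \<and>
    (\<forall>x\<in>dom f. eventually (\<lambda>y. y \<in> dom f) (near X x) \<and> morph_at X Y x (\<lambda>y. the (f y)))"
  show "regular_map X Y f"
    unfolding regular_map_def
  proof (intro conjI ballI)
    show "dom f \<subseteq> pts X" using f by simp
    fix x assume x: "x \<in> dom f"
    then have x': "x \<in> pts X" "eventually (\<lambda>y. y \<in> dom f) (near X x)"
      "morph_at X Y x (\<lambda>y. the (f y))" using f by auto
    obtain U F where U: "(U, F) \<in> atlas X" "x \<in> U" by (rule prevar_cover[OF assms(1) x'(1)])
    obtain V H where V: "(V, H) \<in> atlas Y"
      "eventually (\<lambda>y. the (f y) \<in> V) (near X x)" "\<forall>g\<in>H. reg_at X x (\<lambda>y. g (the (f y)))"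
      using x'(3) by (rule morph_atE)
    have "eventually (\<lambda>y. \<exists>z\<in>V. f y = Some z) (near X x)"
      using x'(2) V(2) by eventually_elim auto
    then obtain r where r: "r \<in> polyfun \<rat> F" "r x \<noteq> 0" "\<forall>y\<in>U. r y \<noteq> 0 \<longrightarrow> (\<exists>z\<in>V. f y = Some z)"
      unfolding eventually_near_chart[OF assms(1) U] by (elim bexE conjE)
    have "\<exists>q\<in>polyfun \<rat> F. q x \<noteq> 0 \<and> (\<forall>y. q y \<noteq> 0 \<longrightarrow> r y \<noteq> 0) \<and>
      (\<forall>g\<in>H. \<exists>p\<in>polyfun \<rat> F. \<forall>y\<in>U. q y \<noteq> 0 \<longrightarrow> g (the (f y)) = p y / q y)"
      using V(3) unfolding reg_at_chart[OF assms(1) U]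
      by (intro chart_reg_common_denominator[OF prevar_finite[OF assms(2) V(1)] _ r(1,2)])
    then obtain q where q: "q \<in> polyfun \<rat> F" "q x \<noteq> 0" "\<forall>y. q y \<noteq> 0 \<longrightarrow> r y \<noteq> 0"
      "\<forall>g\<in>H. \<exists>p\<in>polyfun \<rat> F. \<forall>y\<in>U. q y \<noteq> 0 \<longrightarrow> g (the (f y)) = p y / q y"
      by (elim bexE conjE)
    show "\<exists>(U, F)\<in>atlas X. \<exists>(V, H)\<in>atlas Y. \<exists>q\<in>polyfun \<rat> F.
        x \<in> U \<and> q x \<noteq> 0 \<and> (\<forall>y\<in>U. q y \<noteq> 0 \<longrightarrow> (\<exists>z\<in>V. f y = Some z)) \<and>
        (\<forall>g\<in>H. \<exists>p\<in>polyfun \<rat> F. \<forall>y\<in>U. q y \<noteq> 0 \<longrightarrow> g (the (f y)) = p y / q y)"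
      by (intro bexI[OF _ U(1)] bexI[OF _ V(1)] case_prodI bexI[OF _ q(1)] conjI U(2) q(2,4))
         (use q(3) r(3) in auto)
  qed
qed

lemma regular_mapD:
  assumes "prevar X" "prevar Y" "regular_map X Y f" "x \<in> dom f"
  shows "x \<in> pts X" "eventually (\<lambda>y. y \<in> dom f) (near X x)" "morph_at X Y x (\<lambda>y. the (f y))"
    "the (f x) \<in> pts Y"
proof -
  show "x \<in> pts X" "eventually (\<lambda>y. y \<in> dom f) (near X x)" and m: "morph_at X Y x (\<lambda>y. the (f y))"
    using assms regular_map_iff[OF assms(1,2), of f] by auto
  show "the (f x) \<in> pts Y" using morph_at_target[OF assms(2) m] .
qed

lemma regular_map_dom_open:
  assumes "prevar X" "prevar Y" "regular_map X Y f"
  shows "zariski_open X (dom f)"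
proof (rule zariski_openI)
  show "dom f \<subseteq> pts X" using assms by (simp add: regular_map_def)
  fix U F x assume "(U, F) \<in> atlas X" "x \<in> U" "x \<in> dom f"
  then show "\<exists>q\<in>polyfun \<rat> F. q x \<noteq> 0 \<and> (\<forall>y\<in>U. q y \<noteq> 0 \<longrightarrow> y \<in> dom f)"
    using regular_mapD(2)[OF assms] eventually_near_chart[OF assms(1), of U F x "\<lambda>y. y \<in> dom f"]
    by simp
qed

lemma regular_map_target:
  assumes "prevar X" "prevar Y" "regular_map X Y f" "f x = Some y"
  shows "x \<in> pts X" "y \<in> pts Y"
  using regular_mapD(1,4)[OF assms(1-3), of x] assms(4) by auto


subsection \<open>Products\<close>

lemma pts_prod [simp]: "pts (X \<times>\<^sub>v Y) = pts X \<times> pts Y"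
  by (simp add: prod_var_def)

lemma atlas_prodI:
  "(U, F) \<in> atlas X \<Longrightarrow> (V, H) \<in> atlas Y \<Longrightarrow>
    (U \<times> V, (\<lambda>f. f \<circ> fst) ` F \<union> (\<lambda>g. g \<circ> snd) ` H) \<in> atlas (X \<times>\<^sub>v Y)"
  unfolding prod_var_def by auto

lemma atlas_prodE:
  assumes "(W, K) \<in> atlas (X \<times>\<^sub>v Y)"
  obtains U F V H where "(U, F) \<in> atlas X" "(V, H) \<in> atlas Y" "W = U \<times> V"
    "K = (\<lambda>f. f \<circ> fst) ` F \<union> (\<lambda>g. g \<circ> snd) ` H"
  using assms unfolding prod_var_def by auto

lemma polyfun_fst: "p \<in> polyfun k F \<Longrightarrow> (\<lambda>z. p (fst z)) \<in> polyfun k ((\<lambda>f. f \<circ> fst) ` F \<union> K)"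
  by (erule polyfun_comp) (auto intro!: polyfun.gen image_eqI simp: comp_def)

lemma polyfun_snd: "p \<in> polyfun k H \<Longrightarrow> (\<lambda>z. p (snd z)) \<in> polyfun k (K \<union> (\<lambda>g. g \<circ> snd) ` H)"
  by (erule polyfun_comp) (auto intro!: polyfun.gen image_eqI simp: comp_def)

lemma chart_reg_fst:
  assumes "chart_reg U F (fst z) h"
  shows "chart_reg (U \<times> V) ((\<lambda>f. f \<circ> fst) ` F \<union> K) z (h \<circ> fst)"
  using assms
  by (rule chart_regE) (rule chart_regI[OF polyfun_fst polyfun_fst], auto)

lemma chart_reg_snd:
  assumes "chart_reg V H (snd z) h"
  shows "chart_reg (U \<times> V) (K \<union> (\<lambda>g. g \<circ> snd) ` H) z (h \<circ> snd)"
  using assms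
  by (rule chart_regE) (rule chart_regI[OF polyfun_snd polyfun_snd], auto)

lemma prevar_prod:
  assumes "prevar X" "prevar Y"
  shows "prevar (X \<times>\<^sub>v Y)"
  unfolding prevar_def
proof (intro conjI)
  show "\<Union> (fst ` atlas (X \<times>\<^sub>v Y)) = pts (X \<times>\<^sub>v Y)"
  proof
    show "\<Union> (fst ` atlas (X \<times>\<^sub>v Y)) \<subseteq> pts (X \<times>\<^sub>v Y)"
    proof clarify
      fix W K a b assume "(W, K) \<in> atlas (X \<times>\<^sub>v Y)" "(a, b) \<in> fst (W, K)"
      then show "(a, b) \<in> pts (X \<times>\<^sub>v Y)"
        using subsetD[OF prevar_chart_subset[OF assms(1)]] subsetD[OF prevar_chart_subset[OF assms(2)]]
        by (auto elim!: atlas_prodE)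
    qed
    show "pts (X \<times>\<^sub>v Y) \<subseteq> \<Union> (fst ` atlas (X \<times>\<^sub>v Y))"
    proof clarify
      fix a b assume "(a, b) \<in> pts (X \<times>\<^sub>v Y)"
      then have ab: "a \<in> pts X" "b \<in> pts Y" by auto
      obtain U F where U: "(U, F) \<in> atlas X" "a \<in> U" by (rule prevar_cover[OF assms(1) ab(1)])
      obtain V H where V: "(V, H) \<in> atlas Y" "b \<in> V" by (rule prevar_cover[OF assms(2) ab(2)])
      show "(a, b) \<in> \<Union> (fst ` atlas (X \<times>\<^sub>v Y))"
        using U(2) V(2) by (intro UN_I[OF atlas_prodI[OF U(1) V(1)]]) simp
    qed
  qed
  show "\<forall>(W, K)\<in>atlas (X \<times>\<^sub>v Y). finite K"
    using prevar_finite[OF assms(1)] prevar_finite[OF assms(2)] by (auto elim!: atlas_prodE)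
  show "\<forall>(W, K)\<in>atlas (X \<times>\<^sub>v Y). \<forall>(W', K')\<in>atlas (X \<times>\<^sub>v Y). \<forall>z\<in>W \<inter> W'.
    (\<exists>q\<in>polyfun \<rat> K. q z \<noteq> 0 \<and> {y \<in> W. q y \<noteq> 0} \<subseteq> W') \<and> (\<forall>g\<in>K'. chart_reg W K z g)"
  proof (intro ballI case_prodI2 impI)
    fix c c' W K W' K' z
    assume c: "c \<in> atlas (X \<times>\<^sub>v Y)" "c = (W, K)" "c' \<in> atlas (X \<times>\<^sub>v Y)" "c' = (W', K')"
      and z: "z \<in> W \<inter> W'"
    obtain U F V H where 1: "(U, F) \<in> atlas X" "(V, H) \<in> atlas Y" "W = U \<times> V"
      "K = (\<lambda>f. f \<circ> fst) ` F \<union> (\<lambda>g. g \<circ> snd) ` H"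
      using c(1)[unfolded c(2)] by (rule atlas_prodE)
    obtain U' F' V' H' where 2: "(U', F') \<in> atlas X" "(V', H') \<in> atlas Y" "W' = U' \<times> V'"
      "K' = (\<lambda>f. f \<circ> fst) ` F' \<union> (\<lambda>g. g \<circ> snd) ` H'"
      using c(3)[unfolded c(4)] by (rule atlas_prodE)
    have zz: "fst z \<in> U" "fst z \<in> U'" "snd z \<in> V" "snd z \<in> V'" using z 1(3) 2(3) by auto
    obtain q where q: "q \<in> polyfun \<rat> F" "q (fst z) \<noteq> 0" "\<forall>y\<in>U. q y \<noteq> 0 \<longrightarrow> y \<in> U'"
      "\<forall>g\<in>F'. chart_reg U F (fst z) g"
      using prevar_overlap[OF assms(1) 1(1) 2(1) zz(1,2)] .
    obtain r where r: "r \<in> polyfun \<rat> H" "r (snd z) \<noteq> 0" "\<forall>y\<in>V. r y \<noteq> 0 \<longrightarrow> y \<in> V'"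
      "\<forall>g\<in>H'. chart_reg V H (snd z) g"
      using prevar_overlap[OF assms(2) 1(2) 2(2) zz(3,4)] .
    have "(\<lambda>z. q (fst z) * r (snd z)) \<in> polyfun \<rat> K"
      unfolding 1(4) by (rule polyfun.mult[OF polyfun_fst[OF q(1)] polyfun_snd[OF r(1)]])
    then have "\<exists>q\<in>polyfun \<rat> K. q z \<noteq> 0 \<and> {y \<in> W. q y \<noteq> 0} \<subseteq> W'"
      by (rule bexI[rotated]) (use q r 1(3) 2(3) in auto)
    moreover have "chart_reg W K z g" if "g \<in> K'" for g
      using that[unfolded 2(4)] unfolding 1(3,4)
      using chart_reg_fst[OF bspec[OF q(4)]] chart_reg_snd[OF bspec[OF r(4)]] by auto
    ultimately show "(\<exists>q\<in>polyfun \<rat> K. q z \<noteq> 0 \<and> {y \<in> W. q y \<noteq> 0} \<subseteq> W') \<and>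
      (\<forall>g\<in>K'. chart_reg W K z g)" by simp
  qed
qed

lemma morph_at_fst:
  assumes "prevar X" "prevar Y" "z \<in> pts (X \<times>\<^sub>v Y)"
  shows "morph_at (X \<times>\<^sub>v Y) X z fst"
proof -
  have P: "prevar (X \<times>\<^sub>v Y)" by (rule prevar_prod[OF assms(1,2)])
  obtain W K where W: "(W, K) \<in> atlas (X \<times>\<^sub>v Y)" "z \<in> W" by (rule prevar_cover[OF P assms(3)])
  obtain U F V H where 1: "(U, F) \<in> atlas X" "(V, H) \<in> atlas Y" "W = U \<times> V"
    "K = (\<lambda>f. f \<circ> fst) ` F \<union> (\<lambda>g. g \<circ> snd) ` H" using W(1) by (rule atlas_prodE)
  show ?thesis
  proof (rule morph_atI[OF P assms(3) 1(1)])
    show "eventually (\<lambda>y. fst y \<in> U) (near (X \<times>\<^sub>v Y) z)"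
      using eventually_near_in_chart[OF P W] by eventually_elim (use 1(3) in auto)
    show "reg_at (X \<times>\<^sub>v Y) z (\<lambda>y. g (fst y))" if "g \<in> F" for g
      using reg_at_poly[OF W, unfolded 1(4), OF polyfun_fst[OF polyfun.gen[OF that]]] .
  qed
qed

lemma morph_at_snd:
  assumes "prevar X" "prevar Y" "z \<in> pts (X \<times>\<^sub>v Y)"
  shows "morph_at (X \<times>\<^sub>v Y) Y z snd"
proof -
  have P: "prevar (X \<times>\<^sub>v Y)" by (rule prevar_prod[OF assms(1,2)])
  obtain W K where W: "(W, K) \<in> atlas (X \<times>\<^sub>v Y)" "z \<in> W" by (rule prevar_cover[OF P assms(3)])
  obtain U F V H where 1: "(U, F) \<in> atlas X" "(V, H) \<in> atlas Y" "W = U \<times> V"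
    "K = (\<lambda>f. f \<circ> fst) ` F \<union> (\<lambda>g. g \<circ> snd) ` H" using W(1) by (rule atlas_prodE)
  show ?thesis
  proof (rule morph_atI[OF P assms(3) 1(2)])
    show "eventually (\<lambda>y. snd y \<in> V) (near (X \<times>\<^sub>v Y) z)"
      using eventually_near_in_chart[OF P W] by eventually_elim (use 1(3) in auto)
    show "reg_at (X \<times>\<^sub>v Y) z (\<lambda>y. g (snd y))" if "g \<in> H" for g
      using reg_at_poly[OF W, unfolded 1(4), OF polyfun_snd[OF polyfun.gen[OF that]]] .
  qed
qed

lemma morph_at_Pair:
  assumes "prevar X" "morph_at X Y x \<phi>" "morph_at X Z x \<psi>"
  shows "morph_at X (Y \<times>\<^sub>v Z) x (\<lambda>y. (\<phi> y, \<psi> y))"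
proof -
  obtain U F where U: "(U, F) \<in> atlas Y" "eventually (\<lambda>y. \<phi> y \<in> U) (near X x)"
    "\<forall>g\<in>F. reg_at X x (\<lambda>y. g (\<phi> y))" using assms(2) by (rule morph_atE)
  obtain V H where V: "(V, H) \<in> atlas Z" "eventually (\<lambda>y. \<psi> y \<in> V) (near X x)"
    "\<forall>g\<in>H. reg_at X x (\<lambda>y. g (\<psi> y))" using assms(3) by (rule morph_atE)
  show ?thesis
  proof (rule morph_atI[OF assms(1) morph_at_source[OF assms(2)] atlas_prodI[OF U(1) V(1)]])
    show "eventually (\<lambda>y. (\<phi> y, \<psi> y) \<in> U \<times> V) (near X x)"
      using U(2) V(2) by eventually_elim simp
  qed (use U(3) V(3) in auto)
qed


subsection \<open>Separatedness and maximal extensions\<close>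

definition separated :: "('a, 'm) var_scheme \<Rightarrow> bool" where
  "separated X \<longleftrightarrow> zariski_open (X \<times>\<^sub>v X) {(x, y). x \<in> pts X \<and> y \<in> pts X \<and> x \<noteq> y}"

lemma variety_separated: "variety X \<Longrightarrow> separated X"
  by (simp add: variety_def separated_def)

text \<open>Pairs of distinct points form an open set by separatedness. If the values differed at
  \<open>x\<close>, they would differ near \<open>x\<close>, and this neighbourhood meets the dense
  set of agreement.\<close>

lemma morph_at_agree:
  assumes "prevar X" "prevar Y" "separated Y" "morph_at X Y x \<phi>" "morph_at X Y x \<psi>"
    "eventually (\<lambda>y. \<phi> y = \<psi> y) (generic X)"
  shows "\<phi> x = \<psi> x"
proof (rule ccontr)
  let ?D = "{(a, b). a \<in> pts Y \<and> b \<in> pts Y \<and> a \<noteq> b}"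
  have P: "prevar (Y \<times>\<^sub>v Y)" by (rule prevar_prod[OF assms(2,2)])
  assume "\<phi> x \<noteq> \<psi> x"
  then have "(\<phi> x, \<psi> x) \<in> ?D"
    using morph_at_target[OF assms(2,4)] morph_at_target[OF assms(2,5)] by simp
  then have "eventually (\<lambda>z. z \<in> ?D) (near (Y \<times>\<^sub>v Y) (\<phi> x, \<psi> x))"
    using eventually_near_open[OF P assms(3)[unfolded separated_def]] by blast
  then have "eventually (\<lambda>y. (\<phi> y, \<psi> y) \<in> ?D) (near X x)"
    by (rule morph_at_eventually[OF assms(1) P morph_at_Pair[OF assms(1,4,5)]])
  from generic_meets_near[OF assms(1) morph_at_source[OF assms(4)] assms(6) this]
  show False by auto
qed

lemma regular_map_agree:
  assumes "prevar X" "prevar Y" "separated Y" "regular_map X Y f" "regular_map X Y g"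
    "rat_equiv X f g" "x \<in> dom f" "x \<in> dom g"
  shows "f x = g x"
proof -
  have "eventually (\<lambda>y. the (f y) = the (g y)) (generic X)"
    using assms(6)[unfolded rat_equiv_iff[OF assms(1)]] by eventually_elim auto
  then have "the (f x) = the (g x)"
    using assms by (intro morph_at_agree[OF assms(1-3)] regular_mapD(3))
  then show ?thesis using assms(7,8) by auto
qed

lemma rat_equiv_sym: "rat_equiv X f g \<Longrightarrow> rat_equiv X g f"
  unfolding rat_equiv_def by (elim exE conjE, rule exI) auto

lemma rat_equiv_trans:
  assumes "prevar X" "rat_equiv X f g" "rat_equiv X g h" shows "rat_equiv X f h"
  using assms(2,3) unfolding rat_equiv_iff[OF assms(1)] by eventually_elim auto

text \<open>\<open>rat_ext\<close> glues all regular representatives; separatedness makes any two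
  agree where both are defined, so the definite description is unambiguous. The representative
  \<open>g\<close> certifies that there is something to glue, and it is extended at every point of
  its own domain.\<close>

lemma rat_ext_props:
  assumes X: "prevar X" and Y: "prevar Y" "separated Y"
    and g: "regular_map X Y g" "rat_equiv X f g"
  shows "rational_map X Y (rat_ext X Y f)" "g \<subseteq>\<^sub>m rat_ext X Y f"
proof -
  define P where "P x y \<longleftrightarrow> (\<exists>g. regular_map X Y g \<and> rat_equiv X f g \<and> g x = Some y)" for x y
  have uniq: "y = y'" if "P x y" "P x y'" for x y y'
  proof -
    obtain h where h: "regular_map X Y h" "rat_equiv X f h" "h x = Some y"
      using \<open>P x y\<close> unfolding P_def by auto
    obtain h' where h': "regular_map X Y h'" "rat_equiv X f h'" "h' x = Some y'"
      using \<open>P x y'\<close> unfolding P_def by auto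
    have "h x = h' x"
      using h h' rat_equiv_trans[OF X rat_equiv_sym[OF h(2)] h'(2)]
      by (intro regular_map_agree[OF X Y]) auto
    then show ?thesis using h h' by simp
  qed
  have ext: "rat_ext X Y f x = Some y \<longleftrightarrow> P x y" for x y
  proof -
    have "rat_ext X Y f x = (if \<exists>y. P x y then Some (THE y. P x y) else None)"
      unfolding rat_ext_def P_def Let_def ..
    moreover have "P x y' \<Longrightarrow> (THE y. P x y) = y'" for y'
      using uniq by (intro the_equality) auto
    ultimately show ?thesis by auto
  qed
  have le: "h \<subseteq>\<^sub>m rat_ext X Y f" if "regular_map X Y h" "rat_equiv X f h" for h
  proof (unfold map_le_def, rule ballI)
    fix x assume "x \<in> dom h"
    then obtain y where "h x = Some y" by auto
    with that show "h x = rat_ext X Y f x" using ext[of x y] unfolding P_def by auto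
  qed
  show "g \<subseteq>\<^sub>m rat_ext X Y f" by (rule le[OF g])
  have local: "\<exists>h. regular_map X Y h \<and> rat_equiv X f h \<and> x \<in> dom h" if "x \<in> dom (rat_ext X Y f)" for x
    using that ext unfolding P_def by blast
  have reg: "regular_map X Y (rat_ext X Y f)"
    unfolding regular_map_iff[OF X Y(1)]
  proof (intro conjI ballI)
    show "dom (rat_ext X Y f) \<subseteq> pts X"
      using local regular_mapD(1)[OF X Y(1)] by blast
    fix x assume "x \<in> dom (rat_ext X Y f)"
    then obtain h where h: "regular_map X Y h" "rat_equiv X f h" "x \<in> dom h" using local by blast
    note m = regular_mapD[OF X Y(1) h(1,3)]
    have eq: "y \<in> dom (rat_ext X Y f) \<and> rat_ext X Y f y = h y" if "y \<in> dom h" for y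
      using le[OF h(1,2)] that by (metis domIff map_le_def)
    show "eventually (\<lambda>y. y \<in> dom (rat_ext X Y f)) (near X x)"
      using m(2) by eventually_elim (use eq in auto)
    have "eventually (\<lambda>y. the (rat_ext X Y f y) = the (h y)) (near X x)"
      using m(2) by eventually_elim (use eq in auto)
    then show "morph_at X Y x (\<lambda>y. the (rat_ext X Y f y))"
      by (rule morph_at_cong[OF X Y(1) m(3)])
  qed
  have eq: "rat_equiv X f (rat_ext X Y f)"
    using g(2) unfolding rat_equiv_iff[OF X]
    by eventually_elim (use le[OF g] in \<open>metis domIff map_le_def\<close>)
  show "rational_map X Y (rat_ext X Y f)"
    unfolding rational_map_def
  proof (intro conjI allI impI reg)
    show "zariski_dense X (dom (rat_ext X Y f))"
      using eq unfolding rat_equiv_def zariski_dense_def by blast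
    fix h assume "regular_map X Y h \<and> rat_equiv X (rat_ext X Y f) h"
    then show "h \<subseteq>\<^sub>m rat_ext X Y f" using le rat_equiv_trans[OF X eq] by blast
  qed
qed

lemma rational_map_generic_dom:
  assumes "prevar X" "prevar Y" "rational_map X Y f"
  shows "eventually (\<lambda>x. x \<in> dom f) (generic X)"
  using assms regular_map_dom_open[OF assms(1,2), of f]
  unfolding eventually_generic[OF assms(1)] rational_map_def by blast


section \<open>Rational slices\<close>

text \<open>An affine \<open>H\<close> whose points with rational coordinates are so plentiful that any two nonzero
  functions, even with complex coefficients, have a common rational non-zero.  This replaces
  geometric irreducibility, and lets generic statements about \<open>H \<times> X\<close> be specialised to
  slices \<open>{c} \<times> X\<close> that are defined over \<open>\<rat>\<close>.\<close>

definition rational_var :: "('h, 'm) var_scheme \<Rightarrow> bool" where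
  "rational_var H \<longleftrightarrow> prevar H \<and> pts H \<noteq> {} \<and> (\<exists>F. atlas H = {(pts H, F)} \<and>
     (\<forall>p\<in>polyfun UNIV F. \<forall>q\<in>polyfun UNIV F. \<forall>a\<in>pts H. \<forall>b\<in>pts H. p a \<noteq> 0 \<and> q b \<noteq> 0 \<longrightarrow>
        (\<exists>c\<in>pts H. (\<forall>f\<in>F. f c \<in> \<rat>) \<and> p c \<noteq> 0 \<and> q c \<noteq> 0)))"

definition rational_point :: "('h, 'm) var_scheme \<Rightarrow> 'h \<Rightarrow> bool" where
  "rational_point H c \<longleftrightarrow> c \<in> pts H \<and> (\<forall>(U, F)\<in>atlas H. \<forall>f\<in>F. f c \<in> \<rat>)"

lemma rational_varE:
  assumes "rational_var H"
  obtains F where "prevar H" "atlas H = {(pts H, F)}"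
    "\<forall>p\<in>polyfun UNIV F. \<forall>q\<in>polyfun UNIV F. \<forall>a\<in>pts H. \<forall>b\<in>pts H. p a \<noteq> 0 \<and> q b \<noteq> 0 \<longrightarrow>
        (\<exists>c\<in>pts H. (\<forall>f\<in>F. f c \<in> \<rat>) \<and> p c \<noteq> 0 \<and> q c \<noteq> 0)"
  using assms unfolding rational_var_def by (elim conjE exE)

lemma rational_var_prevar: "rational_var H \<Longrightarrow> prevar H"
  by (simp add: rational_var_def)

text \<open>The coordinates of \<open>c\<close> become constants of the coordinate ring, and the
  constants available there are the rational ones.\<close>

lemma morph_at_rational_const:
  assumes "prevar X" "prevar H" "x \<in> pts X" "rational_point H c"
  shows "morph_at X H x (\<lambda>_. c)"
proof -
  have c: "c \<in> pts H" using assms(4) by (simp add: rational_point_def)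
  obtain U F where U: "(U, F) \<in> atlas H" "c \<in> U" by (rule prevar_cover[OF assms(2) c])
  show ?thesis
  proof (rule morph_atI[OF assms(1,3) U(1)])
    fix f assume "f \<in> F"
    then have "f c \<in> \<rat>" using assms(4) U(1) unfolding rational_point_def by blast
    then show "reg_at X x (\<lambda>_. f c)" by (rule reg_at_const[OF assms(1,3)])
  qed (use U(2) in simp)
qed

lemma morph_at_slice:
  assumes "prevar X" "prevar H" "x \<in> pts X" "rational_point H c"
  shows "morph_at X (H \<times>\<^sub>v X) x (\<lambda>y. (c, y))"
  by (rule morph_at_Pair[OF assms(1) morph_at_rational_const[OF assms] morph_at_id[OF assms(1,3)]])

lemma near_prod_restrict:
  assumes "prevar H" "prevar X" "atlas H = {(pts H, F)}" "(a, x) \<in> pts (H \<times>\<^sub>v X)"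
    "eventually P (near (H \<times>\<^sub>v X) (a, x))"
  shows "\<exists>p\<in>polyfun UNIV F. p a \<noteq> 0 \<and>
    (\<forall>c. rational_point H c \<and> p c \<noteq> 0 \<longrightarrow> eventually (\<lambda>y. P (c, y)) (near X x))"
proof -
  have ax: "a \<in> pts H" "x \<in> pts X" using assms(4) by auto
  have HX: "prevar (H \<times>\<^sub>v X)" by (rule prevar_prod[OF assms(1,2)])
  obtain U K where U: "(U, K) \<in> atlas X" "x \<in> U" by (rule prevar_cover[OF assms(2) ax(2)])
  let ?K = "(\<lambda>f. f \<circ> fst) ` F \<union> (\<lambda>g. g \<circ> snd) ` K"
  have W: "(pts H \<times> U, ?K) \<in> atlas (H \<times>\<^sub>v X)"
    using U(1) assms(3) by (intro atlas_prodI) auto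
  have axU: "(a, x) \<in> pts H \<times> U" using ax U(2) by simp
  obtain q where q: "q \<in> polyfun \<rat> ?K" "q (a, x) \<noteq> 0" "\<forall>z\<in>pts H \<times> U. q z \<noteq> 0 \<longrightarrow> P z"
    using assms(5)[unfolded eventually_near_chart[OF HX W axU]] by (elim bexE conjE)
  \<comment> \<open>Freezing x turns its coordinates into constants, in general irrational ones;
    hence the complex coefficients in \<open>rational_var\<close>.\<close>
  have pol: "(\<lambda>h. q (h, x)) \<in> polyfun UNIV F"
  proof (rule polyfun_comp[OF polyfun_mono[OF q(1) subset_UNIV subset_refl]])
    fix g assume "g \<in> ?K"
    then consider f where "f \<in> F" "g = f \<circ> fst" | k where "g = k \<circ> snd" by auto
    then show "(\<lambda>h. g (h, x)) \<in> polyfun UNIV F"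
      by cases (simp_all add: polyfun.gen polyfun.const)
  qed
  show ?thesis
  proof (rule bexI[OF _ pol], intro conjI allI impI, rule q(2))
    fix c assume c: "rational_point H c \<and> q (c, x) \<noteq> 0"
    then have "(c, x) \<in> pts H \<times> U" using U(2) by (auto simp: rational_point_def)
    then have "eventually P (near (H \<times>\<^sub>v X) (c, x))"
      using c q(3) by (subst eventually_near_chart[OF HX W]) (auto intro!: bexI[OF _ q(1)])
    then show "eventually (\<lambda>y. P (c, y)) (near X x)"
      by (rule morph_at_eventually[OF assms(2) HX morph_at_slice[OF assms(2,1) ax(2) conjunct1[OF c]]])
  qed
qed

text \<open>Each condition asks only that one nonzero function on \<open>H\<close> does not vanish
  at \<open>c\<close>; \<open>rational_var\<close> meets two such conditions at once, even when they
  start from different points.\<close>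

lemma common_rational_slice:
  assumes "rational_var H" "prevar X" "(a, x) \<in> pts (H \<times>\<^sub>v X)" "(b, y) \<in> pts (H \<times>\<^sub>v X)"
    "eventually P (near (H \<times>\<^sub>v X) (a, x))" "eventually Q (near (H \<times>\<^sub>v X) (b, y))"
  shows "\<exists>c. rational_point H c \<and> eventually (\<lambda>y. P (c, y)) (near X x) \<and>
    eventually (\<lambda>y. Q (c, y)) (near X y)"
proof -
  obtain F where H: "prevar H" "atlas H = {(pts H, F)}"
    "\<forall>p\<in>polyfun UNIV F. \<forall>q\<in>polyfun UNIV F. \<forall>a\<in>pts H. \<forall>b\<in>pts H. p a \<noteq> 0 \<and> q b \<noteq> 0 \<longrightarrow>
        (\<exists>c\<in>pts H. (\<forall>f\<in>F. f c \<in> \<rat>) \<and> p c \<noteq> 0 \<and> q c \<noteq> 0)"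
    using assms(1) by (rule rational_varE)
  obtain p where p: "p \<in> polyfun UNIV F" "p a \<noteq> 0"
    "\<forall>c. rational_point H c \<and> p c \<noteq> 0 \<longrightarrow> eventually (\<lambda>y. P (c, y)) (near X x)"
    using near_prod_restrict[OF H(1) assms(2) H(2) assms(3,5)] by (elim bexE conjE)
  obtain q where q: "q \<in> polyfun UNIV F" "q b \<noteq> 0"
    "\<forall>c. rational_point H c \<and> q c \<noteq> 0 \<longrightarrow> eventually (\<lambda>z. Q (c, z)) (near X y)"
    using near_prod_restrict[OF H(1) assms(2) H(2) assms(4,6)] by (elim bexE conjE)
  have ab: "a \<in> pts H" "b \<in> pts H" using assms(3,4) by auto
  obtain c where c: "c \<in> pts H" "\<forall>f\<in>F. f c \<in> \<rat>" "p c \<noteq> 0" "q c \<noteq> 0"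
    using bspec[OF bspec[OF bspec[OF bspec[OF H(3) p(1)] q(1)] ab(1)] ab(2)] p(2) q(2) by auto
  then have "rational_point H c" using H(2) by (simp add: rational_point_def)
  then show ?thesis using p(3) q(3) c(3,4) by blast
qed

text \<open>Over \<rat> a product of irreducible varieties can be reducible, as for a point with
  quadratic residue field multiplied by itself. Here both open sets meet one common rational slice,
  a copy of \<open>X\<close>, and they intersect there.\<close>

lemma irreducible_prod:
  assumes "rational_var H" "prevar X" "irreducible_var X"
  shows "irreducible_var (H \<times>\<^sub>v X)"
  unfolding irreducible_var_def
proof (intro conjI allI impI)
  have HX: "prevar (H \<times>\<^sub>v X)" by (rule prevar_prod[OF rational_var_prevar[OF assms(1)] assms(2)])
  show "pts (H \<times>\<^sub>v X) \<noteq> {}"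
    using assms(1,3) by (simp add: rational_var_def irreducible_var_def)
  fix V V' assume V: "zariski_open (H \<times>\<^sub>v X) V \<and> zariski_open (H \<times>\<^sub>v X) V' \<and> V \<noteq> {} \<and> V' \<noteq> {}"
  then obtain a x b y where ax: "(a, x) \<in> V" and b: "(b, y) \<in> V'" by fast
  have pts: "(a, x) \<in> pts (H \<times>\<^sub>v X)" "(b, y) \<in> pts (H \<times>\<^sub>v X)"
    using V ax b unfolding zariski_open_def by blast+
  obtain c where c: "rational_point H c" "eventually (\<lambda>y. (c, y) \<in> V) (near X x)"
    "eventually (\<lambda>y. (c, y) \<in> V') (near X y)"
    using common_rational_slice[OF assms(1,2) pts, of "\<lambda>z. z \<in> V" "\<lambda>z. z \<in> V'"]
      eventually_near_open[OF HX _ ax] eventually_near_open[OF HX _ b] V by auto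
  have "eventually (\<lambda>y. (c, y) \<in> V) (generic X)"
    using pts c by (intro generic_of_near[OF assms(2,3)]) auto
  from generic_meets_near[OF assms(2) _ this c(3)] show "V \<inter> V' \<noteq> {}" using pts by auto
qed

lemma generic_slice:
  assumes "rational_var H" "prevar X" "irreducible_var X" "eventually P (generic (H \<times>\<^sub>v X))"
  shows "\<exists>c. rational_point H c \<and> eventually (\<lambda>y. P (c, y)) (generic X)"
proof -
  have HX: "prevar (H \<times>\<^sub>v X)" by (rule prevar_prod[OF rational_var_prevar[OF assms(1)] assms(2)])
  have "pts (H \<times>\<^sub>v X) \<noteq> {}"
    using irreducible_prod[OF assms(1-3)] by (simp add: irreducible_var_def)
  then obtain z where z: "z \<in> pts (H \<times>\<^sub>v X)" "eventually P (near (H \<times>\<^sub>v X) z)"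
    using generic_ex[OF HX _ eventually_generic_near[OF HX assms(4)]] by auto
  obtain a x where ax: "z = (a, x)" by fastforce
  obtain c where "rational_point H c" "eventually (\<lambda>y. P (c, y)) (near X x)"
    using common_rational_slice[OF assms(1,2) z(1)[unfolded ax] z(1)[unfolded ax] z(2)[unfolded ax] z(2)[unfolded ax]]
    by blast
  then show ?thesis using generic_of_near[OF assms(2,3)] z(1) ax by auto
qed


section \<open>The multiplicative group\<close>

lemma polyfun_Laurent:
  assumes "p \<in> polyfun UNIV {\<lambda>z::complex. z, inverse}"
  shows "\<exists>N P. \<forall>z. z \<noteq> 0 \<longrightarrow> p z * z ^ N = poly P z"
  using assms
proof induction
  case (const c)
  show ?case by (rule exI[of _ 0], rule exI[of _ "[:c:]"]) simp
next
  case (gen f)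
  then consider "f = (\<lambda>z. z)" | "f = inverse" by auto
  then show ?case
  proof cases
    case 1 then show ?thesis by (intro exI[of _ 0] exI[of _ "[:0, 1:]"]) simp
  next
    case 2 then show ?thesis by (intro exI[of _ 1] exI[of _ "[:1:]"]) simp
  qed
next
  case (add f g)
  then obtain N P M Q where *: "\<forall>z. z \<noteq> 0 \<longrightarrow> f z * z ^ N = poly P z"
    "\<forall>z. z \<noteq> 0 \<longrightarrow> g z * z ^ M = poly Q z" by blast
  have "(f z + g z) * z ^ (N + M) = poly (P * monom 1 M + Q * monom 1 N) z" if "z \<noteq> 0" for z
  proof -
    have "(f z + g z) * z ^ (N + M) = (f z * z ^ N) * z ^ M + (g z * z ^ M) * z ^ N"
      by (simp add: power_add algebra_simps)
    then show ?thesis using * that by (simp add: poly_monom)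
  qed
  then show ?case by blast
next
  case (mult f g)
  then obtain N P M Q where *: "\<forall>z. z \<noteq> 0 \<longrightarrow> f z * z ^ N = poly P z"
    "\<forall>z. z \<noteq> 0 \<longrightarrow> g z * z ^ M = poly Q z" by blast
  have "f z * g z * z ^ (N + M) = poly (P * Q) z" if "z \<noteq> 0" for z
  proof -
    have "f z * g z * z ^ (N + M) = (f z * z ^ N) * (g z * z ^ M)"
      by (simp add: power_add algebra_simps)
    then show ?thesis using * that by simp
  qed
  then show ?case by blast
qed

lemma Laurent_common_rational_nonzero:
  assumes "p \<in> polyfun UNIV {\<lambda>z::complex. z, inverse}" "q \<in> polyfun UNIV {\<lambda>z. z, inverse}"
    "a \<noteq> 0" "b \<noteq> 0" "p a \<noteq> 0" "q b \<noteq> 0"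
  shows "\<exists>c\<in>\<rat>. c \<noteq> 0 \<and> p c \<noteq> 0 \<and> q c \<noteq> 0"
proof -
  obtain N P where P: "\<forall>z. z \<noteq> 0 \<longrightarrow> p z * z ^ N = poly P z"
    using polyfun_Laurent[OF assms(1)] by blast
  obtain M Q where Q: "\<forall>z. z \<noteq> 0 \<longrightarrow> q z * z ^ M = poly Q z"
    using polyfun_Laurent[OF assms(2)] by blast
  have "poly P a \<noteq> 0" "poly Q b \<noteq> 0" using P Q assms by (metis mult_eq_0_iff power_not_zero)+
  \<comment> \<open>The factor \<open>[:0, 1:]\<close> keeps 0 out of the candidates.\<close>
  then have "P * Q * [:0, 1:] \<noteq> 0" by auto
  then have "finite {z. poly (P * Q * [:0, 1:]) z = 0}" by (rule poly_roots_finite)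
  moreover have "infinite (\<rat> :: complex set)"
  proof
    assume "finite (\<rat> :: complex set)"
    moreover have "range (of_nat :: nat \<Rightarrow> complex) \<subseteq> \<rat>" by auto
    ultimately have "finite (range (of_nat :: nat \<Rightarrow> complex))" by (rule rev_finite_subset)
    then show False by (simp add: finite_image_iff inj_of_nat)
  qed
  ultimately obtain c :: complex where c: "c \<in> \<rat>" "poly (P * Q * [:0, 1:]) c \<noteq> 0"
    using rev_finite_subset by blast
  then have "c \<noteq> 0" "poly P c \<noteq> 0" "poly Q c \<noteq> 0" by auto
  then have "p c \<noteq> 0" "q c \<noteq> 0" using P Q by force+
  then show ?thesis using c \<open>c \<noteq> 0\<close> by auto
qed

lemma prevar_single_chart:
  assumes "atlas X = {(pts X, F)}" "finite F"
  shows "prevar X"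
  unfolding prevar_def assms(1)
  using assms(2)
  by (auto intro!: bexI[of _ "\<lambda>_. 1"] polyfun.const chart_reg_poly intro: polyfun.gen)

lemma Gm_simps [simp]: "pts Gm = - {0}" "atlas Gm = {(- {0}, {\<lambda>z. z, inverse})}"
  "gmult Gm = (*)" "gone Gm = 1"
  by (simp_all add: Gm_def)

lemma prevar_Gm: "prevar Gm"
  by (rule prevar_single_chart[of _ "{\<lambda>z. z, inverse}"]) simp_all

lemma rational_var_Gm: "rational_var Gm"
  unfolding rational_var_def
proof (intro conjI prevar_Gm exI[of _ "{\<lambda>z. z, inverse}"] ballI impI)
  show "pts Gm \<noteq> {}" by (auto intro!: exI[of _ 1])
  fix p q a b
  assume "p \<in> polyfun UNIV {\<lambda>z. z, inverse}" "q \<in> polyfun UNIV {\<lambda>z. z, inverse}"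
    "a \<in> pts Gm" "b \<in> pts Gm" "p a \<noteq> 0 \<and> q b \<noteq> 0"
  then obtain c where "c \<in> \<rat>" "c \<noteq> 0" "p c \<noteq> 0" "q c \<noteq> 0"
    using Laurent_common_rational_nonzero[of p q a b] by auto
  then show "\<exists>c\<in>pts Gm. (\<forall>f\<in>{\<lambda>z. z, inverse}. f c \<in> \<rat>) \<and> p c \<noteq> 0 \<and> q c \<noteq> 0"
    by (intro bexI[of _ c]) auto
qed simp

lemma rational_point_Gm: "rational_point Gm c \<longleftrightarrow> c \<in> \<rat> \<and> c \<noteq> 0"
  by (auto simp: rational_point_def)

lemma morph_at_Gm_iff:
  assumes "prevar X"
  shows "morph_at X Gm x h \<longleftrightarrow> reg_at X x h \<and> h x \<noteq> 0"
proof
  assume "morph_at X Gm x h"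
  then show "reg_at X x h \<and> h x \<noteq> 0" by (auto elim!: morph_atE)
next
  assume h: "reg_at X x h \<and> h x \<noteq> 0"
  show "morph_at X Gm x h"
  proof (rule morph_atI[OF assms reg_at_pts[OF assms]])
    show "(- {0}, {\<lambda>z. z, inverse}) \<in> atlas Gm" by simp
    show "eventually (\<lambda>y. h y \<in> - {0}) (near X x)"
      using reg_at_nonzero[OF assms] h by simp
  qed (use h reg_at_inverse[OF assms] in auto)
qed


section \<open>Unital rational actions of the multiplicative group\<close>

locale Gm_action =
  fixes X :: "('x, 'm) var_scheme" and e :: "complex \<times> 'x \<rightharpoonup> 'x"
  assumes var: "variety X" and irred: "irreducible_var X"
    and unital: "unital_rational_action Gm X e"
begin

abbreviation GX where "GX \<equiv> Gm \<times>\<^sub>v X"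
abbreviation GGX where "GGX \<equiv> Gm \<times>\<^sub>v Gm \<times>\<^sub>v X"
abbreviation E where "E z \<equiv> the (e z)"

lemma prevars: "prevar X" "prevar GX" "prevar GGX"
  using variety_prevar[OF var] by (simp_all add: prevar_prod prevar_Gm)

lemma irreds: "irreducible_var GX" "irreducible_var GGX"
  using prevars irred by (simp_all add: irreducible_prod rational_var_Gm)

lemma rat: "rational_map GX X e"
  using unital by (simp add: unital_rational_action_def rational_action_def)

lemma reg: "regular_map GX X e"
  using rat by (simp add: rational_map_def)

lemmas regD = regular_mapD[OF prevars(2,1) reg]

lemma dom_pts: "(c, x) \<in> dom e \<Longrightarrow> c \<noteq> 0 \<and> x \<in> pts X"
  using regD(1)[of "(c, x)"] by simp

lemma one_dom: "x \<in> pts X \<Longrightarrow> (1, x) \<in> dom e"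
  using unital by (auto simp: unital_rational_action_def)

lemma one_act: "x \<in> pts X \<Longrightarrow> e (1, x) = Some x"
  using unital one_dom by (simp add: unital_rational_action_def rational_action_def)

lemma assoc_generic:
  "eventually (\<lambda>z. (fst z * fst (snd z), snd (snd z)) \<in> dom e \<and> snd z \<in> dom e \<and>
     (fst z, E (snd z)) \<in> dom e \<and>
     e (fst z * fst (snd z), snd (snd z)) = e (fst z, E (snd z))) (generic GGX)"
proof -
  have "rat_equiv GGX (\<lambda>(g, h, x). e (g * h, x))
       (\<lambda>(g, h, x). Option.bind (e (h, x)) (\<lambda>y. e (g, y)))"
    using unital by (simp add: unital_rational_action_def rational_action_def)
  then show ?thesis
    unfolding rat_equiv_iff[OF prevars(3)]
    by eventually_elim (auto simp: bind_eq_Some_conv split: prod.splits)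
qed

lemma reg_coord:
  assumes "prevar Y" "z \<in> pts (Gm \<times>\<^sub>v Y)" shows "reg_at (Gm \<times>\<^sub>v Y) z fst"
  using morph_at_fst[OF prevar_Gm assms] morph_at_Gm_iff[OF prevar_prod[OF prevar_Gm assms(1)]]
  by blast

lemma morph_mult:
  assumes "z \<in> pts GGX" shows "morph_at GGX GX z (\<lambda>z. (fst z * fst (snd z), snd (snd z)))"
proof (rule morph_at_Pair[OF prevars(3)])
  have s: "morph_at GGX GX z snd" by (rule morph_at_snd[OF prevar_Gm prevars(2) assms])
  have sz: "snd z \<in> pts GX" using assms by auto
  have "reg_at GGX z (\<lambda>z. fst (snd z))"
    by (rule reg_at_comp[OF prevars(3,2) s reg_coord[OF prevars(1) sz]])
  then show "morph_at GGX Gm z (\<lambda>z. fst z * fst (snd z))"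
    using assms reg_at_mult[OF prevars(3) reg_coord[OF prevars(2) assms]]
    by (auto simp: morph_at_Gm_iff[OF prevars(3)])
  show "morph_at GGX X z (\<lambda>z. snd (snd z))"
    by (rule morph_at_comp[OF prevars(3,2,1) s morph_at_snd[OF prevar_Gm prevars(1) sz]])
qed

text \<open>The action law is given on a dense open set. Once the three points lie in
  \<open>dom e\<close>, both sides are morphisms at (d, c, x), and separatedness carries the law
  there.\<close>

lemma act_comp:
  assumes "(c, x) \<in> dom e" "(d, E (c, x)) \<in> dom e" "(d * c, x) \<in> dom e"
  shows "e (d * c, x) = e (d, E (c, x))"
proof -
  have z: "(d, c, x) \<in> pts GGX" using dom_pts assms by auto
  have s: "morph_at GGX GX (d, c, x) snd" by (rule morph_at_snd[OF prevar_Gm prevars(2) z])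
  have 1: "morph_at GGX X (d, c, x) (\<lambda>z. E (fst z * fst (snd z), snd (snd z)))"
    by (rule morph_at_comp[OF prevars(3,2,1) morph_mult[OF z]]) (use regD(3)[OF assms(3)] in simp)
  have "morph_at GGX X (d, c, x) (\<lambda>z. E (snd z))"
    by (rule morph_at_comp[OF prevars(3,2,1) s]) (use regD(3)[OF assms(1)] in simp)
  from morph_at_Pair[OF prevars(3) morph_at_fst[OF prevar_Gm prevars(2) z] this]
  have 2: "morph_at GGX X (d, c, x) (\<lambda>z. E (fst z, E (snd z)))"
    by (rule morph_at_comp[OF prevars(3,2,1)]) (use regD(3)[OF assms(2)] in simp)
  have "eventually (\<lambda>z. E (fst z * fst (snd z), snd (snd z)) = E (fst z, E (snd z))) (generic GGX)"
    using assoc_generic by eventually_elim simp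
  from morph_at_agree[OF prevars(3,1) variety_separated[OF var] 1 2 this]
  show ?thesis using assms(2,3) by auto
qed

text \<open>For a rational \<open>c\<close> the partial map \<open>(d, x) \<mapsto> e (d / c) (e c x)\<close> is defined over \<open>\<rat>\<close>
  and agrees with \<open>e\<close>, so maximality of \<open>dom e\<close> applies to it.\<close>

lemma act_dom:
  assumes "c \<in> \<rat>" "(c, x) \<in> dom e" "(d, E (c, x)) \<in> dom e"
  shows "(d * c, x) \<in> dom e"
proof -
  have c: "c \<noteq> 0" and dx: "d \<noteq> 0" "x \<in> pts X" using dom_pts assms(2,3) by auto
  have rc: "rational_point Gm c" using assms(1) c by (simp add: rational_point_Gm)
  let ?s = "\<lambda>z. (c, snd z)" and ?t = "\<lambda>z. (fst z * inverse c, E (c, snd z))"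
  define g where "g = (\<lambda>z. if ?s z \<in> dom e \<and> ?t z \<in> dom e then e (?t z) else None)"
  have dg: "z \<in> dom g \<longleftrightarrow> ?s z \<in> dom e \<and> ?t z \<in> dom e" for z
    by (auto simp: g_def domIff)
  have eg: "g z = e z" if "z \<in> dom g" "z \<in> dom e" for z
  proof -
    obtain d' y where z: "z = (d', y)" by fastforce
    have t: "(c, y) \<in> dom e" "(d' * inverse c, E (c, y)) \<in> dom e" using that dg z by auto
    have d': "d' * inverse c * c = d'" using c by simp
    have "e (d', y) = e (d' * inverse c, E (c, y))"
      using act_comp[OF t, unfolded d'] that(2) z by simp
    then show ?thesis using t z by (simp add: g_def)
  qed
  have ms: "morph_at GX GX z ?s" if "z \<in> pts GX" for z
    by (rule morph_at_Pair[OF prevars(2) morph_at_rational_const[OF prevars(2) prevar_Gm that rc]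
          morph_at_snd[OF prevar_Gm prevars(1) that]])
  have mt: "morph_at GX GX z ?t" if "z \<in> pts GX" "?s z \<in> dom e" for z
  proof (rule morph_at_Pair[OF prevars(2)])
    have "reg_at GX z (\<lambda>z. fst z * inverse c)"
      using assms(1) that(1)
      by (intro reg_at_mult[OF prevars(2) reg_coord[OF prevars(1) that(1)]] reg_at_const[OF prevars(2)]) auto
    then show "morph_at GX Gm z (\<lambda>z. fst z * inverse c)"
      using c that(1) by (auto simp: morph_at_Gm_iff[OF prevars(2)])
    show "morph_at GX X z (\<lambda>z. E (c, snd z))"
      by (rule morph_at_comp[OF prevars(2,2,1) ms[OF that(1)] regD(3)[OF that(2)]])
  qed
  have regg: "regular_map GX X g"
    unfolding regular_map_iff[OF prevars(2,1)]
  proof (intro conjI ballI)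
    show sub: "dom g \<subseteq> pts GX"
    proof (rule subsetI)
      fix z assume "z \<in> dom g"
      then have "?s z \<in> dom e" "?t z \<in> dom e" using dg by auto
      then have "snd z \<in> pts X" "fst z * inverse c \<noteq> 0" using dom_pts by blast+
      then show "z \<in> pts GX" by (simp add: mem_Times_iff)
    qed
    fix z assume z: "z \<in> dom g"
    have zp: "z \<in> pts GX" and zs: "?s z \<in> dom e" and zt: "?t z \<in> dom e"
      using z subsetD[OF sub z] dg by blast+
    have ev: "eventually (\<lambda>w. ?s w \<in> dom e \<and> ?t w \<in> dom e) (near GX z)"
      by (intro eventually_conj morph_at_eventually[OF prevars(2,2) ms[OF zp] regD(2)[OF zs]]
          morph_at_eventually[OF prevars(2,2) mt[OF zp zs] regD(2)[OF zt]])
    then show "eventually (\<lambda>w. w \<in> dom g) (near GX z)" by eventually_elim (use dg in simp)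
    show "morph_at GX X z (\<lambda>w. the (g w))"
    proof (rule morph_at_cong[OF prevars(2,1)])
      show "morph_at GX X z (\<lambda>w. E (?t w))"
        by (rule morph_at_comp[OF prevars(2,2,1) mt[OF zp zs] regD(3)[OF zt]])
      show "eventually (\<lambda>w. the (g w) = E (?t w)) (near GX z)"
        using ev by eventually_elim (simp add: g_def)
    qed
  qed
  have "d * c * inverse c = d" using c by simp
  then have dx_g: "(d * c, x) \<in> dom g" using assms unfolding dg by (simp only: fst_conv snd_conv)
  \<comment> \<open>The point in question shows that the open set \<open>dom g\<close> is nonempty,
    hence dense in the irreducible \<open>GX\<close>.\<close>
  have "eventually (\<lambda>z. z \<in> dom g) (generic GX)"
    using regular_mapD[OF prevars(2,1) regg dx_g] by (intro generic_of_near[OF prevars(2) irreds(1)])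
  with rational_map_generic_dom[OF prevars(2,1) rat]
  have "rat_equiv GX e g"
    unfolding rat_equiv_iff[OF prevars(2)] by eventually_elim (use eg in auto)
  then have "g \<subseteq>\<^sub>m e" using rat regg by (simp add: rational_map_def)
  then show ?thesis using map_le_implies_dom_le[of g e] dx_g by blast
qed

text \<open>Dominance of (c, x) \<mapsto> (c, e c x). The obvious preimage of (d, x) is (d, e (1/d)
  x), but (1/d, x) may lie outside \<open>dom e\<close>. The point (d, 1/d, x) of \<open>GGX\<close>
  avoids this: there the product of the two parameters is 1 and acts as the identity, and at a
  generic point nearby the action law splits the product into two defined steps.\<close>

lemma generic_pullback_action:
  assumes "eventually P (generic GX)"
  shows "eventually (\<lambda>z. z \<in> dom e \<and> P (fst z, E z)) (generic GX)"
proof -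
  define P' where "P' z \<longleftrightarrow> z \<in> pts GX \<and> eventually (\<lambda>z. P z \<and> z \<in> dom e) (near GX z)" for z
  have P': "eventually P' (generic GX)"
    unfolding P'_def
    by (intro eventually_generic_near[OF prevars(2)] eventually_conj assms
        rational_map_generic_dom[OF prevars(2,1) rat])
  obtain d x where dx: "(d, x) \<in> pts GX" "eventually P' (near GX (d, x))"
    using generic_ex[OF prevars(2) _ eventually_generic_near[OF prevars(2) P']] irreds(1)
    by (auto simp: irreducible_var_def)
  have d: "d \<noteq> 0" "x \<in> pts X" using dx by auto
  let ?z = "(d, inverse d, x)"
  have z: "?z \<in> pts GGX" using d by auto
  have 1: "(d * inverse d, x) \<in> dom e" using d one_dom by simp
  have "morph_at GGX X ?z (\<lambda>z. E (fst z * fst (snd z), snd (snd z)))"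
    by (rule morph_at_comp[OF prevars(3,2,1) morph_mult[OF z]]) (use regD(3)[OF 1] in simp)
  then have "morph_at GGX GX ?z (\<lambda>z. (fst z, E (fst z * fst (snd z), snd (snd z))))"
    by (rule morph_at_Pair[OF prevars(3) morph_at_fst[OF prevar_Gm prevars(2) z]])
  then have "eventually (\<lambda>z. P' (fst z, E (fst z * fst (snd z), snd (snd z)))) (near GGX ?z)"
    by (rule morph_at_eventually[OF prevars(3,2)]) (use d dx(2) one_act in simp)
  from generic_meets_near[OF prevars(3) z assoc_generic this]
  obtain w where w: "w \<in> pts GGX" "snd w \<in> dom e" "(fst w, E (snd w)) \<in> dom e"
    "e (fst w * fst (snd w), snd (snd w)) = e (fst w, E (snd w))"
    "P' (fst w, E (fst w * fst (snd w), snd (snd w)))" by (elim bexE conjE)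
  let ?y = "(fst w, E (snd w))"
  have y: "?y \<in> pts GX" using regD(1)[OF w(3)] .
  have "morph_at GX GX ?y (\<lambda>z. (fst z, E z))"
    by (rule morph_at_Pair[OF prevars(2) morph_at_fst[OF prevar_Gm prevars(1) y] regD(3)[OF w(3)]])
  moreover have "eventually P (near GX (fst ?y, E ?y))"
    using w(4,5) by (auto simp: P'_def elim: eventually_mono)
  ultimately have "eventually (\<lambda>z. P (fst z, E z)) (near GX ?y)"
    by (rule morph_at_eventually[OF prevars(2,2)])
  with regD(2)[OF w(3)] have "eventually (\<lambda>z. z \<in> dom e \<and> P (fst z, E z)) (near GX ?y)"
    by (rule eventually_conj)
  then show ?thesis by (rule generic_of_near[OF prevars(2) irreds(1) y])
qed

text \<open>Dominance of the action map, which is the identity on the slice c = 1.\<close>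

lemma generic_pullback_orbit:
  assumes "eventually P (generic X)"
  shows "eventually (\<lambda>z. z \<in> dom e \<and> P (E z)) (generic GX)"
proof -
  obtain x where x: "x \<in> pts X" "eventually P (near X x)"
    using generic_ex[OF prevars(1) _ eventually_generic_near[OF prevars(1) assms]] irred
    by (auto simp: irreducible_var_def)
  have "eventually (\<lambda>z. P (E z)) (near GX (1, x))"
    by (rule morph_at_eventually[OF prevars(2,1) regD(3)[OF one_dom[OF x(1)]]]) (use x one_act in simp)
  with regD(2)[OF one_dom[OF x(1)]] have "eventually (\<lambda>z. z \<in> dom e \<and> P (E z)) (near GX (1, x))"
    by (rule eventually_conj)
  then show ?thesis by (rule generic_of_near[OF prevars(2) irreds(1), rotated]) (use x in auto)
qed

end

text \<open>With \<open>a x = \<alpha> (\<gamma> x)\<close>, the partial map \<open>crystal_refl\<close> is \<open>x \<mapsto> e (1 / a x) x\<close>, the candidate for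
  the action of a simple reflection.  That it is defined at all for generic \<open>x\<close> is not clear, since
  \<open>(1 / a x, x)\<close> might avoid \<open>dom e\<close>.  But if \<open>z = e c x\<close> then \<open>1 / a x = (c / a z) * c\<close>, where
  \<open>(c, x) \<mapsto> (c, z) \<mapsto> (c / a z, z)\<close> is dominant; it remains to choose \<open>c\<close> rational.\<close>

locale Gm_action_scaled = Gm_action X e for X :: "('x, 'm) var_scheme" and e +
  fixes D :: "'x set" and a :: "'x \<Rightarrow> complex"
  assumes D_open: "zariski_open X D" and D_nonempty: "D \<noteq> {}"
    and a_reg: "x \<in> D \<Longrightarrow> reg_at X x a" and a_nz: "x \<in> D \<Longrightarrow> a x \<noteq> 0"
    and a_act: "(c, x) \<in> dom e \<Longrightarrow> x \<in> D \<Longrightarrow> the (e (c, x)) \<in> D \<Longrightarrow> a (the (e (c, x))) = c\<^sup>2 * a x"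
begin

definition crystal_refl :: "'x \<rightharpoonup> 'x" where
  "crystal_refl x = (if x \<in> D then e (inverse (a x), x) else None)"

lemma D_pts: "x \<in> D \<Longrightarrow> x \<in> pts X"
  using D_open by (auto simp: zariski_open_def)

lemma D_near: "x \<in> D \<Longrightarrow> eventually (\<lambda>y. y \<in> D) (near X x)"
  by (rule eventually_near_open[OF prevars(1) D_open])

lemma D_generic: "eventually (\<lambda>x. x \<in> D) (generic X)"
  using D_nonempty generic_of_near[OF prevars(1) irred D_pts D_near] by blast

lemma refl_dom: "x \<in> dom crystal_refl \<longleftrightarrow> x \<in> D \<and> (inverse (a x), x) \<in> dom e"
  by (simp add: crystal_refl_def domIff)

lemma refl_eq: "x \<in> D \<Longrightarrow> crystal_refl x = e (inverse (a x), x)"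
  by (simp add: crystal_refl_def)

lemma morph_scale: "x \<in> D \<Longrightarrow> morph_at X GX x (\<lambda>x. (inverse (a x), x))"
  using reg_at_inverse[OF prevars(1) a_reg a_nz] a_nz
  by (intro morph_at_Pair[OF prevars(1)] morph_at_id prevars(1) D_pts)
     (auto simp: morph_at_Gm_iff[OF prevars(1)])

lemma refl_regular: "regular_map X X crystal_refl"
  unfolding regular_map_iff[OF prevars(1,1)]
proof (intro conjI ballI)
  show "dom crystal_refl \<subseteq> pts X" using D_pts refl_dom by auto
  fix x assume "x \<in> dom crystal_refl"
  then have x: "x \<in> D" "(inverse (a x), x) \<in> dom e" using refl_dom by auto
  have ev: "eventually (\<lambda>y. y \<in> D \<and> (inverse (a y), y) \<in> dom e) (near X x)"
    by (intro eventually_conj D_near[OF x(1)]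
        morph_at_eventually[OF prevars(1,2) morph_scale[OF x(1)] regD(2)[OF x(2)]])
  then show "eventually (\<lambda>y. y \<in> dom crystal_refl) (near X x)" by (simp add: refl_dom)
  show "morph_at X X x (\<lambda>y. the (crystal_refl y))"
  proof (rule morph_at_cong[OF prevars(1,1)])
    show "morph_at X X x (\<lambda>y. E (inverse (a y), y))"
      by (rule morph_at_comp[OF prevars(1,2,1) morph_scale[OF x(1)] regD(3)[OF x(2)]])
    show "eventually (\<lambda>y. the (crystal_refl y) = E (inverse (a y), y)) (near X x)"
      using ev by eventually_elim (simp add: refl_eq)
  qed
qed

lemma generic_pullback_scale:
  assumes "eventually P (generic GX)"
  shows "eventually (\<lambda>z. snd z \<in> D \<and> P (fst z * inverse (a (snd z)), snd z)) (generic GX)"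
proof -
  have sD: "eventually (\<lambda>z. snd z \<in> D) (near GX z)" if "z \<in> pts GX" "snd z \<in> D" for z
    by (rule morph_at_eventually[OF prevars(2,1) morph_at_snd[OF prevar_Gm prevars(1) that(1)] D_near[OF that(2)]])
  obtain x0 where x0: "x0 \<in> D" using D_nonempty by auto
  then have "eventually (\<lambda>z. snd z \<in> D) (generic GX)"
    using D_pts by (intro generic_of_near[OF prevars(2) irreds(1) _ sD, of "(1, x0)"]) auto
  with eventually_generic_near[OF prevars(2) assms]
  have "eventually (\<lambda>z. z \<in> pts GX \<and> eventually P (near GX z) \<and> snd z \<in> D) (generic GX)"
    by eventually_elim simp
  from generic_ex[OF prevars(2) _ this] irreds(1)
  obtain d z where dz: "(d, z) \<in> pts GX" "eventually P (near GX (d, z))" "z \<in> D"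
    by (auto simp: irreducible_var_def)
  \<comment> \<open>Preimage of the good point (d, z) under (c, z) \<mapsto> (c / a z, z).\<close>
  let ?w = "(d * a z, z)"
  have w: "?w \<in> pts GX" using dz a_nz by auto
  have d: "d * a z * inverse (a z) = d" using a_nz[OF dz(3)] by simp
  have s: "morph_at GX X ?w snd" by (rule morph_at_snd[OF prevar_Gm prevars(1) w])
  have "reg_at GX ?w (\<lambda>w. a (snd w))"
    by (rule reg_at_comp[OF prevars(2,1) s]) (use a_reg dz(3) in simp)
  then have "reg_at GX ?w (\<lambda>w. fst w * inverse (a (snd w)))"
    using a_nz[OF dz(3)]
    by (intro reg_at_mult[OF prevars(2) reg_coord[OF prevars(1) w]] reg_at_inverse[OF prevars(2)]) auto
  then have "morph_at GX GX ?w (\<lambda>w. (fst w * inverse (a (snd w)), snd w))"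
    using a_nz[OF dz(3)] dz(1)
    by (intro morph_at_Pair[OF prevars(2) _ s]) (auto simp: morph_at_Gm_iff[OF prevars(2)])
  then have "eventually (\<lambda>w. P (fst w * inverse (a (snd w)), snd w)) (near GX ?w)"
    by (rule morph_at_eventually[OF prevars(2,2)]) (use dz(2) in \<open>simp only: fst_conv snd_conv d\<close>)
  with sD[OF w] dz(3)
  have "eventually (\<lambda>w. snd w \<in> D \<and> P (fst w * inverse (a (snd w)), snd w)) (near GX ?w)"
    by (simp add: eventually_conj_iff)
  then show ?thesis by (rule generic_of_near[OF prevars(2) irreds(1) w])
qed

lemma generic_pullback_refl:
  assumes "eventually P (generic X)"
  shows "eventually (\<lambda>x. x \<in> dom crystal_refl \<and> P (the (crystal_refl x))) (generic X)"
proof -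
  let ?P = "\<lambda>z. eventually P (near X z)" and ?d = "\<lambda>c z. c * inverse (a z)"
  have "eventually ?P (generic X)"
    using eventually_generic_near[OF prevars(1) assms] by eventually_elim simp
  \<comment> \<open>The innermost pullback belongs to the map applied last: (c, x) goes to (c, z)
    with z = e c x, then to (c / a z, z), then to e (c / a z) z.\<close>
  from generic_pullback_action[OF generic_pullback_scale[OF generic_pullback_orbit[OF this]]]
  have "eventually (\<lambda>z. z \<in> dom e \<and> E z \<in> D \<and> (?d (fst z) (E z), E z) \<in> dom e \<and>
    ?P (E (?d (fst z) (E z), E z))) (generic GX)"
    by eventually_elim simp
  \<comment> \<open>\<open>act_dom\<close> requires the inner parameter c to be rational, while the
    outer one, c / a z, may be arbitrary.\<close>
  from generic_slice[OF rational_var_Gm prevars(1) irred this] obtain c where c: "rational_point Gm c"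
    and ev: "eventually (\<lambda>x. (c, x) \<in> dom e \<and> E (c, x) \<in> D \<and> (?d c (E (c, x)), E (c, x)) \<in> dom e \<and>
      ?P (E (?d c (E (c, x)), E (c, x)))) (generic X)" by auto
  obtain x where x: "x \<in> D" "(c, x) \<in> dom e" "E (c, x) \<in> D" "(?d c (E (c, x)), E (c, x)) \<in> dom e"
    "?P (E (?d c (E (c, x)), E (c, x)))"
    using generic_ex[OF prevars(1) _ eventually_conj[OF D_generic ev]] irred
    by (auto simp: irreducible_var_def)
  have c': "c \<in> \<rat>" "c \<noteq> 0" using c by (simp_all add: rational_point_Gm)
  have "a (E (c, x)) = c\<^sup>2 * a x" by (rule a_act[OF x(2,1,3)])
  then have d: "?d c (E (c, x)) * c = inverse (a x)"
    using c'(2) by (simp add: power2_eq_square)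
  have "(inverse (a x), x) \<in> dom e" using act_dom[OF c'(1) x(2,4)] d by simp
  then have r: "x \<in> dom crystal_refl" "crystal_refl x = e (?d c (E (c, x)), E (c, x))"
    using act_comp[OF x(2,4)] d x(1) by (simp_all add: refl_dom refl_eq)
  note m = regular_mapD[OF prevars(1,1) refl_regular r(1)]
  have "eventually (\<lambda>x. P (the (crystal_refl x))) (near X x)"
    by (rule morph_at_eventually[OF prevars(1,1) m(3)]) (use r(2) x(5) in simp)
  with m(2) have "eventually (\<lambda>x. x \<in> dom crystal_refl \<and> P (the (crystal_refl x))) (near X x)"
    by (rule eventually_conj)
  then show ?thesis by (rule generic_of_near[OF prevars(1) irred m(1)])
qed

lemma refl_involution:
  "eventually (\<lambda>x. x \<in> dom crystal_refl \<and> the (crystal_refl x) \<in> dom crystal_refl \<and> crystal_refl (the (crystal_refl x)) = Some x) (generic X)"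
proof -
  have "eventually (\<lambda>x. x \<in> dom crystal_refl) (generic X)"
    using generic_pullback_refl[of "\<lambda>_. True"] by simp
  from generic_pullback_refl[OF this] show ?thesis
  proof eventually_elim
    case (elim x)
    define y where "y = E (inverse (a x), x)"
    have x: "x \<in> D" "(inverse (a x), x) \<in> dom e" and y: "crystal_refl x = e (inverse (a x), x)"
      using elim refl_dom by (auto simp: refl_eq)
    have yD: "y \<in> D" "(inverse (a y), y) \<in> dom e" using elim y refl_dom unfolding y_def by auto
    \<comment> \<open>The scaling law gives a y = (1 / a x)^2 * a x, so the second reflection acts
      with the parameter inverse to the first.\<close>
    have "a y = inverse (a x)"
      using a_act[OF x(2,1)] yD(1) a_nz[OF x(1)] unfolding y_def by (simp add: power2_eq_square)
    then have ay: "inverse (a y) = a x" by simp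
    have one: "a x * inverse (a x) = 1" using a_nz[OF x(1)] by simp
    have "e (a x * inverse (a x), x) = e (a x, E (inverse (a x), x))"
      using yD(2) one_dom D_pts[OF x(1)] x(2) one unfolding ay unfolding y_def
      by (intro act_comp) simp_all
    then have "e (inverse (a y), y) = Some x"
      using one ay one_act[OF D_pts[OF x(1)]] by (simp add: y_def)
    then show ?case using elim y yD(1) by (simp add: refl_eq y_def)
  qed
qed

end


section \<open>Split tori\<close>

lemma mat_group_simps [simp]:
  "carrier (mat_group H) = H" "mult (mat_group H) = (**)" "one (mat_group H) = mat 1"
  by (simp_all add: mat_group_def)

lemma group_GL: "group (mat_group (GL :: (complex^'n^'n) set))"
proof (rule groupI)
  fix A :: "complex^'n^'n" assume "A \<in> carrier (mat_group GL)"
  then obtain B where "A ** B = mat 1" "B ** A = mat 1" by (auto simp: GL_def invertible_def)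
  then show "\<exists>B\<in>carrier (mat_group GL). B \<otimes>\<^bsub>mat_group GL\<^esub> A = \<one>\<^bsub>mat_group GL\<^esub>"
    by (intro bexI[of _ B]) (auto simp: GL_def invertible_def)
qed (auto simp: GL_def invertible_mult matrix_mul_assoc invertible_def[of "mat 1"])

lemma matrix_inv_GL:
  assumes "A \<in> GL" shows "matrix_inv A \<in> GL" "A ** matrix_inv A = mat 1" "matrix_inv A ** A = mat 1"
proof -
  have "\<exists>B. A ** B = mat 1 \<and> B ** A = mat 1" using assms by (simp add: GL_def invertible_def)
  from someI_ex[OF this] show *: "A ** matrix_inv A = mat 1" "matrix_inv A ** A = mat 1"
    by (simp_all add: matrix_inv_def)
  then show "matrix_inv A \<in> GL" by (auto simp: GL_def invertible_def)
qed

lemma matrix_inv_unique: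
  fixes A B :: "complex^'n^'n"
  assumes "A ** B = mat 1" "B ** A = mat 1" shows "matrix_inv A = B"
proof -
  have "A \<in> GL" using assms by (auto simp: GL_def invertible_def)
  have "matrix_inv A = matrix_inv A ** (A ** B)" using assms by simp
  then show ?thesis by (simp add: matrix_mul_assoc matrix_inv_GL(3)[OF \<open>A \<in> GL\<close>])
qed

lemma inv_GL: "A \<in> GL \<Longrightarrow> inv\<^bsub>mat_group GL\<^esub> A = matrix_inv A"
  by (rule group.inv_equality[OF group_GL]) (simp_all add: matrix_inv_GL)

lemma matrix_inv_mult:
  assumes "A \<in> GL" "B \<in> GL" shows "matrix_inv (A ** B) = matrix_inv B ** matrix_inv A"
proof (rule matrix_inv_unique)
  show "A ** B ** (matrix_inv B ** matrix_inv A) = mat 1"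
    using matrix_inv_GL[OF assms(1)] matrix_inv_GL[OF assms(2)]
    by (metis matrix_mul_assoc matrix_mul_rid)
  show "matrix_inv B ** matrix_inv A ** (A ** B) = mat 1"
    using matrix_inv_GL[OF assms(1)] matrix_inv_GL[OF assms(2)]
    by (metis matrix_mul_assoc matrix_mul_rid)
qed

lemma polyfun_sum:
  assumes "0 \<in> k" "\<And>i. i \<in> I \<Longrightarrow> f i \<in> polyfun k F"
  shows "(\<lambda>x. \<Sum>i\<in>I. f i x) \<in> polyfun k F"
  using assms(2)
proof (induction I rule: infinite_finite_induct)
  case (insert i I)
  then show ?case by (simp add: polyfun.add)
qed (simp_all add: polyfun.const assms(1))

lemma polyfun_det:
  assumes "\<int> \<subseteq> k" "\<And>i j. (\<lambda>x. A x $ i $ j) \<in> polyfun k F"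
  shows "(\<lambda>x. det (A x :: complex^'n^'n)) \<in> polyfun k F"
proof -
  have k: "0 \<in> k" "1 \<in> k" "of_int m \<in> k" for m using assms(1) by auto
  show ?thesis
    unfolding det_def
    by (intro polyfun_sum polyfun.mult polyfun.const polyfun_prod assms(2) k)
qed

text \<open>Functions are compared on \<open>S\<close> only, so each generator may be replaced by a
  member of the other algebra with the same restriction.\<close>

lemma polyfun_restrict:
  assumes "p \<in> polyfun k F" "\<And>f. f \<in> F \<Longrightarrow> \<exists>g\<in>polyfun k H. \<forall>x\<in>S. f (\<phi> x) = g x"
  shows "\<exists>g\<in>polyfun k H. \<forall>x\<in>S. p (\<phi> x) = g x"
  using assms(1)
proof induction
  case (const c)
  then show ?case by (intro bexI[of _ "\<lambda>_. c"] polyfun.const) auto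
next
  case (gen f)
  then show ?case by (rule assms(2))
next
  case (add f g)
  obtain f' where f': "f' \<in> polyfun k H" "\<forall>x\<in>S. f (\<phi> x) = f' x" using add.IH(1) by (elim bexE)
  obtain g' where g': "g' \<in> polyfun k H" "\<forall>x\<in>S. g (\<phi> x) = g' x" using add.IH(2) by (elim bexE)
  show ?case by (rule bexI[OF _ polyfun.add[OF f'(1) g'(1)]]) (use f'(2) g'(2) in simp)
next
  case (mult f g)
  obtain f' where f': "f' \<in> polyfun k H" "\<forall>x\<in>S. f (\<phi> x) = f' x" using mult.IH(1) by (elim bexE)
  obtain g' where g': "g' \<in> polyfun k H" "\<forall>x\<in>S. g (\<phi> x) = g' x" using mult.IH(2) by (elim bexE)
  show ?case by (rule bexI[OF _ polyfun.mult[OF f'(1) g'(1)]]) (use f'(2) g'(2) in simp)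
qed

lemma polyfun_Rats: "p \<in> polyfun \<rat> F \<Longrightarrow> (\<And>f. f \<in> F \<Longrightarrow> f c \<in> \<rat>) \<Longrightarrow> p c \<in> \<rat>"
  by (induction rule: polyfun.induct) auto

lemma entriesI: "(\<lambda>A. A $ i $ j) \<in> entries"
  by (auto simp: entries_def)

lemma finite_coords: "finite (coords :: (complex^'n^'n \<Rightarrow> complex) set)"
proof -
  have "entries = (\<lambda>(i, j) A. (A :: complex^'n^'n) $ i $ j) ` (UNIV \<times> UNIV)"
    by (auto simp: entries_def)
  moreover have "finite (UNIV \<times> UNIV :: ('n \<times> 'n) set)" by simp
  ultimately have "finite (entries :: (complex^'n^'n \<Rightarrow> complex) set)" by (metis finite_imageI)
  then show ?thesis by (simp add: coords_def)
qed

lemma mat_variety_simps [simp]: "pts (mat_variety H) = H" "atlas (mat_variety H) = {(H, coords)}"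
  by (simp_all add: mat_variety_def)

lemma prevar_mat_variety: "prevar (mat_variety H)"
  by (rule prevar_single_chart[of _ coords]) (simp_all add: finite_coords)

lemma separated_mat_variety: "separated (mat_variety H)"
  unfolding separated_def
proof (rule zariski_openI, force)
  fix U F z assume U: "(U, F) \<in> atlas (mat_variety H \<times>\<^sub>v mat_variety H)"
    and z: "z \<in> {(x, y). x \<in> pts (mat_variety H) \<and> y \<in> pts (mat_variety H) \<and> x \<noteq> y}"
  have UF: "U = H \<times> H" "F = (\<lambda>f. f \<circ> fst) ` coords \<union> (\<lambda>g. g \<circ> snd) ` coords"
    using U by (auto elim!: atlas_prodE)
  obtain i j where ij: "fst z $ i $ j \<noteq> snd z $ i $ j" using z by (auto simp: vec_eq_iff)
  have c: "(\<lambda>A. A $ i $ j) \<in> coords" unfolding coords_def by (rule insertI2[OF entriesI])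
  have "(\<lambda>z. fst z $ i $ j - snd z $ i $ j) \<in> polyfun \<rat> F"
    unfolding UF(2)
    by (rule polyfun_diff[OF _ polyfun_fst[OF polyfun.gen[OF c]] polyfun_snd[OF polyfun.gen[OF c]]]) auto
  then show "\<exists>q\<in>polyfun \<rat> F. q z \<noteq> 0 \<and> (\<forall>y\<in>U. q y \<noteq> 0 \<longrightarrow>
      y \<in> {(x, y). x \<in> pts (mat_variety H) \<and> y \<in> pts (mat_variety H) \<and> x \<noteq> y})"
    by (rule bexI[rotated]) (use ij UF(1) in auto)
qed

locale split_torus_over_rat =
  fixes T :: "(complex^'n^'n) set"
  assumes split: "split_torus \<rat> T"
begin

lemma subgroup_T: "subgroup T (mat_group GL)"
  using split by (simp add: split_torus_def algebraic_group_def)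

lemma T_GL: "t \<in> T \<Longrightarrow> t \<in> GL"
  using subgroup.subset[OF subgroup_T] by auto

lemma T_one: "mat 1 \<in> T"
  using subgroup.one_closed[OF subgroup_T] by simp

lemma T_mult: "s \<in> T \<Longrightarrow> t \<in> T \<Longrightarrow> s ** t \<in> T"
  using subgroup.m_closed[OF subgroup_T] by simp

lemma T_inv: "t \<in> T \<Longrightarrow> matrix_inv t \<in> T"
  using subgroup.m_inv_closed[OF subgroup_T] T_GL inv_GL by metis

lemmas T_inv_simps = matrix_inv_GL(2,3)[OF T_GL]

lemma coordinates:
  obtains r :: nat and \<eta> where "\<forall>i<r. \<eta> i \<in> characters \<rat> T"
    "bij_betw (\<lambda>t. \<lambda>i\<in>{..<r}. \<eta> i t) T ({..<r} \<rightarrow>\<^sub>E - {0})"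
    "\<forall>f\<in>entries. \<exists>p\<in>polyfun \<rat> (\<Union>i<r. {\<eta> i, \<lambda>t. inverse (\<eta> i t)}). \<forall>t\<in>T. f t = p t"
  using split unfolding split_torus_def by (elim conjE exE)

lemma char_one: "\<eta> \<in> characters k T \<Longrightarrow> \<eta> (mat 1) = 1"
  by (simp add: characters_def)

lemma char_mult: "\<eta> \<in> characters k T \<Longrightarrow> s \<in> T \<Longrightarrow> t \<in> T \<Longrightarrow> \<eta> (s ** t) = \<eta> s * \<eta> t"
  by (simp add: characters_def)

lemma char_nz:
  assumes "\<eta> \<in> characters k T" "t \<in> T" shows "\<eta> t \<noteq> 0"
proof
  assume "\<eta> t = 0"
  then have "\<eta> (t ** matrix_inv t) = 0" using assms T_inv by (simp add: char_mult)
  then show False using assms by (simp add: T_inv_simps char_one)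
qed

lemma char_inv:
  assumes "\<eta> \<in> characters k T" "t \<in> T" shows "\<eta> (matrix_inv t) = inverse (\<eta> t)"
proof -
  have "\<eta> t * \<eta> (matrix_inv t) = 1"
    using assms T_inv by (simp add: T_inv_simps char_one flip: char_mult)
  then show ?thesis by (simp add: inverse_unique)
qed

lemma coordinates_inj:
  assumes "bij_betw (\<lambda>t. \<lambda>i\<in>{..<r}. \<eta> i t) T ({..<r} \<rightarrow>\<^sub>E - {0})"
    "s \<in> T" "t \<in> T" "\<And>i. i < r \<Longrightarrow> \<eta> i s = \<eta> i t"
  shows "s = t"
proof -
  have "(\<lambda>i\<in>{..<r}. \<eta> i s) = (\<lambda>i\<in>{..<r}. \<eta> i t)"
    using assms(4) by (intro restrict_ext) simp
  then show ?thesis using inj_onD[OF bij_betw_imp_inj_on[OF assms(1)]] assms(2,3) by simp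
qed

lemma T_comm:
  assumes "s \<in> T" "t \<in> T" shows "s ** t = t ** s"
proof -
  obtain r :: nat and \<eta> where \<eta>: "\<forall>i<r. \<eta> i \<in> characters \<rat> T"
    "bij_betw (\<lambda>t. \<lambda>i\<in>{..<r}. \<eta> i t) T ({..<r} \<rightarrow>\<^sub>E - {0})"
    by (rule coordinates)
  show ?thesis
    using assms \<eta>(1) by (intro coordinates_inj[OF \<eta>(2)]) (auto simp: T_mult char_mult mult.commute)
qed

text \<open>In the character coordinates every component of such an element is a cube root of
  unity.\<close>

lemma finite_cube_torsion: "finite {t\<in>T. t ** t ** t = mat 1}"
proof -
  obtain r :: nat and \<eta> where \<eta>: "\<forall>i<r. \<eta> i \<in> characters \<rat> T"
    "bij_betw (\<lambda>t. \<lambda>i\<in>{..<r}. \<eta> i t) T ({..<r} \<rightarrow>\<^sub>E - {0})"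
    by (rule coordinates)
  have "finite {z::complex. z ^ 3 = 1}" by (rule finite_roots_unity) simp
  then have "finite ({..<r} \<rightarrow>\<^sub>E {z::complex. z ^ 3 = 1})" by (intro finite_PiE) auto
  moreover have "(\<lambda>t. \<lambda>i\<in>{..<r}. \<eta> i t) ` {t\<in>T. t ** t ** t = mat 1} \<subseteq> {..<r} \<rightarrow>\<^sub>E {z. z ^ 3 = 1}"
  proof (rule image_subsetI, rule restrict_PiE_iff[THEN iffD2], rule ballI)
    fix t i assume t: "t \<in> {t\<in>T. t ** t ** t = mat 1}" and "i \<in> {..<r}"
    then have c: "\<eta> i \<in> characters \<rat> T" using \<eta>(1) by simp
    have tT: "t \<in> T" using t by simp
    have "\<eta> i t ^ 3 = \<eta> i (t ** t ** t)"
      using char_mult[OF c] T_mult tT by (simp add: power3_eq_cube)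
    also have "t ** t ** t = mat 1" using t by simp
    finally show "\<eta> i t \<in> {z. z ^ 3 = 1}" using char_one[OF c] by simp
  qed
  ultimately have "finite ((\<lambda>t. \<lambda>i\<in>{..<r}. \<eta> i t) ` {t\<in>T. t ** t ** t = mat 1})"
    by (rule rev_finite_subset)
  moreover have "inj_on (\<lambda>t. \<lambda>i\<in>{..<r}. \<eta> i t) {t\<in>T. t ** t ** t = mat 1}"
    by (rule inj_on_subset[OF bij_betw_imp_inj_on[OF \<eta>(2)]]) auto
  ultimately show ?thesis by (rule finite_imageD)
qed

text \<open>The characters identify T with a power of Gm. Moving one coordinate at a time leaves
  nonzero Laurent polynomials in one variable, so both functions can be kept nonzero while that
  coordinate becomes a common rational number for both points. After the last coordinate the two
  points coincide.\<close>

lemma rational_var_T: "rational_var (mat_variety T)"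
proof -
  obtain r :: nat and \<eta> where \<eta>: "\<forall>i<r. \<eta> i \<in> characters \<rat> T"
    "bij_betw (\<lambda>t. \<lambda>i\<in>{..<r}. \<eta> i t) T ({..<r} \<rightarrow>\<^sub>E - {0})"
    "\<forall>f\<in>entries. \<exists>p\<in>polyfun \<rat> (\<Union>i<r. {\<eta> i, \<lambda>t. inverse (\<eta> i t)}). \<forall>t\<in>T. f t = p t"
    by (rule coordinates)
  define L where "L = (\<Union>i<r. {\<eta> i, \<lambda>t. inverse (\<eta> i t)})"
  have L: "\<eta> i \<in> L" "(\<lambda>t. inverse (\<eta> i t)) \<in> L" if "i < r" for i
    using that by (auto simp: L_def)
  have ent: "\<exists>p\<in>polyfun \<rat> L. \<forall>t\<in>T. f t = p t" if "f \<in> entries" for f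
    using bspec[OF \<eta>(3) that] unfolding L_def .
  \<comment> \<open>The inverse determinant among \<open>coords\<close> will be read as the
    determinant of the inverse matrix, whose entries must therefore be expressed by the
    characters.\<close>
  have ent_inv: "\<exists>p\<in>polyfun \<rat> L. \<forall>t\<in>T. f (matrix_inv t) = p t" if f: "f \<in> entries" for f
  proof -
    obtain p where p: "p \<in> polyfun \<rat> L" "\<forall>t\<in>T. f t = p t" using ent[OF f] by (elim bexE)
    have "\<exists>g\<in>polyfun \<rat> L. \<forall>t\<in>T. h (matrix_inv t) = g t" if h: "h \<in> L" for h
    proof -
      obtain i where i: "i < r" "h = \<eta> i \<or> h = (\<lambda>t. inverse (\<eta> i t))"
        using h by (auto simp: L_def)
      have c: "\<eta> i (matrix_inv t) = inverse (\<eta> i t)" if "t \<in> T" for t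
        using char_inv \<eta>(1) i(1) that by blast
      from i(2) show ?thesis
      proof
        assume "h = \<eta> i"
        then show ?thesis by (intro bexI[OF _ polyfun.gen[OF L(2)[OF i(1)]]]) (simp add: c)
      next
        assume "h = (\<lambda>t. inverse (\<eta> i t))"
        then show ?thesis by (intro bexI[OF _ polyfun.gen[OF L(1)[OF i(1)]]]) (simp add: c)
      qed
    qed
    then obtain g where g: "g \<in> polyfun \<rat> L" "\<forall>t\<in>T. p (matrix_inv t) = g t"
      using polyfun_restrict[OF p(1), of L T matrix_inv] by (elim meta_impE bexE)
    show ?thesis by (rule bexI[OF _ g(1)]) (use p(2) g(2) T_inv in simp)
  qed
  have coord: "\<exists>p\<in>polyfun \<rat> L. \<forall>t\<in>T. f t = p t" if "f \<in> coords" for f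
  proof (cases "f \<in> entries")
    case True then show ?thesis by (rule ent)
  next
    case False
    then have f: "f = (\<lambda>A. inverse (det A))" using that by (simp add: coords_def)
    have "(\<lambda>A. det A) \<in> polyfun \<rat> (entries :: (complex^'n^'n \<Rightarrow> complex) set)"
      by (rule polyfun_det) (auto intro: polyfun.gen entriesI simp: Ints_def)
    then obtain g where g: "g \<in> polyfun \<rat> L" "\<forall>t\<in>T. det (matrix_inv t) = g t"
      using polyfun_restrict[of "\<lambda>A. det A" \<rat> entries L T matrix_inv] ent_inv by (elim meta_impE bexE)
    have "inverse (det t) = det (matrix_inv t)" if "t \<in> T" for t
    proof -
      have "det t * det (matrix_inv t) = 1"
        using that by (simp add: T_inv_simps flip: det_mul)
      then show ?thesis by (rule inverse_unique)
    qed
    then show ?thesis unfolding f by (intro bexI[OF _ g(1)]) (use g(2) in simp)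
  qed
  \<comment> \<open>Along a line on which only coordinate \<open>i\<close> varies, the other
    coordinates are complex constants and a regular function becomes a Laurent polynomial.\<close>
  have pull: "\<exists>R\<in>polyfun UNIV {\<lambda>z. z, inverse}. \<forall>z\<in>-{0}. p (u z) = R z"
    if p: "p \<in> polyfun UNIV coords" and i: "i < r"
      and u: "\<forall>z\<in>-{0}. u z \<in> T \<and> \<eta> i (u z) = z \<and> (\<forall>j<r. j \<noteq> i \<longrightarrow> \<eta> j (u z) = \<eta> j t)"
    for p i u t
  proof (rule polyfun_restrict[OF p])
    fix f assume f: "f \<in> (coords :: (complex^'n^'n \<Rightarrow> complex) set)"
    obtain P where P: "P \<in> polyfun \<rat> L" "\<forall>t\<in>T. f t = P t" using coord[OF f] by (elim bexE)
    have "\<exists>R\<in>polyfun UNIV {\<lambda>z. z, inverse}. \<forall>z\<in>-{0}. P (u z) = R z"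
    proof (rule polyfun_restrict[OF polyfun_mono[OF P(1) subset_UNIV subset_refl]])
      fix h assume "h \<in> L"
      then obtain j where j: "j < r" "h = \<eta> j \<or> h = (\<lambda>t. inverse (\<eta> j t))"
        by (auto simp: L_def)
      consider "h = \<eta> i" | "h = (\<lambda>t. inverse (\<eta> i t))"
        | "\<forall>z\<in>-{0}. h (u z) = h t" using j u by (cases "j = i") auto
      then show "\<exists>R\<in>polyfun UNIV {\<lambda>z. z, inverse}. \<forall>z\<in>-{0}. h (u z) = R z"
      proof cases
        case 1 then show ?thesis
          by (intro bexI[of _ "\<lambda>z. z"] polyfun.gen) (use u in auto)
      next
        case 2 then show ?thesis
          by (intro bexI[of _ inverse] polyfun.gen) (use u in auto)
      next
        case 3 then show ?thesis by (intro bexI[of _ "\<lambda>_. h t"] polyfun.const) auto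
      qed
    qed
    then obtain R where "R \<in> polyfun UNIV {\<lambda>z. z, inverse}" "\<forall>z\<in>-{0}. P (u z) = R z"
      by (elim bexE)
    then show "\<exists>R\<in>polyfun UNIV {\<lambda>z. z, inverse}. \<forall>z\<in>-{0}. f (u z) = R z"
      by (intro bexI[of _ R]) (use P(2) u in auto)
  qed
  have line: "\<exists>u. \<forall>z\<in>-{0}. u z \<in> T \<and> \<eta> i (u z) = z \<and> (\<forall>j<r. j \<noteq> i \<longrightarrow> \<eta> j (u z) = \<eta> j t)"
    if "t \<in> T" "i < r" for t i
  proof (rule bchoice, rule ballI)
    fix z :: complex assume "z \<in> -{0}"
    have nz: "\<eta> j t \<noteq> 0" if "j < r" for j using char_nz[OF _ \<open>t \<in> T\<close>] \<eta>(1) that by blast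
    let ?c = "\<lambda>j\<in>{..<r}. if j = i then z else \<eta> j t"
    have "?c \<in> {..<r} \<rightarrow>\<^sub>E - {0}"
      using \<open>z \<in> -{0}\<close> nz by auto
    then obtain s where s: "s \<in> T" "(\<lambda>i\<in>{..<r}. \<eta> i s) = ?c"
      using \<eta>(2) unfolding bij_betw_def by (metis (no_types, lifting) imageE)
    have "\<eta> j s = (if j = i then z else \<eta> j t)" if "j < r" for j
      using fun_cong[OF s(2), of j] that by simp
    then show "\<exists>s. s \<in> T \<and> \<eta> i s = z \<and> (\<forall>j<r. j \<noteq> i \<longrightarrow> \<eta> j s = \<eta> j t)"
      using s(1) \<open>i < r\<close> by auto
  qed
  \<comment> \<open>The coordinates of \<open>a\<close> and \<open>b\<close> are replaced by common rational values one at a time.\<close>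
  have main: "\<exists>a'\<in>T. \<exists>b'\<in>T. p a' \<noteq> 0 \<and> q b' \<noteq> 0 \<and> (\<forall>i<k. \<eta> i a' = \<eta> i b' \<and> \<eta> i a' \<in> \<rat>)"
    if pq: "p \<in> polyfun UNIV coords" "q \<in> polyfun UNIV coords"
      and ab: "a \<in> T" "b \<in> T" "p a \<noteq> 0" "q b \<noteq> 0" and "k \<le> r" for p q a b k
    using \<open>k \<le> r\<close>
  proof (induction k)
    case 0 then show ?case using ab by auto
  next
    case (Suc k)
    then obtain a' b' where *: "a' \<in> T" "b' \<in> T" "p a' \<noteq> 0" "q b' \<noteq> 0"
      "\<forall>i<k. \<eta> i a' = \<eta> i b' \<and> \<eta> i a' \<in> \<rat>" by auto
    have k: "k < r" using Suc.prems by simp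
    obtain u where u: "\<forall>z\<in>-{0}. u z \<in> T \<and> \<eta> k (u z) = z \<and> (\<forall>j<r. j \<noteq> k \<longrightarrow> \<eta> j (u z) = \<eta> j a')"
      using line[OF *(1) k] by (elim exE)
    obtain v where v: "\<forall>z\<in>-{0}. v z \<in> T \<and> \<eta> k (v z) = z \<and> (\<forall>j<r. j \<noteq> k \<longrightarrow> \<eta> j (v z) = \<eta> j b')"
      using line[OF *(2) k] by (elim exE)
    obtain R where R: "R \<in> polyfun UNIV {\<lambda>z. z, inverse}" "\<forall>z\<in>-{0}. p (u z) = R z"
      using pull[OF pq(1) k u] by (elim bexE)
    obtain S where S: "S \<in> polyfun UNIV {\<lambda>z. z, inverse}" "\<forall>z\<in>-{0}. q (v z) = S z"
      using pull[OF pq(2) k v] by (elim bexE)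
    have nz: "\<eta> k a' \<noteq> 0" "\<eta> k b' \<noteq> 0" using char_nz \<eta>(1) k *(1,2) by blast+
    have "u (\<eta> k a') = a'"
    proof (rule coordinates_inj[OF \<eta>(2)])
      fix i assume "i < r"
      then show "\<eta> i (u (\<eta> k a')) = \<eta> i a'" using u nz by (cases "i = k") auto
    qed (use u nz * in auto)
    moreover have "v (\<eta> k b') = b'"
    proof (rule coordinates_inj[OF \<eta>(2)])
      fix i assume "i < r"
      then show "\<eta> i (v (\<eta> k b')) = \<eta> i b'" using v nz by (cases "i = k") auto
    qed (use v nz * in auto)
    ultimately have "R (\<eta> k a') \<noteq> 0" "S (\<eta> k b') \<noteq> 0"
      using bspec[OF R(2), of "\<eta> k a'"] bspec[OF S(2), of "\<eta> k b'"] nz *(3,4) by auto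
    then obtain c where c: "c \<in> \<rat>" "c \<noteq> 0" "R c \<noteq> 0" "S c \<noteq> 0"
      using Laurent_common_rational_nonzero[OF R(1) S(1) nz] by auto
    show ?case
    proof (rule bexI[of _ "u c"], rule bexI[of _ "v c"], intro conjI allI impI)
      fix i assume "i < Suc k"
      then have "i = k \<or> i < k" by auto
      then show "\<eta> i (u c) = \<eta> i (v c)" "\<eta> i (u c) \<in> \<rat>" using u v c *(5) k by auto
    qed (use u v R(2) S(2) c in auto)
  qed
  show ?thesis
    unfolding rational_var_def
  proof (intro conjI prevar_mat_variety exI[of _ coords] ballI impI)
    show "pts (mat_variety T) \<noteq> {}" using T_one by auto
    show "atlas (mat_variety T) = {(pts (mat_variety T), coords)}" by simp
    fix p q a b
    assume pq: "p \<in> polyfun UNIV coords" "q \<in> polyfun UNIV coords"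
      and ab: "a \<in> pts (mat_variety T)" "b \<in> pts (mat_variety T)" "p a \<noteq> 0 \<and> q b \<noteq> 0"
    have "\<exists>a'\<in>T. \<exists>b'\<in>T. p a' \<noteq> 0 \<and> q b' \<noteq> 0 \<and> (\<forall>i<r. \<eta> i a' = \<eta> i b' \<and> \<eta> i a' \<in> \<rat>)"
      by (rule main[OF pq, of a b r]) (use ab in auto)
    then obtain a' b' where *: "a' \<in> T" "b' \<in> T" "p a' \<noteq> 0" "q b' \<noteq> 0"
      "\<forall>i<r. \<eta> i a' = \<eta> i b' \<and> \<eta> i a' \<in> \<rat>" by blast
    have eq: "a' = b'" by (rule coordinates_inj[OF \<eta>(2) *(1,2)]) (use *(5) in simp)
    have "f a' \<in> \<rat>" if f: "f \<in> coords" for f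
    proof -
      obtain P where P: "P \<in> polyfun \<rat> L" "\<forall>t\<in>T. f t = P t" using coord[OF f] by (elim bexE)
      have "h a' \<in> \<rat>" if "h \<in> L" for h using that *(5) by (auto simp: L_def)
      from polyfun_Rats[OF P(1) this] show ?thesis using P(2) *(1) by simp
    qed
    then show "\<exists>c\<in>pts (mat_variety T). (\<forall>f\<in>coords. f c \<in> \<rat>) \<and> p c \<noteq> 0 \<and> q c \<noteq> 0"
      using * eq by (intro bexI[of _ a']) auto
  qed
qed

lemma char_regular:
  assumes "\<eta> \<in> characters \<rat> T" "t \<in> T" shows "reg_at (mat_variety T) t \<eta>"
proof -
  have "\<exists>p\<in>polyfun \<rat> coords. \<forall>t\<in>T. \<eta> t = p t" using assms(1) by (simp add: characters_def)
  then obtain p where p: "p \<in> polyfun \<rat> coords" "\<forall>t\<in>T. \<eta> t = p t" by (elim bexE)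
  have t: "(T, coords) \<in> atlas (mat_variety T)" by simp
  show ?thesis
    by (rule reg_at_cong[OF prevar_mat_variety reg_at_poly[OF t assms(2) p(1)]],
        rule eventually_mono[OF eventually_near_in_chart[OF prevar_mat_variety t assms(2)]])
       (use p(2) in simp)
qed

end


section \<open>The Weyl group and its action on the torus\<close>

lemma mat2_mult: "mat2 p q r s ** mat2 p' q' r' s' =
  mat2 (p * p' + q * r') (p * q' + q * s') (r * p' + s * r') (r * q' + s * s')"
  by (simp add: mat2_def vec_eq_iff matrix_matrix_mult_def forall_2 sum_2)

lemma det_mat2: "det (mat2 p q r s) = p * s - q * r"
  by (simp add: mat2_def det_2)

lemma GL_cancel:
  fixes A B s :: "complex^'n^'n"
  assumes "s \<in> GL" "A ** s = B ** s" shows "A = B"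
proof -
  have "A ** (s ** matrix_inv s) = B ** (s ** matrix_inv s)"
    using assms(2) by (simp add: matrix_mul_assoc)
  then show ?thesis by (simp add: matrix_inv_GL(2)[OF assms(1)])
qed

lemma matrix_cube:
  fixes A :: "complex^'n^'n"
  assumes "A ** A ** A = mat 1"
  shows "A ** (A ** A) = mat 1" "A ** (A ** (A ** X)) = X"
  using assms by (simp_all add: matrix_mul_assoc)

lemma matrix_left_commute:
  fixes A B :: "complex^'n^'n"
  assumes "B ** A = A ** B" shows "B ** (A ** X) = A ** (B ** X)"
  using assms by (simp add: matrix_mul_assoc)

locale reductive_group =
  fixes D :: "('n::finite, 'i) reductive_datum"
  assumes split_reductive: "split_reductive D"
begin

abbreviation T where "T \<equiv> tor D"
abbreviation W where "W \<equiv> weyl D"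

lemma split_T: "split_torus \<rat> T"
  using split_reductive by (simp add: split_reductive_def split_maximal_torus_def)

sublocale split_torus_over_rat T
  by unfold_locales (rule split_T)

lemma subgroup_G: "subgroup (grp D) (mat_group GL)"
  using split_reductive by (simp add: split_reductive_def algebraic_group_def)

lemma group_G: "group (mat_group (grp D))"
  using subgroup.subgroup_is_group[OF subgroup_G group_GL] by (simp add: mat_group_def)

lemma T_subgroup_G: "subgroup T (mat_group (grp D))"
proof -
  have "T \<subseteq> grp D"
    using split_reductive by (simp add: split_reductive_def split_maximal_torus_def)
  from group.subgroup_incl[OF group_GL subgroup_T subgroup_G this] show ?thesis
    by (simp add: mat_group_def)
qed

abbreviation N where "N \<equiv> (mat_group (grp D))\<lparr>carrier := normalizer (mat_group (grp D)) T\<rparr>"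

lemma normal_T: "T \<lhd> N"
  by (rule group.subgroup_in_normalizer[OF group_G T_subgroup_G])

lemma group_N: "group N"
  using normal_T by (simp add: normal_def)

lemma group_W: "group W"
  unfolding weyl_group_def by (rule normal.factorgroup_is_group[OF normal_T])

lemma carrier_N_GL: "n \<in> carrier N \<Longrightarrow> n \<in> GL"
  using group.normalizer_imp_subgroup[OF group_G, of T] subgroup.subset[OF T_subgroup_G]
    subgroup.subset[OF subgroup_G] subgroup.subset by fastforce

lemma W_coset:
  assumes "w \<in> carrier W"
  obtains n where "n \<in> carrier N" "w = {t ** n | t. t \<in> T}"
proof -
  obtain n where "n \<in> carrier N" "w = T #>\<^bsub>N\<^esub> n"
    using assms unfolding weyl_group_def FactGroup_def RCOSETS_def by auto
  then show ?thesis by (intro that[of n]) (auto simp: r_coset_def)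
qed

lemma W_nonempty: "w \<in> carrier W \<Longrightarrow> w \<noteq> {}"
  using T_one by (auto elim!: W_coset)

lemma W_subset_N: "w \<in> carrier W \<Longrightarrow> w \<subseteq> carrier N"
  using subgroup.rcosets_carrier[OF normal_imp_subgroup[OF normal_T] group_N]
  unfolding weyl_group_def FactGroup_def by simp

lemma W_GL: "w \<in> carrier W \<Longrightarrow> n \<in> w \<Longrightarrow> n \<in> GL"
  using W_subset_N carrier_N_GL by blast

lemma W_mult:
  assumes "n \<in> v \<otimes>\<^bsub>W\<^esub> w" obtains m m' where "m \<in> v" "m' \<in> w" "n = m ** m'"
  using assms by (auto simp: weyl_group_def FactGroup_def set_mult_def)

lemma W_one: "\<one>\<^bsub>W\<^esub> = T"
  by (simp add: weyl_group_def)

lemma W_inv: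
  assumes "w \<in> carrier W" "n \<in> inv\<^bsub>W\<^esub> w"
  obtains m where "m \<in> w" "n = matrix_inv m"
proof -
  have "n \<in> (\<Union>m\<in>w. {inv\<^bsub>N\<^esub> m})"
    using assms normal.inv_FactGroup[OF normal_T] by (simp add: weyl_group_def SET_INV_def)
  then obtain m where m: "m \<in> w" "n = inv\<^bsub>N\<^esub> m" by auto
  then have mN: "m \<in> carrier N" using W_subset_N assms by auto
  have "m ** n = mat 1" "n ** m = mat 1"
    using group.r_inv[OF group_N mN] group.l_inv[OF group_N mN] m(2) by simp_all
  then show ?thesis using that m(1) matrix_inv_unique by blast
qed

section \<open>Simple reflections acting on the torus\<close>

definition sref :: "'i \<Rightarrow> complex^'n^'n \<Rightarrow> complex^'n^'n" where
  "sref i t = t ** scoroot D i (inverse (sroot D i t))"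

lemma root_char:
  assumes "i \<in> idx D" shows "sroot D i \<in> characters \<rat> T"
  using split_reductive assms by (auto simp: split_reductive_def simple_roots_def roots_def)

lemma coroot:
  assumes "i \<in> idx D" shows "is_coroot (grp D) T (sroot D i) (scoroot D i)"
  using split_reductive assms by (simp add: split_reductive_def)

lemma coroot_T: "i \<in> idx D \<Longrightarrow> c \<noteq> 0 \<Longrightarrow> scoroot D i c \<in> T"
  using coroot[of i] by (simp add: is_coroot_def cocharacters_def)

lemma coroot_mult:
  "i \<in> idx D \<Longrightarrow> c \<noteq> 0 \<Longrightarrow> d \<noteq> 0 \<Longrightarrow> scoroot D i (c * d) = scoroot D i c ** scoroot D i d"
  using coroot[of i] by (simp add: is_coroot_def cocharacters_def)

lemmas T_cancel = GL_cancel[OF T_GL]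

text \<open>By multiplicativity the value at 1 is idempotent, and the identity is the only
  idempotent of a group.\<close>

lemma coroot_one:
  assumes "i \<in> idx D" shows "scoroot D i 1 = mat 1"
proof (rule T_cancel)
  show "scoroot D i 1 \<in> T" by (rule coroot_T[OF assms]) simp
  show "scoroot D i 1 ** scoroot D i 1 = mat 1 ** scoroot D i 1"
    using coroot_mult[OF assms, of 1 1] by simp
qed

text \<open>Conjugation by l(c) scales the parameter of the upper unipotent subgroup by c^2, by a
  computation in SL2, and by \<alpha>(l(c)), by the root condition. If the factors differed, some
  nonzero w would have U(w) = 1; rescaling w to 1 by another l(d) would make U(1) trivial, which
  \<open>is_coroot\<close> excludes.\<close>

lemma root_coroot:
  assumes i: "i \<in> idx D" and c: "c \<noteq> 0"
  shows "sroot D i (scoroot D i c) = c\<^sup>2"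
proof (rule ccontr)
  let ?a = "sroot D i" and ?l = "scoroot D i"
  obtain \<phi> where \<phi>: "\<forall>A. det A = 1 \<longrightarrow> \<phi> A \<in> grp D"
    "\<forall>A A'. det A = 1 \<and> det A' = 1 \<longrightarrow> \<phi> (A ** A') = \<phi> A ** \<phi> A'"
    "\<phi> (mat2 1 1 0 1) \<noteq> mat 1"
    "\<forall>t\<in>T. \<forall>z. t ** \<phi> (mat2 1 z 0 1) ** matrix_inv t = \<phi> (mat2 1 (?a t * z) 0 1)"
    "\<forall>c. c \<noteq> 0 \<longrightarrow> ?l c = \<phi> (mat2 c 0 0 (inverse c))"
    using coroot[OF i] unfolding is_coroot_def by (elim conjE exE)
  define U where "U z = \<phi> (mat2 1 z 0 1)" for z
  have U_add: "U (y + z) = U y ** U z" for y z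
  proof -
    have "mat2 1 (y + z) 0 1 = mat2 1 y 0 1 ** mat2 1 z 0 1" by (simp add: mat2_mult add.commute)
    then show ?thesis using \<phi>(2) by (simp add: U_def det_mat2)
  qed
  have U_GL: "U z \<in> GL" for z
    using \<phi>(1) subgroup.subset[OF subgroup_G] by (auto simp: U_def det_mat2)
  have conj_l: "?l d ** U z = U (d\<^sup>2 * z) ** ?l d" if "d \<noteq> 0" for d z
  proof -
    have "mat2 d 0 0 (inverse d) ** mat2 1 z 0 1 = mat2 1 (d\<^sup>2 * z) 0 1 ** mat2 d 0 0 (inverse d)"
      using that by (simp add: mat2_mult power2_eq_square field_simps)
    then show ?thesis using \<phi>(2,5) that by (simp add: U_def det_mat2 flip: \<phi>(2))
  qed
  have conj_t: "t ** U z = U (?a t * z) ** t" if "t \<in> T" for t z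
  proof -
    have "t ** U z = t ** U z ** (matrix_inv t ** t)" using that by (simp add: T_inv_simps)
    also have "\<dots> = t ** U z ** matrix_inv t ** t" by (simp add: matrix_mul_assoc)
    finally show ?thesis using \<phi>(4) that by (simp add: U_def)
  qed
  assume neq: "?a (?l c) \<noteq> c\<^sup>2"
  let ?w = "c\<^sup>2 - ?a (?l c)"
  have "U (c\<^sup>2) ** ?l c = U (?a (?l c)) ** ?l c"
    using conj_l[OF c, of 1] conj_t[OF coroot_T[OF i c], of 1] by simp
  then have "U (c\<^sup>2) = U (?a (?l c))" by (rule T_cancel[OF coroot_T[OF i c]])
  then have "U (?w + ?a (?l c)) = U (?a (?l c))" by simp
  then have "U ?w ** U (?a (?l c)) = mat 1 ** U (?a (?l c))" unfolding U_add by simp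
  then have Uw: "U ?w = mat 1" by (rule GL_cancel[OF U_GL])
  define d where "d = csqrt (inverse ?w)"
  have d: "d\<^sup>2 * ?w = 1" "d \<noteq> 0" using neq by (auto simp: d_def)
  have "U 1 ** ?l d = mat 1 ** ?l d" using conj_l[OF d(2), of ?w] Uw d(1) by simp
  then have "U 1 = mat 1" using T_cancel[OF coroot_T[OF i d(2)]] by blast
  then show False using \<phi>(3) by (simp add: U_def)
qed

lemma sref_T: "i \<in> idx D \<Longrightarrow> t \<in> T \<Longrightarrow> sref i t \<in> T"
  unfolding sref_def using char_nz[OF root_char] by (intro T_mult coroot_T) auto

lemma root_sref:
  assumes "i \<in> idx D" "t \<in> T" shows "sroot D i (sref i t) = inverse (sroot D i t)"
proof -
  have nz: "sroot D i t \<noteq> 0" by (rule char_nz[OF root_char[OF assms(1)] assms(2)])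
  then have "sroot D i (sref i t) = sroot D i t * (inverse (sroot D i t))\<^sup>2"
    unfolding sref_def using assms
    by (subst char_mult[OF root_char[OF assms(1)] assms(2) coroot_T[OF assms(1)]])
       (simp_all add: root_coroot)
  then show ?thesis using nz by (simp add: power2_eq_square)
qed

lemma sref_sref:
  assumes "i \<in> idx D" "t \<in> T" shows "sref i (sref i t) = t"
proof -
  let ?a = "sroot D i t"
  have nz: "?a \<noteq> 0" by (rule char_nz[OF root_char[OF assms(1)] assms(2)])
  have "sref i (sref i t) = sref i t ** scoroot D i ?a"
    using root_sref[OF assms] by (simp add: sref_def[of i "sref i t"])
  also have "\<dots> = t ** scoroot D i (inverse ?a * ?a)"
    using nz by (subst coroot_mult[OF assms(1)]) (simp_all add: sref_def matrix_mul_assoc)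
  finally show ?thesis using nz by (simp add: coroot_one[OF assms(1)])
qed

lemma srefl_iff:
  assumes "i \<in> idx D"
  shows "w = srefl D i \<longleftrightarrow>
    w \<in> carrier W \<and> (\<forall>n\<in>w. \<forall>t\<in>T. n ** t ** matrix_inv n = sref i t)"
  using split_reductive assms unfolding split_reductive_def sref_def by blast

lemma srefl_W: "i \<in> idx D \<Longrightarrow> srefl D i \<in> carrier W"
  using srefl_iff by blast

lemma srefl_conj:
  "i \<in> idx D \<Longrightarrow> n \<in> srefl D i \<Longrightarrow> t \<in> T \<Longrightarrow> n ** t ** matrix_inv n = sref i t"
  using srefl_iff by blast

lemma srefl_conj_inv:
  assumes "i \<in> idx D" "n \<in> srefl D i" "t \<in> T"
  shows "matrix_inv n ** t ** n = sref i t"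
proof -
  have n: "n \<in> GL" by (rule W_GL[OF srefl_W[OF assms(1)] assms(2)])
  have "n ** sref i t ** matrix_inv n = t"
    using srefl_conj[OF assms(1,2) sref_T[OF assms(1,3)]] sref_sref[OF assms(1,3)] by simp
  then have "matrix_inv n ** t ** n =
    matrix_inv n ** (n ** sref i t ** matrix_inv n) ** n" by simp
  also have "\<dots> = (matrix_inv n ** n) ** sref i t ** (matrix_inv n ** n)"
    by (simp add: matrix_mul_assoc)
  finally show ?thesis by (simp add: matrix_inv_GL[OF n])
qed

text \<open>The inverse coset acts on T in the same way, because \<open>sref i\<close> is an
  involution; the characterisation of \<open>srefl\<close> in \<open>split_reductive\<close> then
  makes the two cosets equal.\<close>

lemma srefl_involution:
  assumes "i \<in> idx D" shows "srefl D i \<otimes>\<^bsub>W\<^esub> srefl D i = \<one>\<^bsub>W\<^esub>"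
proof -
  have s: "srefl D i \<in> carrier W" by (rule srefl_W[OF assms])
  have "n ** t ** matrix_inv n = sref i t" if n: "n \<in> inv\<^bsub>W\<^esub> (srefl D i)" "t \<in> T" for n t
  proof -
    obtain m where m: "m \<in> srefl D i" "n = matrix_inv m" by (rule W_inv[OF s n(1)])
    have "m \<in> GL" by (rule W_GL[OF s m(1)])
    then have "matrix_inv n = m" using m(2) matrix_inv_GL by (intro matrix_inv_unique) auto
    then show ?thesis using srefl_conj_inv[OF assms m(1) n(2)] m(2) by simp
  qed
  then have "inv\<^bsub>W\<^esub> (srefl D i) = srefl D i"
    using srefl_iff[OF assms] group.inv_closed[OF group_W s] by blast
  then show ?thesis using group.r_inv[OF group_W s] by simp
qed

section \<open>Words in the simple reflections and their action on the torus\<close>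

lemma word_prod_Nil: "word_prod D [] = \<one>\<^bsub>W\<^esub>"
  by (simp add: word_prod_def)

lemma word_prod_Cons: "word_prod D (i # is) = srefl D i \<otimes>\<^bsub>W\<^esub> word_prod D is"
  by (simp add: word_prod_def)

lemma word_prod_W: "is \<in> lists (idx D) \<Longrightarrow> word_prod D is \<in> carrier W"
proof (induction "is")
  case Nil then show ?case
    using group.is_monoid[OF group_W] by (simp add: word_prod_Nil monoid.one_closed)
next
  case (Cons i "is") then show ?case
    using group.is_monoid[OF group_W] srefl_W by (simp add: word_prod_Cons monoid.m_closed)
qed

lemma word_prod_append:
  assumes "is \<in> lists (idx D)" "js \<in> lists (idx D)"
  shows "word_prod D (is @ js) = word_prod D is \<otimes>\<^bsub>W\<^esub> word_prod D js"
  using assms(1)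
proof (induction "is" rule: list.induct)
  case Nil then show ?case
    using group.is_monoid[OF group_W] word_prod_W[OF assms(2)] by (simp add: word_prod_Nil monoid.l_one)
next
  case (Cons i "is") then show ?case
    using group.is_monoid[OF group_W] srefl_W word_prod_W assms(2)
    by (simp add: word_prod_Cons monoid.m_assoc)
qed

lemma foldr_sref_T: "is \<in> lists (idx D) \<Longrightarrow> t \<in> T \<Longrightarrow> foldr sref is t \<in> T"
  by (induction "is") (auto simp: sref_T)

lemma word_prod_conj:
  assumes "is \<in> lists (idx D)" "n \<in> word_prod D is" "t \<in> T"
  shows "n ** t ** matrix_inv n = foldr sref is t"
  using assms(1,2)
proof (induction "is" arbitrary: n rule: list.induct)
  case Nil
  then have n: "n \<in> T" by (simp add: word_prod_Nil W_one)
  then have "n ** t ** matrix_inv n = t ** (n ** matrix_inv n)"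
    using T_comm[OF n assms(3)] by (simp add: matrix_mul_assoc)
  then show ?case using T_inv_simps[OF n] by simp
next
  case (Cons i "is")
  then have i: "i \<in> idx D" and js: "is \<in> lists (idx D)" by auto
  obtain m m' where m: "m \<in> srefl D i" "m' \<in> word_prod D is" "n = m ** m'"
    using Cons.prems(2) unfolding word_prod_Cons by (rule W_mult)
  have GL: "m \<in> GL" "m' \<in> GL" using W_GL srefl_W[OF i] word_prod_W[OF js] m by auto
  have "n ** t ** matrix_inv n = m ** (m' ** t ** matrix_inv m') ** matrix_inv m"
    unfolding m(3) matrix_inv_mult[OF GL] by (simp add: matrix_mul_assoc)
  also have "\<dots> = m ** foldr sref is t ** matrix_inv m"
    using Cons.IH[OF js m(2)] by simp
  finally show ?case using srefl_conj[OF i m(1) foldr_sref_T[OF js assms(3)]] by simp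
qed

lemma word_prod_eq_imp_action_eq:
  assumes "is \<in> lists (idx D)" "js \<in> lists (idx D)" "word_prod D is = word_prod D js" "t \<in> T"
  shows "foldr sref is t = foldr sref js t"
proof -
  obtain n where "n \<in> word_prod D is" using W_nonempty[OF word_prod_W[OF assms(1)]] by blast
  then show ?thesis using word_prod_conj[OF _ _ assms(4), of _ n] assms by metis
qed

text \<open>A reflection acts on characters by precomposition with its inverse, which is itself.
  Precomposition reverses the order, so the \<open>fold\<close> in \<open>e_word\<close> becomes a
  \<open>foldr\<close> on T.\<close>

lemma fold_weyl_char:
  assumes "is \<in> lists (idx D)" "t \<in> T"
  shows "fold (\<lambda>j. weyl_char (srefl D j)) is \<eta> t = \<eta> (foldr sref is t)"
  using assms(1)
proof (induction "is" arbitrary: \<eta> rule: list.induct)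
  case (Cons j "is")
  then have j: "j \<in> idx D" and js: "is \<in> lists (idx D)" by auto
  have "(SOME n. n \<in> srefl D j) \<in> srefl D j"
    using W_nonempty[OF srefl_W[OF j]] by (simp add: some_in_eq)
  then have "weyl_char (srefl D j) \<eta> s = \<eta> (sref j s)" if "s \<in> T" for s
    using srefl_conj_inv[OF j _ that] by (simp add: weyl_char_def Let_def)
  then show ?case using Cons.IH[OF js] foldr_sref_T[OF js assms(2)] by simp
qed simp


end


subsection \<open>Parity of words\<close>

text \<open>The points other than \<open>x0\<close> fall into pairs {x, f x}.\<close>

lemma odd_card_involution:
  assumes "finite S" "x0 \<in> S" "\<And>x. x \<in> S \<Longrightarrow> f x \<in> S" "\<And>x. x \<in> S \<Longrightarrow> f (f x) = x"
    "\<And>x. x \<in> S \<Longrightarrow> f x = x \<longleftrightarrow> x = x0"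
  shows "odd (card S)"
  using assms
proof (induction "card S" arbitrary: S rule: less_induct)
  case less
  show ?case
  proof (cases "S = {x0}")
    case False
    then obtain x where x: "x \<in> S" "x \<noteq> x0" using less.prems(2) by blast
    then have fx: "f x \<in> S" "f x \<noteq> x" using less.prems by auto
    let ?S = "S - {x, f x}"
    have c: "card S = card ?S + 2"
    proof -
      have "card ?S = card S - card {x, f x}" using x fx by (intro card_Diff_subset) auto
      moreover have "card {x, f x} \<le> card S" using x fx less.prems(1) by (intro card_mono) auto
      ultimately show ?thesis using fx(2) by simp
    qed
    have "f x \<noteq> x0" using less.prems(4,5) x fx by metis
    moreover have "f y \<noteq> x \<and> f y \<noteq> f x" if "y \<in> ?S" for y
      using less.prems(4) x(1) that by (metis Diff_iff insertI1 insertI2)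
    ultimately have "odd (card ?S)"
      using c x less.prems by (intro less.hyps) auto
    then show ?thesis using c by simp
  qed simp
qed

text \<open>The last two premises say that \<open>P\<close> contains exactly one point of every
  two-cycle, so \<open>p\<close> is a product of \<open>card P\<close> disjoint
  transpositions.\<close>

lemma sign_involution:
  assumes "finite P" "\<And>x. p (p x) = x" "\<And>x. x \<in> P \<Longrightarrow> p x \<notin> P"
    "\<And>x. x \<notin> P \<Longrightarrow> p x \<notin> P \<Longrightarrow> p x = x"
  shows "permutation p \<and> sign p = (- 1) ^ card P"
  using assms
proof (induction P arbitrary: p rule: finite_induct)
  case empty
  then have "p = id" by auto
  then show ?case by (simp add: sign_id)
next
  case (insert x P)
  let ?\<tau> = "Transposition.transpose x (p x)"
  define p' where "p' = p \<circ> ?\<tau>"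
  have px: "p x \<noteq> x" "p x \<notin> P" using insert.prems(2) by auto
  have p': "p' y = (if y = x \<or> y = p x then y else p y)" for y
    using insert.prems(1) by (auto simp: p'_def Transposition.transpose_def)
  have ne: "p y \<noteq> x \<and> p y \<noteq> p x" if "y \<noteq> x" "y \<noteq> p x" for y using insert.prems(1) that by metis
  have "permutation p' \<and> sign p' = (- 1) ^ card P"
  proof (rule insert.IH)
    show "p' (p' y) = y" for y
      using ne by (cases "y = x \<or> y = p x") (simp_all add: p' insert.prems(1))
    show "p' y \<notin> P" if "y \<in> P" for y
      using that insert.prems(2)[of y] px(2) insert.hyps(2) by (auto simp: p')
    show "p' y = y" if "y \<notin> P" "p' y \<notin> P" for y
    proof (cases "y = x \<or> y = p x")
      case False
      then show ?thesis using that ne[of y] insert.prems(3)[of y] by (simp add: p')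
    qed (simp add: p')
  qed
  moreover have "p = p' \<circ> ?\<tau>" by (simp add: p'_def comp_assoc)
  moreover have "permutation ?\<tau>" "sign ?\<tau> = - 1"
    using px(1) by (auto simp: permutation_swap_id sign_swap_id)
  ultimately have "permutation p" "sign p = sign p' * sign ?\<tau>"
    using permutation_compose sign_compose by metis+
  then show ?case
    using insert.hyps \<open>permutation p' \<and> _\<close> \<open>sign ?\<tau> = - 1\<close> by simp
qed

context reductive_group
begin

text \<open>\<open>sign\<close> concerns permutations of a whole type that move finitely many
  points, so the reflection is restricted to the finite 3-torsion and extended by the
  identity.\<close>

definition torsion_refl :: "'i \<Rightarrow> complex^'n^'n \<Rightarrow> complex^'n^'n" where
  "torsion_refl i t = (if t \<in> T \<and> t ** t ** t = mat 1 then sref i t else t)"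

lemma cube_sref:
  assumes "i \<in> idx D" "t \<in> T" "t ** t ** t = mat 1"
  shows "sref i t ** sref i t ** sref i t = mat 1"
proof -
  let ?c = "inverse (sroot D i t)"
  have nz: "sroot D i t \<noteq> 0" by (rule char_nz[OF root_char[OF assms(1)] assms(2)])
  let ?l = "scoroot D i ?c"
  have l: "?l \<in> T" using nz by (intro coroot_T[OF assms(1)]) simp
  have "sroot D i t * sroot D i t * sroot D i t = sroot D i (t ** t ** t)"
    using assms(1,2) by (simp add: char_mult[OF root_char] T_mult)
  then have "sroot D i t * sroot D i t * sroot D i t = 1"
    using assms(3) char_one[OF root_char[OF assms(1)]] by simp
  then have c: "?c * ?c * ?c = 1" by (metis inverse_1 inverse_mult_distrib mult.commute)
  have "?l ** ?l ** ?l = mat 1"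
    using nz c coroot_one[OF assms(1)] by (simp flip: coroot_mult[OF assms(1)])
  note rules = matrix_mul_assoc[symmetric] matrix_cube[OF assms(3)] matrix_cube[OF this]
    T_comm[OF l assms(2)] matrix_left_commute[OF T_comm[OF l assms(2)]]
  show ?thesis by (simp add: sref_def rules)
qed

text \<open>On the 3-torsion of \<open>T\<close>, where \<open>\<alpha>\<^sub>i\<close> takes the values \<open>1, \<omega>, \<omega>\<^sup>2\<close>, the reflection \<open>s\<^sub>i\<close> fixes
  the kernel of \<open>\<alpha>\<^sub>i\<close> and exchanges the fibres over \<open>\<omega>\<close> and \<open>\<omega>\<^sup>2\<close>.  The fibre over \<open>\<omega>\<close> is a
  coset of a group without 2-torsion, so its cardinality is odd.\<close>

lemma sign_torsion_refl:
  assumes i: "i \<in> idx D"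
  shows "permutation (torsion_refl i)" "sign (torsion_refl i) = - 1"
proof -
  let ?S = "{t\<in>T. t ** t ** t = mat 1}" and ?a = "sroot D i"
  define \<omega> :: complex where "\<omega> = Complex (-1/2) (sqrt 3 / 2)"
  have \<omega>: "\<omega> * \<omega> + \<omega> + 1 = 0" by (simp add: \<omega>_def complex_eq_iff)
  have \<omega>3: "\<omega> * \<omega> * \<omega> = 1" using \<omega> by algebra
  have \<omega>nz: "\<omega> \<noteq> 0" using \<omega>3 by auto
  have \<omega>1: "\<omega> * \<omega> \<noteq> 1" using \<omega> \<omega>3 by (auto simp: \<omega>_def complex_eq_iff)
  have \<omega>inv: "inverse \<omega> = \<omega> * \<omega>" using \<omega>3 by (intro inverse_unique) (simp add: mult.assoc)
  define P where "P = {t\<in>?S. ?a t = \<omega>}"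
  have ch: "?a \<in> characters \<rat> T" by (rule root_char[OF i])
  have cube: "?a t * ?a t * ?a t = 1" if "t \<in> ?S" for t
  proof -
    have tT: "t \<in> T" using that by simp
    have "?a t * ?a t * ?a t = ?a (t ** t ** t)" by (simp add: tT char_mult[OF ch] T_mult)
    then show ?thesis using that char_one[OF ch] by simp
  qed
  have fin: "finite P" by (rule finite_subset[OF _ finite_cube_torsion]) (auto simp: P_def)
  have inv: "torsion_refl i (torsion_refl i t) = t" for t
    using sref_sref[OF i] sref_T[OF i] cube_sref[OF i] by (cases "t \<in> ?S") (auto simp: torsion_refl_def)
  have move: "torsion_refl i t \<notin> P" if "t \<in> P" for t
  proof -
    have "?a (torsion_refl i t) = \<omega> * \<omega>"
      using that root_sref[OF i] \<omega>inv by (simp add: P_def torsion_refl_def)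
    moreover have "\<omega> * \<omega> \<noteq> \<omega>" using \<omega>1 \<omega>nz \<omega>3 by auto
    ultimately show ?thesis by (simp add: P_def)
  qed
  have stay: "torsion_refl i t = t" if "t \<notin> P" "torsion_refl i t \<notin> P" for t
  proof (cases "t \<in> ?S")
    case True
    then have r: "torsion_refl i t = sref i t" by (simp add: torsion_refl_def)
    have "sref i t \<in> ?S" using True sref_T[OF i] cube_sref[OF i] by simp
    then have "?a t \<noteq> \<omega>" "inverse (?a t) \<noteq> \<omega>"
      using that True r root_sref[OF i] by (auto simp: P_def)
    then have "?a t \<noteq> \<omega>" "?a t \<noteq> \<omega> * \<omega>" using \<omega>inv by (metis inverse_inverse_eq)+
    moreover have "(?a t - 1) * (?a t - \<omega>) * (?a t - \<omega> * \<omega>) = 0"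
      using cube[OF True] \<omega> by algebra
    ultimately have "?a t = 1" by auto
    then show ?thesis using r coroot_one[OF i] by (simp add: sref_def)
  qed (auto simp: torsion_refl_def)
  have "odd (card P)"
  proof -
    \<comment> \<open>A base point of the fibre: \<alpha> takes it to \<omega>^4 = \<omega>.\<close>
    let ?t0 = "scoroot D i (\<omega> * \<omega>)"
    have t0: "?t0 \<in> T" using \<omega>nz by (intro coroot_T[OF i]) simp
    have t03: "?t0 ** ?t0 ** ?t0 = mat 1"
    proof -
      have "\<omega> * \<omega> * (\<omega> * \<omega>) * (\<omega> * \<omega>) = 1" using \<omega>3 by algebra
      then show ?thesis using \<omega>nz coroot_one[OF i] by (simp flip: coroot_mult[OF i])
    qed
    have at0: "?a ?t0 = \<omega>" using root_coroot[OF i, of "\<omega> * \<omega>"] \<omega>nz \<omega>3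
      by (simp add: power2_eq_square mult.assoc)
    \<comment> \<open>For t = t0 * u with u^3 = 1 this is t0^4 * u^2 = t0 * u^-1, the inversion of
      the coset about t0. A fixed point has u^2 = 1, and together with u^3 = 1 this forces u =
      1.\<close>
    let ?f = "\<lambda>t. ?t0 ** ?t0 ** (t ** t)"
    show ?thesis
    proof (rule odd_card_involution[OF fin, of ?t0 ?f])
      show "?t0 \<in> P" using t0 t03 at0 by (simp add: P_def)
      fix t assume "t \<in> P"
      then have t: "t \<in> T" "t ** t ** t = mat 1" "?a t = \<omega>" by (auto simp: P_def)
      have comm: "t ** ?t0 = ?t0 ** t" by (rule T_comm[OF t(1) t0])
      note rules = matrix_mul_assoc[symmetric] matrix_cube[OF t03] matrix_cube[OF t(2)]
        comm matrix_left_commute[OF comm]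
      show "?f (?f t) = t" by (simp add: rules)
      have "?f t \<in> T" using t t0 T_mult by simp
      moreover have "?f t ** ?f t ** ?f t = mat 1" by (simp add: rules)
      moreover have "?a (?f t) = \<omega>"
        using t(1,3) t0 at0 \<omega>3 by (simp add: char_mult[OF ch] T_mult mult.assoc)
      ultimately show "?f t \<in> P" by (simp add: P_def)
      show "?f t = t \<longleftrightarrow> t = ?t0"
      proof
        assume "?f t = t"
        then have "(?t0 ** ?t0 ** t) ** t = mat 1 ** t" by (simp add: matrix_mul_assoc)
        then have "?t0 ** ?t0 ** t = mat 1" by (rule T_cancel[OF t(1)])
        then have "?t0 ** (?t0 ** ?t0 ** t) = ?t0" by simp
        then show "t = ?t0" using t03 by (simp add: matrix_mul_assoc)
      next
        assume "t = ?t0"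
        then show "?f t = t" using matrix_cube[OF t03] by (simp add: matrix_mul_assoc[symmetric])
      qed
    qed
  qed
  with sign_involution[OF fin inv move stay]
  show "permutation (torsion_refl i)" "sign (torsion_refl i) = - 1" by auto
qed

definition torsion_act :: "'i list \<Rightarrow> complex^'n^'n \<Rightarrow> complex^'n^'n" where
  "torsion_act is = foldr (\<lambda>i p. torsion_refl i \<circ> p) is id"

lemma torsion_act_simps:
  "torsion_act [] = id" "torsion_act (i # is) = torsion_refl i \<circ> torsion_act is"
  by (simp_all add: torsion_act_def)

lemma sign_torsion_act:
  assumes "is \<in> lists (idx D)"
  shows "permutation (torsion_act is) \<and> sign (torsion_act is) = (- 1) ^ length is"
  using assms
proof (induction "is" rule: list.induct)
  case (Cons i "is")
  then have "permutation (torsion_refl i)" "permutation (torsion_act is)"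
    "sign (torsion_refl i) * sign (torsion_act is) = (- 1) ^ length (i # is)"
    using sign_torsion_refl[of i] by simp_all
  then show ?case
    unfolding torsion_act_simps by (metis permutation_compose sign_compose)
qed (simp add: torsion_act_simps sign_id)

lemma torsion_act_eq:
  assumes "is \<in> lists (idx D)"
  shows "torsion_act is t = (if t \<in> T \<and> t ** t ** t = mat 1 then foldr sref is t else t)"
proof -
  have "torsion_act is t = (if t \<in> T \<and> t ** t ** t = mat 1 then foldr sref is t else t) \<and>
    (t \<in> T \<and> t ** t ** t = mat 1 \<longrightarrow>
      foldr sref is t \<in> T \<and> foldr sref is t ** foldr sref is t ** foldr sref is t = mat 1)"
    using assms
  proof (induction "is" rule: list.induct)
    case (Cons i "is")
    then show ?case using cube_sref[of i "foldr sref is t"] sref_T[of i]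
      by (auto simp: torsion_refl_def torsion_act_simps)
  qed (simp add: torsion_act_simps)
  then show ?thesis by simp
qed

text \<open>The permutation of the 3-torsion depends only on the Weyl group element, its sign only
  on the length of the word. The sign plays the role of the determinant of the reflection
  representation.\<close>

lemma word_parity:
  assumes "is \<in> lists (idx D)" "js \<in> lists (idx D)" "word_prod D is = word_prod D js"
  shows "even (length is) \<longleftrightarrow> even (length js)"
proof -
  have "torsion_act is = torsion_act js"
    using word_prod_eq_imp_action_eq[OF assms] by (auto simp: fun_eq_iff torsion_act_eq assms(1,2))
  then have "(- 1 :: int) ^ length is = (- 1) ^ length js"
    using sign_torsion_act[OF assms(1)] sign_torsion_act[OF assms(2)] by simp
  then show ?thesis by (cases "even (length is)"; cases "even (length js)") simp_all
qed

section \<open>Reduced words and lengths\<close>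

lemma word_exists:
  assumes "w \<in> carrier W" shows "\<exists>is\<in>lists (idx D). word_prod D is = w"
proof -
  have "w \<in> generate W (srefl D ` idx D)"
    using assms split_reductive by (simp add: split_reductive_def)
  then show ?thesis
  proof induction
    case one
    show ?case by (rule bexI[of _ "[]"]) (simp_all add: word_prod_Nil)
  next
    case (incl h)
    then obtain i where i: "i \<in> idx D" "h = srefl D i" by auto
    have "word_prod D [i] = h"
      using i srefl_W group.is_monoid[OF group_W] by (simp add: word_prod_Cons word_prod_Nil monoid.r_one)
    then show ?case using i by (intro bexI[of _ "[i]"]) auto
  next
    case (inv h)
    then obtain i where i: "i \<in> idx D" "h = srefl D i" by auto
    have "inv\<^bsub>W\<^esub> h = h"
      using group.inv_equality[OF group_W srefl_involution[OF i(1)]] srefl_W[OF i(1)] i(2) by simp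
    then have "word_prod D [i] = inv\<^bsub>W\<^esub> h"
      using i srefl_W group.is_monoid[OF group_W] by (simp add: word_prod_Cons word_prod_Nil monoid.r_one)
    then show ?case using i by (intro bexI[of _ "[i]"]) auto
  next
    case (eng h1 h2)
    then obtain u v where "u \<in> lists (idx D)" "word_prod D u = h1" "v \<in> lists (idx D)" "word_prod D v = h2"
      by auto
    then show ?case using word_prod_append[of u v] by (intro bexI[of _ "u @ v"]) auto
  qed
qed

lemma reduced_word_exists:
  assumes "w \<in> carrier W" shows "reduced_words D w \<noteq> {}"
proof -
  obtain js where "js \<in> lists (idx D)" "word_prod D js = w" using word_exists[OF assms] by blast
  then have "\<exists>l. \<exists>is\<in>lists (idx D). word_prod D is = w \<and> length is = l" by blast
  from LeastI_ex[OF this] show ?thesis by (auto simp: reduced_words_def weyl_length_def)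
qed

lemma weyl_length_le:
  "is \<in> lists (idx D) \<Longrightarrow> word_prod D is = w \<Longrightarrow> weyl_length D w \<le> length is"
  unfolding weyl_length_def by (rule Least_le) blast

lemma reduced_words_one: "reduced_words D \<one>\<^bsub>W\<^esub> = {[]}"
  using weyl_length_le[of "[]" "\<one>\<^bsub>W\<^esub>"] by (auto simp: reduced_words_def word_prod_Nil)

lemma srefl_cancel:
  assumes "i \<in> idx D" "w \<in> carrier W" shows "srefl D i \<otimes>\<^bsub>W\<^esub> (srefl D i \<otimes>\<^bsub>W\<^esub> w) = w"
  using srefl_W[OF assms(1)] assms(2) srefl_involution[OF assms(1)] group.is_monoid[OF group_W]
  by (simp add: monoid.m_assoc[symmetric] monoid.l_one)

text \<open>Prefixing the letter i in either direction bounds the difference of the lengths by one,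
  and parity excludes equality.\<close>

lemma weyl_length_srefl:
  assumes "i \<in> idx D" "w \<in> carrier W"
  shows "weyl_length D (srefl D i \<otimes>\<^bsub>W\<^esub> w) = Suc (weyl_length D w) \<or>
    weyl_length D w = Suc (weyl_length D (srefl D i \<otimes>\<^bsub>W\<^esub> w))"
proof -
  let ?v = "srefl D i \<otimes>\<^bsub>W\<^esub> w"
  have v: "?v \<in> carrier W"
    using assms srefl_W group.is_monoid[OF group_W] by (simp add: monoid.m_closed)
  obtain r where r: "r \<in> lists (idx D)" "word_prod D r = w" "length r = weyl_length D w"
    using reduced_word_exists[OF assms(2)] by (auto simp: reduced_words_def)
  obtain r' where r': "r' \<in> lists (idx D)" "word_prod D r' = ?v" "length r' = weyl_length D ?v"
    using reduced_word_exists[OF v] by (auto simp: reduced_words_def)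
  have ir: "i # r \<in> lists (idx D)" "word_prod D (i # r) = ?v"
    using r assms(1) by (simp_all add: word_prod_Cons)
  have ir': "i # r' \<in> lists (idx D)" "word_prod D (i # r') = w"
    using r' assms by (simp_all add: word_prod_Cons srefl_cancel)
  have "even (length (i # r)) \<longleftrightarrow> even (length r')"
    by (rule word_parity[OF ir(1) r'(1)]) (use ir r' in simp)
  moreover have "length r' \<le> Suc (length r)" "length r \<le> Suc (length r')"
    using weyl_length_le[OF ir] weyl_length_le[OF ir'] r r' by auto
  ultimately have "length r' = Suc (length r) \<or> length r = Suc (length r')"
    by (cases "length r' = length r") (auto simp: le_Suc_eq)
  then show ?thesis using r(3) r'(3) by simp
qed

lemma reduced_words_Cons:
  assumes "i \<in> idx D" "is \<in> reduced_words D w"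
    "weyl_length D (srefl D i \<otimes>\<^bsub>W\<^esub> w) = Suc (weyl_length D w)"
  shows "i # is \<in> reduced_words D (srefl D i \<otimes>\<^bsub>W\<^esub> w)"
  using assms by (auto simp: reduced_words_def word_prod_Cons)

end


section \<open>The birational Weyl group action\<close>

lemma regular_map_bind:
  assumes X: "prevar X" and Y: "prevar Y" and Z: "prevar Z"
    and f: "regular_map X Y f" and g: "regular_map Y Z g"
  shows "regular_map X Z (\<lambda>x. Option.bind (f x) g)"
  unfolding regular_map_iff[OF X Z]
proof (intro conjI ballI)
  let ?h = "\<lambda>x. Option.bind (f x) g"
  have dom: "x \<in> dom ?h \<longleftrightarrow> x \<in> dom f \<and> the (f x) \<in> dom g" for x
    by (cases "f x") (auto simp: domIff)
  show "dom ?h \<subseteq> pts X" using dom f by (auto simp: regular_map_def)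
  fix x assume "x \<in> dom ?h"
  then have x: "x \<in> dom f" "the (f x) \<in> dom g" using dom by auto
  note mf = regular_mapD[OF X Y f x(1)] and mg = regular_mapD[OF Y Z g x(2)]
  have ev: "eventually (\<lambda>u. u \<in> dom f \<and> the (f u) \<in> dom g) (near X x)"
    by (intro eventually_conj mf(2) morph_at_eventually[OF X Y mf(3) mg(2)])
  then show "eventually (\<lambda>u. u \<in> dom ?h) (near X x)" by eventually_elim (use dom in blast)
  show "morph_at X Z x (\<lambda>u. the (?h u))"
  proof (rule morph_at_cong[OF X Z morph_at_comp[OF X Y Z mf(3) mg(3)]])
    show "eventually (\<lambda>u. the (?h u) = the (g (the (f u)))) (near X x)"
      using ev by eventually_elim auto
  qed
qed

lemma reg_at_sum:
  assumes "prevar X" "x \<in> pts X" "\<And>i. i \<in> I \<Longrightarrow> reg_at X x (f i)"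
  shows "reg_at X x (\<lambda>y. \<Sum>i\<in>I. f i y)"
  using assms(3)
proof (induction I rule: infinite_finite_induct)
  case (insert i I)
  then show ?case using reg_at_add[OF assms(1)] by simp
qed (simp_all add: reg_at_const[OF assms(1,2)])

text \<open>The remaining coordinate 1 / det comes for free: det is a polynomial in the entries and
  does not vanish on \<open>GL\<close>.\<close>

lemma morph_at_mat_variety:
  fixes \<phi> :: "'a \<Rightarrow> complex^'n^'n"
  assumes X: "prevar X" "x \<in> pts X" and H: "H \<subseteq> GL" "eventually (\<lambda>y. \<phi> y \<in> H) (near X x)"
    and reg: "\<And>i j. reg_at X x (\<lambda>y. \<phi> y $ i $ j)"
  shows "morph_at X (mat_variety H) x \<phi>"
proof (rule morph_atI[OF X _ H(2)])
  show "(H, coords) \<in> atlas (mat_variety H)" by simp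
  fix g :: "complex^'n^'n \<Rightarrow> complex" assume "g \<in> coords"
  then consider "g = (\<lambda>A. inverse (det A))" | "g \<in> entries" by (auto simp: coords_def)
  then show "reg_at X x (\<lambda>y. g (\<phi> y))"
  proof cases
    case 1
    have "(\<lambda>A. det A) \<in> polyfun \<rat> (entries :: (complex^'n^'n \<Rightarrow> complex) set)"
      by (rule polyfun_det) (auto intro: polyfun.gen entriesI simp: Ints_def)
    then have "reg_at X x (\<lambda>y. det (\<phi> y))"
      by (rule reg_at_polyfun_comp[OF X]) (auto simp: entries_def reg)
    moreover have "det (\<phi> x) \<noteq> 0"
      using eventually_near_imp[OF X H(2)] H(1) by (auto simp: GL_def invertible_det_nz)
    ultimately show ?thesis unfolding 1 by (rule reg_at_inverse[OF X(1)])
  qed (auto simp: entries_def reg)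
qed

locale crystal_datum = reductive_group D
  for D :: "('n::finite, 'i) reductive_datum" +
  fixes X :: "('x, 'm) var_scheme" and \<gamma> :: "'x \<rightharpoonup> complex^'n^'n" and e :: "'i \<Rightarrow> complex \<times> 'x \<rightharpoonup> 'x"
  assumes crystal: "geometric_crystal D X \<gamma> e"
begin

abbreviation TV where "TV \<equiv> mat_variety T"
abbreviation \<gamma>' where "\<gamma>' x \<equiv> the (\<gamma> x)"

lemma var: "variety X" and irred: "irreducible_var X" and rat_\<gamma>: "rational_map X TV \<gamma>"
  and unital: "i \<in> idx D \<Longrightarrow> unital_rational_action Gm X (e i)"
  and equivariant: "i \<in> idx D \<Longrightarrow> rat_equiv (Gm \<times>\<^sub>v X)
          (\<lambda>(c, x). Option.bind (e i (c, x)) \<gamma>)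
          (\<lambda>(c, x). map_option (\<lambda>t. scoroot D i c ** t) (\<gamma> x))"
  using crystal by (auto simp: geometric_crystal_def geometric_precrystal_def)

lemma prevars: "prevar X" "prevar TV" "prevar (Gm \<times>\<^sub>v X)" "prevar (TV \<times>\<^sub>v X)"
  using variety_prevar[OF var] by (simp_all add: prevar_prod prevar_Gm prevar_mat_variety)

lemma irred_TX: "irreducible_var (TV \<times>\<^sub>v X)"
  by (rule irreducible_prod[OF rational_var_T prevars(1) irred])

lemma reg_\<gamma>: "regular_map X TV \<gamma>"
  using rat_\<gamma> by (simp add: rational_map_def)

lemmas \<gamma>D = regular_mapD[OF prevars(1,2) reg_\<gamma>]

lemma \<gamma>_T: "x \<in> dom \<gamma> \<Longrightarrow> \<gamma>' x \<in> T"
  using \<gamma>D(4) by simp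

lemma \<gamma>_generic: "eventually (\<lambda>x. x \<in> dom \<gamma>) (generic X)"
  by (rule rational_map_generic_dom[OF prevars(1,2) rat_\<gamma>])

lemma Gm_action: "i \<in> idx D \<Longrightarrow> Gm_action X (e i)"
  by unfold_locales (use var irred unital in auto)

lemma morph_at_coroot_mult:
  assumes i: "i \<in> idx D" and Y: "prevar Y" and c: "morph_at Y Gm y c" and s: "morph_at Y TV y s"
  shows "morph_at Y TV y (\<lambda>y. scoroot D i (c y) ** s y)"
proof (rule morph_at_mat_variety[OF Y morph_at_source[OF c]])
  have c0: "eventually (\<lambda>z. c z \<noteq> 0) (near Y y)" and cr: "reg_at Y y c" "c y \<noteq> 0"
    using c reg_at_nonzero[OF Y] by (simp_all add: morph_at_Gm_iff[OF Y])
  have sT: "eventually (\<lambda>z. s z \<in> T) (near Y y)"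
    and sr: "\<And>f. f \<in> coords \<Longrightarrow> reg_at Y y (\<lambda>z. f (s z))"
    using morph_at_chart[OF Y prevars(2) s, of T coords] morph_at_target[OF prevars(2) s] by auto
  show "T \<subseteq> GL" using T_GL by auto
  show "eventually (\<lambda>z. scoroot D i (c z) ** s z \<in> T) (near Y y)"
    using c0 sT by eventually_elim (use coroot_T[OF i] T_mult in auto)
  have l: "reg_at Y y (\<lambda>z. scoroot D i (c z) $ j $ k)" for j k
  proof -
    have "\<forall>f\<in>entries. \<exists>p\<in>polyfun \<rat> {\<lambda>z. z, inverse}. \<forall>c. c \<noteq> 0 \<longrightarrow> f (scoroot D i c) = p c"
      using coroot[OF i] by (simp add: is_coroot_def cocharacters_def)
    from bspec[OF this entriesI[of j k]]
    obtain p where p: "p \<in> polyfun \<rat> {\<lambda>z. z, inverse}" "\<forall>c. c \<noteq> 0 \<longrightarrow> scoroot D i c $ j $ k = p c"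
      by (elim bexE)
    have "reg_at Y y (\<lambda>z. p (c z))"
      by (rule reg_at_polyfun_comp[OF Y morph_at_source[OF c] p(1)])
         (use cr reg_at_inverse[OF Y cr] in auto)
    moreover have "eventually (\<lambda>z. scoroot D i (c z) $ j $ k = p (c z)) (near Y y)"
      using c0 by eventually_elim (use p(2) in simp)
    ultimately show ?thesis by (rule reg_at_cong[OF Y])
  qed
  have sjk: "reg_at Y y (\<lambda>z. s z $ j $ k)" for j k
    by (rule sr) (unfold coords_def, rule insertI2[OF entriesI])
  show "reg_at Y y (\<lambda>z. (scoroot D i (c z) ** s z) $ j $ k)" for j k
    unfolding matrix_matrix_mult_def
    by (simp, intro reg_at_sum[OF Y morph_at_source[OF c]] reg_at_mult[OF Y] l sjk)
qed

text \<open>Equivariance is given on a dense open subset of Gm x X, but it is needed at parameters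
  depending on x, which may lie off that subset. Both sides are morphisms to the separated T, so it
  holds wherever both are defined.\<close>

lemma \<gamma>_act:
  assumes i: "i \<in> idx D" and x: "(c, x) \<in> dom (e i)" "x \<in> dom \<gamma>" "the (e i (c, x)) \<in> dom \<gamma>"
  shows "\<gamma>' (the (e i (c, x))) = scoroot D i c ** \<gamma>' x"
proof -
  interpret A: Gm_action X "e i" by (rule Gm_action[OF i])
  have z: "(c, x) \<in> pts (Gm \<times>\<^sub>v X)" using A.regD(1)[OF x(1)] .
  have 1: "morph_at (Gm \<times>\<^sub>v X) TV (c, x) (\<lambda>z. \<gamma>' (the (e i z)))"
    by (rule morph_at_comp[OF prevars(3,1,2) A.regD(3)[OF x(1)] \<gamma>D(3)[OF x(3)]])
  have "morph_at (Gm \<times>\<^sub>v X) TV (c, x) (\<lambda>z. \<gamma>' (snd z))"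
    by (rule morph_at_comp[OF prevars(3,1,2) morph_at_snd[OF prevar_Gm prevars(1) z]])
       (use \<gamma>D(3)[OF x(2)] in simp)
  from morph_at_coroot_mult[OF i prevars(3) morph_at_fst[OF prevar_Gm prevars(1) z] this]
  have 2: "morph_at (Gm \<times>\<^sub>v X) TV (c, x) (\<lambda>z. scoroot D i (fst z) ** \<gamma>' (snd z))" .
  have "eventually (\<lambda>z. \<gamma>' (the (e i z)) = scoroot D i (fst z) ** \<gamma>' (snd z)) (generic (Gm \<times>\<^sub>v X))"
    using equivariant[OF i] unfolding rat_equiv_iff[OF prevars(3)]
    by eventually_elim (auto simp: bind_eq_Some_conv)
  from morph_at_agree[OF prevars(3,2) separated_mat_variety 1 2 this] show ?thesis by simp
qed

lemma scaled:
  assumes i: "i \<in> idx D"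
  shows "Gm_action_scaled X (e i) (dom \<gamma>) (\<lambda>x. sroot D i (\<gamma>' x))"
proof -
  interpret A: Gm_action X "e i" by (rule Gm_action[OF i])
  show ?thesis
  proof unfold_locales
    show "zariski_open X (dom \<gamma>)" by (rule regular_map_dom_open[OF prevars(1,2) reg_\<gamma>])
    show "dom \<gamma> \<noteq> {}"
      using generic_ex[OF prevars(1) _ \<gamma>_generic] irred by (auto simp: irreducible_var_def)
    fix x assume x: "x \<in> dom \<gamma>"
    show "reg_at X x (\<lambda>x. sroot D i (\<gamma>' x))"
      by (rule reg_at_comp[OF prevars(1,2) \<gamma>D(3)[OF x] char_regular[OF root_char[OF i] \<gamma>_T[OF x]]])
    show "sroot D i (\<gamma>' x) \<noteq> 0" by (rule char_nz[OF root_char[OF i] \<gamma>_T[OF x]])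
    fix c assume c: "(c, x) \<in> dom (e i)" "the (e i (c, x)) \<in> dom \<gamma>"
    then have "c \<noteq> 0" using A.dom_pts by blast
    then show "sroot D i (\<gamma>' (the (e i (c, x)))) = c\<^sup>2 * sroot D i (\<gamma>' x)"
      using \<gamma>_act[OF i c(1) x c(2)] coroot_T[OF i] \<gamma>_T[OF x] root_coroot[OF i]
      by (simp add: char_mult[OF root_char[OF i]])
  qed
qed

section \<open>Birational simple reflections and their composites\<close>

definition sigma :: "'i \<Rightarrow> 'x \<rightharpoonup> 'x" where
  "sigma i = Gm_action_scaled.crystal_refl (e i) (dom \<gamma>) (\<lambda>x. sroot D i (\<gamma>' x))"

lemma sigma_eq: "i \<in> idx D \<Longrightarrow> x \<in> dom \<gamma> \<Longrightarrow> sigma i x = e i (inverse (sroot D i (\<gamma>' x)), x)"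
  unfolding sigma_def by (rule Gm_action_scaled.refl_eq[OF scaled])

lemma sigma_regular: "i \<in> idx D \<Longrightarrow> regular_map X X (sigma i)"
  unfolding sigma_def by (rule Gm_action_scaled.refl_regular[OF scaled])

lemma sigma_pullback:
  "i \<in> idx D \<Longrightarrow> eventually P (generic X) \<Longrightarrow>
    eventually (\<lambda>x. x \<in> dom (sigma i) \<and> P (the (sigma i x))) (generic X)"
  unfolding sigma_def by (rule Gm_action_scaled.generic_pullback_refl[OF scaled])

lemma sigma_involution:
  "i \<in> idx D \<Longrightarrow> eventually (\<lambda>x. x \<in> dom (sigma i) \<and> the (sigma i x) \<in> dom (sigma i) \<and>
    sigma i (the (sigma i x)) = Some x) (generic X)"
  unfolding sigma_def by (rule Gm_action_scaled.refl_involution[OF scaled])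

lemma sigma_\<gamma>:
  assumes i: "i \<in> idx D" and x: "x \<in> dom \<gamma>" "x \<in> dom (sigma i)" "the (sigma i x) \<in> dom \<gamma>"
  shows "\<gamma>' (the (sigma i x)) = sref i (\<gamma>' x)"
proof -
  have nz: "inverse (sroot D i (\<gamma>' x)) \<noteq> 0" using char_nz[OF root_char[OF i] \<gamma>_T[OF x(1)]] by simp
  have "(inverse (sroot D i (\<gamma>' x)), x) \<in> dom (e i)" using x sigma_eq[OF i x(1)] by (auto simp: domIff)
  then have "\<gamma>' (the (sigma i x)) = scoroot D i (inverse (sroot D i (\<gamma>' x))) ** \<gamma>' x"
    using \<gamma>_act[OF i _ x(1)] x(3) sigma_eq[OF i x(1)] by simp
  then show ?thesis
    unfolding sref_def using T_comm[OF coroot_T[OF i nz] \<gamma>_T[OF x(1)]] by simp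
qed

text \<open>The literal composite, without \<open>rat_ext\<close>, so that its values can be
  computed letter by letter.\<close>

primrec sigma_word :: "'i list \<Rightarrow> 'x \<rightharpoonup> 'x" where
  "sigma_word [] = (\<lambda>x. if x \<in> pts X then Some x else None)"
| "sigma_word (i # is) = (\<lambda>x. Option.bind (sigma_word is x) (sigma i))"

lemma sigma_word_regular: "is \<in> lists (idx D) \<Longrightarrow> regular_map X X (sigma_word is)"
proof (induction "is")
  case Nil
  show ?case
    unfolding regular_map_iff[OF prevars(1,1)]
  proof (intro conjI ballI)
    fix x assume "x \<in> dom (sigma_word [])"
    then have x: "x \<in> pts X" by (simp add: domIff split: if_splits)
    show "eventually (\<lambda>y. y \<in> dom (sigma_word [])) (near X x)"
      using eventually_near_pts[OF prevars(1) x] by eventually_elim auto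
    show "morph_at X X x (\<lambda>y. the (sigma_word [] y))"
      by (rule morph_at_cong[OF prevars(1,1) morph_at_id[OF prevars(1) x]],
          rule eventually_mono[OF eventually_near_pts[OF prevars(1) x]]) simp
  qed (auto split: if_splits)
next
  case (Cons i "is")
  then show ?case using regular_map_bind[OF prevars(1,1,1) _ sigma_regular[of i]] by simp
qed

lemma sigma_word_pullback:
  "is \<in> lists (idx D) \<Longrightarrow> eventually P (generic X) \<Longrightarrow>
    eventually (\<lambda>x. x \<in> dom (sigma_word is) \<and> P (the (sigma_word is x))) (generic X)"
proof (induction "is" arbitrary: P)
  case Nil
  then show ?case
    using eventually_generic_pts[OF prevars(1)] by (auto elim: eventually_elim2)
next
  case (Cons i "is")
  then have "eventually (\<lambda>x. x \<in> dom (sigma_word is) \<and>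
    (the (sigma_word is x) \<in> dom (sigma i) \<and> P (the (sigma i (the (sigma_word is x)))))) (generic X)"
    using sigma_pullback[of i P] by simp
  then show ?case by eventually_elim auto
qed

lemma sigma_word_\<gamma>:
  "is \<in> lists (idx D) \<Longrightarrow> eventually (\<lambda>x. x \<in> dom \<gamma> \<and> x \<in> dom (sigma_word is) \<and>
    the (sigma_word is x) \<in> dom \<gamma> \<and> \<gamma>' (the (sigma_word is x)) = foldr sref is (\<gamma>' x)) (generic X)"
proof (induction "is")
  case Nil
  show ?case
    using \<gamma>_generic eventually_generic_pts[OF prevars(1)] by eventually_elim auto
next
  case (Cons i "is")
  then have i: "i \<in> idx D" and js: "is \<in> lists (idx D)" by auto
  from sigma_word_pullback[OF js sigma_pullback[OF i \<gamma>_generic]] Cons.IH[OF js]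
  show ?case
  proof eventually_elim
    case (elim x)
    then show ?case using sigma_\<gamma>[OF i, of "the (sigma_word is x)"] by auto
  qed
qed

section \<open>The maps \<open>e_word\<close> on the graph of the inverse of \<gamma>\<close>

lemma sref_one: "i \<in> idx D \<Longrightarrow> sref i (mat 1) = mat 1"
  by (simp add: sref_def char_one[OF root_char] coroot_one)

text \<open>On T, \<open>sref i\<close> is conjugation by a representative of the reflection, hence
  a homomorphism.\<close>

lemma sref_matrix_inv:
  assumes "i \<in> idx D" "t \<in> T" shows "sref i (matrix_inv t) = matrix_inv (sref i t)"
proof -
  have hom: "sref i s ** sref i u = sref i (s ** u)" if "s \<in> T" "u \<in> T" for s u
  proof -
    obtain n where n: "n \<in> srefl D i" using W_nonempty[OF srefl_W[OF assms(1)]] by blast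
    then have GL: "n \<in> GL" by (rule W_GL[OF srefl_W[OF assms(1)]])
    have "n ** s ** matrix_inv n ** (n ** u ** matrix_inv n) =
      n ** s ** (matrix_inv n ** n) ** u ** matrix_inv n" by (simp add: matrix_mul_assoc)
    also have "\<dots> = n ** (s ** u) ** matrix_inv n"
      by (simp add: matrix_inv_GL(3)[OF GL] matrix_mul_assoc)
    finally show ?thesis using srefl_conj[OF assms(1) n] that T_mult by simp
  qed
  have "sref i t ** sref i (matrix_inv t) = mat 1" "sref i (matrix_inv t) ** sref i t = mat 1"
    using hom T_inv[OF assms(2)] assms by (simp_all add: T_inv_simps sref_one)
  then show ?thesis by (metis matrix_inv_unique)
qed

lemma foldr_sref_matrix_inv:
  "is \<in> lists (idx D) \<Longrightarrow> t \<in> T \<Longrightarrow> foldr sref is (matrix_inv t) = matrix_inv (foldr sref is t)"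
  by (induction "is") (auto simp: sref_matrix_inv foldr_sref_T)

lemma foldr_sref_one: "is \<in> lists (idx D) \<Longrightarrow> foldr sref is (mat 1) = mat 1"
  by (induction "is") (auto simp: sref_one)

lemma eventually_near_T: "t \<in> T \<Longrightarrow> eventually (\<lambda>s. s \<in> T) (near TV t)"
  using eventually_near_pts[OF prevars(2)] by simp

lemma morph_at_sref:
  assumes i: "i \<in> idx D" and t: "t \<in> T" shows "morph_at TV TV t (sref i)"
proof (rule morph_at_cong[OF prevars(2,2)])
  have "morph_at TV Gm t (\<lambda>s. inverse (sroot D i s))"
    using reg_at_inverse[OF prevars(2) char_regular[OF root_char[OF i] t]] char_nz[OF root_char[OF i] t]
    by (simp add: morph_at_Gm_iff[OF prevars(2)])
  then show "morph_at TV TV t (\<lambda>s. scoroot D i (inverse (sroot D i s)) ** s)"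
    using t by (intro morph_at_coroot_mult[OF i prevars(2)] morph_at_id[OF prevars(2)]) simp_all
  show "eventually (\<lambda>s. sref i s = scoroot D i (inverse (sroot D i s)) ** s) (near TV t)"
    using eventually_near_T[OF t]
  proof eventually_elim
    case (elim s)
    then have "inverse (sroot D i s) \<noteq> 0" using char_nz[OF root_char[OF i]] by simp
    then show ?case using T_comm[OF elim coroot_T[OF i]] by (simp add: sref_def)
  qed
qed

lemma morph_at_foldr_sref:
  "is \<in> lists (idx D) \<Longrightarrow> t \<in> T \<Longrightarrow> morph_at TV TV t (foldr sref is)"
proof (induction "is")
  case Nil
  then show ?case using morph_at_id[OF prevars(2), of t] by (simp add: id_def)
next
  case (Cons i "is")
  then have i: "i \<in> idx D" and t: "foldr sref is t \<in> T" and IH: "morph_at TV TV t (foldr sref is)"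
    by (simp_all add: foldr_sref_T)
  have "morph_at TV TV t (\<lambda>s. sref i (foldr sref is s))"
    by (rule morph_at_comp[OF prevars(2,2,2) IH morph_at_sref[OF i t]])
  then show ?case by (simp add: comp_def)
qed

text \<open>The character \<alpha>^(k) of a letter \<open>i\<close> when \<open>is\<close> is the
  part of the word to its right.\<close>

abbreviation char_word where
  "char_word i is \<equiv> fold (\<lambda>j. weyl_char (srefl D j)) is (sroot D i)"

lemma char_word_morph:
  assumes "i \<in> idx D" "is \<in> lists (idx D)" "t \<in> T" shows "morph_at TV Gm t (char_word i is)"
proof (rule morph_at_cong[OF prevars(2) prevar_Gm])
  have "reg_at TV t (\<lambda>s. sroot D i (foldr sref is s))"
    using assms by (intro reg_at_comp[OF prevars(2,2) morph_at_foldr_sref] char_regular root_char foldr_sref_T)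
  then show "morph_at TV Gm t (\<lambda>s. sroot D i (foldr sref is s))"
    using char_nz[OF root_char[OF assms(1)] foldr_sref_T[OF assms(2,3)]]
    by (simp add: morph_at_Gm_iff[OF prevars(2)])
  show "eventually (\<lambda>s. char_word i is s = sroot D i (foldr sref is s)) (near TV t)"
    using eventually_near_T[OF assms(3)] by eventually_elim (simp add: fold_weyl_char assms(2))
qed

text \<open>At t = 1 every character is 1 and e i (1, y) = y, so the literal composite
  \<open>f\<close> is defined there; its domain is therefore dense in the irreducible T x X and
  \<open>rat_ext\<close> is meaningful. The inclusion of \<open>f\<close> in its extension is
  recorded because the later evaluation takes place on the graph of \<gamma>^-1, out of reach of
  generic statements on T x X.\<close>

lemma e_word_step:
  assumes i: "i \<in> idx D" and js: "is \<in> lists (idx D)"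
    and IH: "regular_map (TV \<times>\<^sub>v X) X (e_word D X e is)"
      "\<forall>x\<in>pts X. e_word D X e is (mat 1, x) = Some x"
  defines "f \<equiv> (\<lambda>(t, x). Option.bind (e_word D X e is (t, x)) (\<lambda>y. e i (char_word i is t, y)))"
  shows "regular_map (TV \<times>\<^sub>v X) X (e_word D X e (i # is))" "f \<subseteq>\<^sub>m e_word D X e (i # is)"
    "\<forall>x\<in>pts X. e_word D X e (i # is) (mat 1, x) = Some x"
proof -
  interpret A: Gm_action X "e i" by (rule Gm_action[OF i])
  \<comment> \<open>The parameter of the next letter paired with the partial result, so that
    \<open>f\<close> is \<open>h\<close> followed by \<open>e i\<close>.\<close>
  define h where "h z = map_option (\<lambda>y. (char_word i is (fst z), y)) (e_word D X e is z)" for z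
  have dom_h: "dom h = dom (e_word D X e is)" by (auto simp: h_def)
  have "regular_map (TV \<times>\<^sub>v X) (Gm \<times>\<^sub>v X) h"
    unfolding regular_map_iff[OF prevars(4,3)] dom_h
  proof (intro conjI ballI)
    show "dom (e_word D X e is) \<subseteq> pts (TV \<times>\<^sub>v X)" using IH(1) by (simp add: regular_map_def)
    fix z assume z: "z \<in> dom (e_word D X e is)"
    note m = regular_mapD[OF prevars(4,1) IH(1) z]
    show "eventually (\<lambda>y. y \<in> dom (e_word D X e is)) (near (TV \<times>\<^sub>v X) z)" by (rule m(2))
    have "fst z \<in> T" using m(1) by auto
    then have "morph_at (TV \<times>\<^sub>v X) Gm z (\<lambda>z. char_word i is (fst z))"
      using m(1)
      by (intro morph_at_comp[OF prevars(4,2) prevar_Gm morph_at_fst[OF prevars(2,1)]] char_word_morph i js)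
    from morph_at_Pair[OF prevars(4) this m(3)]
    show "morph_at (TV \<times>\<^sub>v X) (Gm \<times>\<^sub>v X) z (\<lambda>y. the (h y))"
    proof (rule morph_at_cong[OF prevars(4,3)])
      show "eventually (\<lambda>y. the (h y) = (char_word i is (fst y), the (e_word D X e is y)))
        (near (TV \<times>\<^sub>v X) z)" using m(2) by eventually_elim (auto simp: h_def)
    qed
  qed
  from regular_map_bind[OF prevars(4,3,1) this A.reg]
  have "regular_map (TV \<times>\<^sub>v X) X (\<lambda>z. Option.bind (h z) (e i))" .
  moreover have "f = (\<lambda>z. Option.bind (h z) (e i))"
    by (auto simp: f_def h_def fun_eq_iff bind_map_option comp_def)
  ultimately have f: "regular_map (TV \<times>\<^sub>v X) X f" by simp
  have f1: "f (mat 1, x) = Some x" if "x \<in> pts X" for x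
    using IH(2) that A.one_act
    by (simp add: f_def fold_weyl_char[OF js T_one] foldr_sref_one[OF js] char_one[OF root_char[OF i]])
  obtain x where x: "x \<in> pts X" using irred by (auto simp: irreducible_var_def)
  then have "(mat 1, x) \<in> dom f" using f1 by auto
  then have "eventually (\<lambda>z. z \<in> dom f) (generic (TV \<times>\<^sub>v X))"
    using regular_mapD[OF prevars(4,1) f] by (intro generic_of_near[OF prevars(4) irred_TX])
  then have "rat_equiv (TV \<times>\<^sub>v X) f f" by (simp add: rat_equiv_iff[OF prevars(4)])
  from rat_ext_props[OF prevars(4,1) variety_separated[OF var] f this]
  show "regular_map (TV \<times>\<^sub>v X) X (e_word D X e (i # is))" and le: "f \<subseteq>\<^sub>m e_word D X e (i # is)"
    by (simp_all add: f_def rational_map_def)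
  show "\<forall>x\<in>pts X. e_word D X e (i # is) (mat 1, x) = Some x"
    using f1 le unfolding map_le_def by (metis domI)
qed

lemma e_word_regular:
  "is \<in> lists (idx D) \<Longrightarrow> regular_map (TV \<times>\<^sub>v X) X (e_word D X e is) \<and>
    (\<forall>x\<in>pts X. e_word D X e is (mat 1, x) = Some x)"
proof (induction "is")
  case Nil
  have "regular_map (TV \<times>\<^sub>v X) X (e_word D X e [])"
    unfolding regular_map_iff[OF prevars(4,1)]
  proof (intro conjI ballI)
    fix z assume "z \<in> dom (e_word D X e [])"
    then have z: "z \<in> pts (TV \<times>\<^sub>v X)" by (cases z) (simp add: domIff split: if_splits)
    note near = eventually_near_pts[OF prevars(4) z]
    show "eventually (\<lambda>y. y \<in> dom (e_word D X e [])) (near (TV \<times>\<^sub>v X) z)"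
      using near by eventually_elim auto
    show "morph_at (TV \<times>\<^sub>v X) X z (\<lambda>y. the (e_word D X e [] y))"
      by (rule morph_at_cong[OF prevars(4,1) morph_at_snd[OF prevars(2,1) z]],
          rule eventually_mono[OF near]) auto
  qed (auto split: if_splits)
  then show ?case using T_one by simp
next
  case (Cons i "is")
  then show ?case using e_word_step[of i "is"] by simp
qed

text \<open>Let y be the result of \<open>is\<close> and s the product of its reflections. The
  character of the next letter at \<gamma>(x)^-1 is 1 / \<alpha>(s(\<gamma>(x))), where \<alpha> is
  the root of that letter, and s(\<gamma>(x)) = \<gamma>(y) by \<open>sigma_word_\<gamma>\<close>.
  This is exactly the parameter with which \<open>sigma i\<close> acts at y.\<close>

lemma e_word_eq_sigma_word:
  "is \<in> lists (idx D) \<Longrightarrow> eventually (\<lambda>x. x \<in> dom \<gamma> \<and> x \<in> dom (sigma_word is) \<and>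
    e_word D X e is (matrix_inv (\<gamma>' x), x) = sigma_word is x) (generic X)"
proof (induction "is")
  case Nil
  show ?case
    using \<gamma>_generic eventually_generic_pts[OF prevars(1)]
    by eventually_elim (use \<gamma>_T T_inv in auto)
next
  case (Cons i "is")
  then have i: "i \<in> idx D" and js: "is \<in> lists (idx D)" by auto
  have "eventually (\<lambda>x. x \<in> dom (sigma_word (i # is))) (generic X)"
    using sigma_word_pullback[OF Cons.prems, of "\<lambda>_. True"] by simp
  with Cons.IH[OF js] sigma_word_\<gamma>[OF js]
  show ?case
  proof eventually_elim
    case (elim x)
    define t where "t = \<gamma>' x"
    obtain y where y: "sigma_word is x = Some y" using elim by auto
    have t: "t \<in> T" "\<gamma>' y = foldr sref is t" "y \<in> dom \<gamma>"
      using elim y \<gamma>_T unfolding t_def by auto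
    have "char_word i is (matrix_inv t) = inverse (sroot D i (\<gamma>' y))"
      using t(1) T_inv[OF t(1)] foldr_sref_T[OF js t(1)]
      by (simp add: fold_weyl_char[OF js] foldr_sref_matrix_inv[OF js] char_inv[OF root_char[OF i]] t(2))
    then have f: "Option.bind (e_word D X e is (matrix_inv t, x))
      (\<lambda>y. e i (char_word i is (matrix_inv t), y)) = sigma i y"
      using elim y sigma_eq[OF i t(3)] by (simp add: t_def)
    have s: "sigma_word (i # is) x = sigma i y" "y \<in> dom (sigma i)" using y elim by auto
    have reg: "regular_map (TV \<times>\<^sub>v X) X (e_word D X e is)"
      "\<forall>x\<in>pts X. e_word D X e is (mat 1, x) = Some x" using e_word_regular[OF js] by auto
    have "e_word D X e (i # is) (matrix_inv t, x) = sigma_word (i # is) x"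
      using bspec[OF e_word_step(2)[OF i js reg, unfolded map_le_def], of "(matrix_inv t, x)"] f s
      by (auto simp: domIff)
    then show ?case using elim unfolding t_def by simp
  qed
qed

section \<open>Compatibility of the composites with multiplication in W\<close>

lemma reducedD: "is \<in> reduced_words D w \<Longrightarrow> is \<in> lists (idx D)" "is \<in> reduced_words D w \<Longrightarrow> word_prod D is = w"
  by (simp_all add: reduced_words_def)

text \<open>The crystal condition equates partial functions, not merely their values at generic
  points of T x X, so it may be evaluated at (\<gamma>(x)^-1, x).\<close>

lemma sigma_word_reduced:
  assumes "w \<in> carrier W" "is \<in> reduced_words D w" "js \<in> reduced_words D w"
  shows "eventually (\<lambda>x. x \<in> dom (sigma_word is) \<and> sigma_word is x = sigma_word js x) (generic X)"
proof -
  have eq: "e_word D X e is = e_word D X e js"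
    using crystal assms unfolding geometric_crystal_def by blast
  from e_word_eq_sigma_word[OF reducedD(1)[OF assms(2)]] e_word_eq_sigma_word[OF reducedD(1)[OF assms(3)]]
  show ?thesis by eventually_elim (simp add: eq)
qed

lemma sigma_word_srefl:
  assumes i: "i \<in> idx D" and w: "w \<in> carrier W" and r: "r \<in> reduced_words D w"
    and r': "r' \<in> reduced_words D (srefl D i \<otimes>\<^bsub>W\<^esub> w)"
  shows "eventually (\<lambda>x. x \<in> dom (sigma_word r') \<and> sigma_word (i # r) x = sigma_word r' x) (generic X)"
proof -
  let ?v = "srefl D i \<otimes>\<^bsub>W\<^esub> w"
  have v: "?v \<in> carrier W"
    using w srefl_W[OF i] group.is_monoid[OF group_W] by (simp add: monoid.m_closed)
  from weyl_length_srefl[OF i w] show ?thesis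
  proof
    assume "weyl_length D ?v = Suc (weyl_length D w)"
    then have "i # r \<in> reduced_words D ?v" by (rule reduced_words_Cons[OF i r])
    from sigma_word_reduced[OF v r' this] show ?thesis by eventually_elim simp
  next
    assume "weyl_length D w = Suc (weyl_length D ?v)"
    then have "i # r' \<in> reduced_words D w"
      using reduced_words_Cons[OF i r'] srefl_cancel[OF i w] by simp
    \<comment> \<open>The involution law holds for generic points; pulling it back along the
      dominant \<open>sigma_word r'\<close> makes it available at the image of x.\<close>
    from sigma_word_reduced[OF w this r] sigma_word_pullback[OF reducedD(1)[OF r'] sigma_involution[OF i]]
    show ?thesis
    proof eventually_elim
      case (elim x)
      then obtain y where y: "sigma_word r' x = Some y" by blast
      then obtain z where "sigma i y = Some z" using elim by auto
      then show ?case using elim y by auto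
    qed
  qed
qed

text \<open>The left factor is an arbitrary word, so each induction step multiplies by a single
  simple reflection, and any reduced word of the intermediate product may serve in between.\<close>

lemma sigma_word_mult:
  assumes "is \<in> lists (idx D)" and w: "w \<in> carrier W" and r: "r \<in> reduced_words D w"
    and "r' \<in> reduced_words D (word_prod D is \<otimes>\<^bsub>W\<^esub> w)"
  shows "eventually (\<lambda>x. x \<in> dom (sigma_word r') \<and>
    Option.bind (sigma_word r x) (sigma_word is) = sigma_word r' x) (generic X)"
  using assms(1,4)
proof (induction "is" arbitrary: r' rule: list.induct)
  case Nil
  then have "r' \<in> reduced_words D w"
    using w group.is_monoid[OF group_W] by (simp add: word_prod_Nil monoid.l_one)
  from sigma_word_reduced[OF w r this] show ?case
  proof eventually_elim
    case (elim x)
    then obtain y where "sigma_word r x = Some y" by blast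
    moreover from this have "y \<in> pts X"
      by (rule regular_map_target[OF prevars(1,1) sigma_word_regular[OF reducedD(1)[OF r]]])
    ultimately show ?case using elim by auto
  qed
next
  case (Cons i "is")
  then have i: "i \<in> idx D" and js: "is \<in> lists (idx D)" by auto
  let ?v = "word_prod D is \<otimes>\<^bsub>W\<^esub> w"
  have mon: "monoid W" by (rule group.is_monoid[OF group_W])
  have v: "?v \<in> carrier W" using monoid.m_closed[OF mon word_prod_W[OF js] w] .
  obtain s where s: "s \<in> reduced_words D ?v" using reduced_word_exists[OF v] by blast
  have "word_prod D (i # is) \<otimes>\<^bsub>W\<^esub> w = srefl D i \<otimes>\<^bsub>W\<^esub> ?v"
    using monoid.m_assoc[OF mon srefl_W[OF i] word_prod_W[OF js] w] by (simp add: word_prod_Cons)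
  then have "r' \<in> reduced_words D (srefl D i \<otimes>\<^bsub>W\<^esub> ?v)" using Cons.prems(2) by simp
  from sigma_word_srefl[OF i v s this] Cons.IH[OF js s] show ?case
    by eventually_elim (simp add: bind_assoc[symmetric])
qed

end


section \<open>Products with a constant group\<close>

lemma constant_group_simps [simp]:
  "pts (constant_group W) = carrier W" "gmult (constant_group W) = mult W"
  "gone (constant_group W) = one W" "atlas (constant_group W) = {({w}, {}) | w. w \<in> carrier W}"
  by (simp_all add: constant_group_def)

lemma prevar_constant_group: "prevar (constant_group W)"
  unfolding prevar_def
proof (intro conjI)
  show "\<forall>(U, F)\<in>atlas (constant_group W). \<forall>(V, H)\<in>atlas (constant_group W). \<forall>x\<in>U \<inter> V.
    (\<exists>q\<in>polyfun \<rat> F. q x \<noteq> 0 \<and> {y \<in> U. q y \<noteq> 0} \<subseteq> V) \<and> (\<forall>g\<in>H. chart_reg U F x g)"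
    by (auto intro!: bexI[of _ "\<lambda>_. 1"] polyfun.const)
qed auto

lemma rational_point_constant_group: "w \<in> carrier W \<Longrightarrow> rational_point (constant_group W) w"
  by (auto simp: rational_point_def)

text \<open>Single points of the group are charts, so the slice {w} x X is open in the
  product.\<close>

lemma near_constant_group:
  assumes "prevar X" "w \<in> carrier W" "x \<in> pts X" "eventually (\<lambda>y. P (w, y)) (near X x)"
  shows "eventually P (near (constant_group W \<times>\<^sub>v X) (w, x))"
proof -
  note pv = prevar_prod[OF prevar_constant_group assms(1)]
  have "(w, x) \<in> pts (constant_group W \<times>\<^sub>v X)" using assms by simp
  from morph_at_snd[OF prevar_constant_group assms(1) this]
  have 1: "eventually (\<lambda>z. P (w, snd z)) (near (constant_group W \<times>\<^sub>v X) (w, x))"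
    by (rule morph_at_eventually[OF pv assms(1)]) (use assms(4) in simp)
  obtain U F where U: "(U, F) \<in> atlas X" "x \<in> U" by (rule prevar_cover[OF assms(1,3)])
  have w: "({w}, {}) \<in> atlas (constant_group W)" using assms(2) by auto
  have "eventually (\<lambda>z. z \<in> {w} \<times> U) (near (constant_group W \<times>\<^sub>v X) (w, x))"
    by (rule eventually_near_in_chart[OF pv atlas_prodI[OF w U(1)]]) (use U(2) in simp)
  with 1 show ?thesis by eventually_elim auto
qed

text \<open>The product is in general not irreducible, so one good point is not enough and every
  slice is checked. The interior of the good locus is dense, because any nonempty open set meets
  some slice in a nonempty open set.\<close>

lemma generic_constant_group:
  assumes "prevar X" "\<And>w. w \<in> carrier W \<Longrightarrow> eventually (\<lambda>y. P (w, y)) (generic X)"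
  shows "eventually P (generic (constant_group W \<times>\<^sub>v X))"
proof -
  let ?WX = "constant_group W \<times>\<^sub>v X"
  note pv = prevar_prod[OF prevar_constant_group[of W] assms(1)]
  define V where "V = {z \<in> pts ?WX. eventually P (near ?WX z)}"
  have "zariski_open ?WX V"
  proof (rule zariski_openI)
    fix U F z assume U: "(U, F) \<in> atlas ?WX" "z \<in> U" and "z \<in> V"
    then have "eventually (\<lambda>y. y \<in> V) (near ?WX z)"
      using eventually_near_near[OF pv, of z P] by (simp add: V_def)
    then show "\<exists>q\<in>polyfun \<rat> F. q z \<noteq> 0 \<and> (\<forall>y\<in>U. q y \<noteq> 0 \<longrightarrow> y \<in> V)"
      unfolding eventually_near_chart[OF pv U] .
  qed (auto simp: V_def)
  moreover have "zariski_dense ?WX V"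
    unfolding zariski_dense_def
  proof (intro allI impI)
    fix A assume A: "zariski_open ?WX A \<and> A \<noteq> {}"
    then obtain w x where wx: "(w, x) \<in> A" by fast
    then have wx': "w \<in> carrier W" "x \<in> pts X" using A by (auto simp: zariski_open_def)
    have near: "eventually (\<lambda>y. (w, y) \<in> A) (near X x)"
      by (rule morph_at_eventually[OF assms(1) pv morph_at_slice[OF assms(1) prevar_constant_group wx'(2)
            rational_point_constant_group[OF wx'(1)]] eventually_near_open[OF pv _ wx]])
         (use A in simp)
    obtain y where y: "y \<in> pts X" "eventually (\<lambda>y. P (w, y)) (near X y)" "(w, y) \<in> A"
      using generic_meets_near[OF assms(1) wx'(2)
          eventually_generic_near[OF assms(1) assms(2)[OF wx'(1)]] near] by blast
    then have "(w, y) \<in> V"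
      using near_constant_group[OF assms(1) wx'(1) y(1)] wx'(1) by (simp add: V_def)
    then show "V \<inter> A \<noteq> {}" using y(3) by blast
  qed
  ultimately show ?thesis
    unfolding eventually_generic[OF pv] using eventually_near_imp[OF pv] by (auto simp: V_def)
qed

lemma regular_map_constant_group:
  assumes "prevar X" "prevar Y" "\<And>w. w \<in> carrier W \<Longrightarrow> regular_map X Y (f w)"
  shows "regular_map (constant_group W \<times>\<^sub>v X) Y (\<lambda>(w, x). if w \<in> carrier W then f w x else None)"
    (is "regular_map ?WX Y ?f")
proof -
  note pv = prevar_prod[OF prevar_constant_group[of W] assms(1)]
  have dom: "(w, x) \<in> dom ?f \<longleftrightarrow> w \<in> carrier W \<and> x \<in> dom (f w)" for w x
    by (simp add: domIff)
  show ?thesis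
    unfolding regular_map_iff[OF pv assms(2)]
  proof (intro conjI ballI)
    show "dom ?f \<subseteq> pts ?WX"
    proof (rule subsetI)
      fix z assume "z \<in> dom ?f"
      then obtain w x where z: "z = (w, x)" and w: "w \<in> carrier W" and x: "x \<in> dom (f w)"
        using dom by (cases z) blast
      then show "z \<in> pts ?WX" using regular_mapD(1)[OF assms(1,2) assms(3)[OF w] x] by simp
    qed
    fix z assume "z \<in> dom ?f"
    then obtain w x where z: "z = (w, x)" and w: "w \<in> carrier W" and x: "x \<in> dom (f w)"
      using dom by (cases z) blast
    note m = regular_mapD[OF assms(1,2) assms(3)[OF w] x]
    show "eventually (\<lambda>y. y \<in> dom ?f) (near ?WX z)"
      unfolding z by (rule near_constant_group[OF assms(1) w m(1)]) (use m(2) w dom in simp)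
    have "(w, x) \<in> pts ?WX" using w m(1) by simp
    from morph_at_snd[OF prevar_constant_group assms(1) this]
    have "morph_at ?WX Y (w, x) (\<lambda>z. the (f w (snd z)))"
      by (rule morph_at_comp[OF pv assms(1,2)]) (use m(3) in simp)
    then show "morph_at ?WX Y z (\<lambda>y. the (?f y))"
      unfolding z
      by (rule morph_at_cong[OF pv assms(2)]) (rule near_constant_group[OF assms(1) w m(1)], simp add: w)
  qed
qed

context crystal_datum
begin

lemma weyl_action:
  "unital_rational_action (constant_group W) X (weyl_map D X \<gamma> e)"
proof -
  let ?G = "constant_group W" and ?f = "weyl_map D X \<gamma> e"
  have mon: "monoid W" by (rule group.is_monoid[OF group_W])
  note pv = prevar_prod[OF prevar_constant_group[of W] prevars(1)]
  \<comment> \<open>The same choice as in \<open>e_weyl\<close>, so that folding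
    \<open>r_def\<close> identifies the two.\<close>
  define r where "r w = (SOME is. is \<in> reduced_words D w)" for w
  have r: "r w \<in> reduced_words D w" if "w \<in> carrier W" for w
    unfolding r_def using reduced_word_exists[OF that] by (simp add: some_in_eq)
  \<comment> \<open>The regular representative of \<open>weyl_corr\<close> that
    \<open>rat_ext_props\<close> requires.\<close>
  define g where "g = (\<lambda>(w, x). if w \<in> carrier W then sigma_word (r w) x else None)"
  have g: "regular_map (?G \<times>\<^sub>v X) X g"
    unfolding g_def
    by (rule regular_map_constant_group[OF prevars(1,1) sigma_word_regular[OF reducedD(1)[OF r]]])
  have "rat_equiv (?G \<times>\<^sub>v X) (weyl_corr D X \<gamma> e) g"
    unfolding rat_equiv_iff[OF pv]
  proof (rule generic_constant_group[OF prevars(1)])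
    fix w assume w: "w \<in> carrier W"
    from e_word_eq_sigma_word[OF reducedD(1)[OF r[OF w]]]
    show "eventually (\<lambda>x. (w, x) \<in> dom (weyl_corr D X \<gamma> e) \<and> (w, x) \<in> dom g \<and>
      weyl_corr D X \<gamma> e (w, x) = g (w, x)) (generic X)"
      by eventually_elim (auto simp: w g_def weyl_corr_def e_weyl_def domIff simp flip: r_def)
  qed
  from rat_ext_props[OF pv prevars(1) variety_separated[OF var] g this]
  have rat: "rational_map (?G \<times>\<^sub>v X) X ?f" and "g \<subseteq>\<^sub>m ?f" by (simp_all add: weyl_map_def)
  then have f: "?f (w, x) = Some y" if "w \<in> carrier W" "sigma_word (r w) x = Some y" for w x y
    using that unfolding map_le_def by (auto simp: g_def domIff dest!: bspec[of _ _ "(w, x)"])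
  have one: "\<one>\<^bsub>W\<^esub> \<in> carrier W" by (rule monoid.one_closed[OF mon])
  \<comment> \<open>Unitality concerns every point of X, not only generic ones: the only reduced
    word of the identity is empty, and \<open>sigma_word []\<close> is defined on all of X.\<close>
  have f_one: "?f (\<one>\<^bsub>W\<^esub>, x) = Some x" if "x \<in> pts X" for x
    using r[OF one] that by (intro f[OF one]) (simp add: reduced_words_one)
  have "rational_action ?G X ?f"
    unfolding rational_action_def
  proof (intro conjI allI impI rat)
    fix x assume "(gone ?G, x) \<in> dom ?f"
    then have "x \<in> pts X" using rat by (auto simp: rational_map_def regular_map_def)
    then show "?f (gone ?G, x) = Some x" using f_one by simp
  next
    show "rat_equiv (?G \<times>\<^sub>v ?G \<times>\<^sub>v X) (\<lambda>(v, w, x). ?f (gmult ?G v w, x))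
      (\<lambda>(v, w, x). Option.bind (?f (w, x)) (\<lambda>y. ?f (v, y)))"
      unfolding rat_equiv_iff[OF prevar_prod[OF prevar_constant_group pv]]
    proof (intro generic_constant_group[OF pv] generic_constant_group[OF prevars(1)])
      fix v w assume v: "v \<in> carrier W" and w: "w \<in> carrier W"
      have vw: "v \<otimes>\<^bsub>W\<^esub> w \<in> carrier W" by (rule monoid.m_closed[OF mon v w])
      have "r (v \<otimes>\<^bsub>W\<^esub> w) \<in> reduced_words D (word_prod D (r v) \<otimes>\<^bsub>W\<^esub> w)"
        using r[OF vw] reducedD(2)[OF r[OF v]] by simp
      from sigma_word_mult[OF reducedD(1)[OF r[OF v]] w r[OF w] this]
      show "eventually (\<lambda>x. (v, w, x) \<in> dom (\<lambda>(v, w, x). ?f (gmult ?G v w, x)) \<and>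
        (v, w, x) \<in> dom (\<lambda>(v, w, x). Option.bind (?f (w, x)) (\<lambda>y. ?f (v, y))) \<and>
        (\<lambda>(v, w, x). ?f (gmult ?G v w, x)) (v, w, x) =
        (\<lambda>(v, w, x). Option.bind (?f (w, x)) (\<lambda>y. ?f (v, y))) (v, w, x)) (generic X)"
      proof eventually_elim
        case (elim x)
        then obtain z where z: "sigma_word (r (v \<otimes>\<^bsub>W\<^esub> w)) x = Some z" by blast
        then obtain y where "sigma_word (r w) x = Some y" "sigma_word (r v) y = Some z"
          using elim by (auto simp: bind_eq_Some_conv)
        then show ?case using f[OF vw z] f[OF w] f[OF v] by (simp add: domIff)
      qed
    qed
  qed
  moreover have "{gone ?G} \<times> pts X \<subseteq> dom ?f" using f_one by auto
  ultimately show ?thesis by (simp add: unital_rational_action_def)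
qed

end

theorem proposition2p3:
  fixes D :: "('n::finite, 'i) reductive_datum"
    and X :: "'x var"
    and \<gamma> :: "'x \<rightharpoonup> complex^'n^'n"
    and e :: "'i \<Rightarrow> complex \<times> 'x \<rightharpoonup> 'x"
  assumes "split_reductive D"
    and "geometric_crystal D X \<gamma> e"
  shows "unital_rational_action (constant_group (weyl D)) X (weyl_map D X \<gamma> e)"
proof -
  interpret crystal_datum D X \<gamma> e
    using assms by unfold_locales
  show ?thesis by (rule weyl_action)
qed

end
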